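(* There is an absolute constant $c>0$ with the following property. Let $n\ge 3$, let an endpoint-local monotone rule run on the $n$-cycle $C_n$, and let the initial integer-valued load vector have an arbitrary distribution independent of the future clocks and random marks. Then, for every $t\ge 1/n$, $$\mathbb{E}\,\operatorname{Gap}(X_t)\ge c\min\{\sqrt n,\,t^{1/4}\}$$ and $$\mathbb{P}\bigl(\operatorname{Gap}(X_t)\ge c\min\{\sqrt n,\,t^{1/4}\}\bigr)\ge \tfrac18 .$$ One may take $c=(1024\pi\sqrt3)^{-1}$.
   Context: For a finite simple graph $G=(V,E)$, load vectors (profiles) are elements $x\in\mathbb{Z}^V$, and $\operatorname{Gap}(x)=\max_{v}x_v-\min_v x_v$. An endpoint-local monotone rule on $G$ is given by, for each edge $e\in E$, a fixed orientation $(u,v)$ of $e$ and a nonincreasing function $p_e:\mathbb{Z}\to[0,1]$ (the functions may differ between edges; constant functions are allowed). The process runs in continuous time: the edges ring according to independent Poisson processes of rate one. When edge $e$ with orientation $(u,v)$ rings and the current load vector is $x$, a fresh independent mark $U$ uniform on $(0,1)$ is drawn, and one ball is added to $u$ if $U\le p_e(x_u-x_v)$ and to $v$ otherwise. $X_t$ denotes the load vector at time $t\ge0$. (Thus on $C_n$ the total event rate is $n$.) *)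

theory Defs
  imports "HOL-Probability.Probability"
begin

text \<open>A finite simple graph is given by its vertex set \<open>V\<close> and its set \<open>E\<close> of two-element edges.
  Only the values of a load vector on \<open>V\<close> matter.\<close>

definition gap :: "'v set \<Rightarrow> ('v \<Rightarrow> int) \<Rightarrow> int" where
  "gap V x = Max (x ` V) - Min (x ` V)"

definition cycle_verts :: "nat \<Rightarrow> nat set" where
  "cycle_verts n = {..<n}"

definition cycle_edges :: "nat \<Rightarrow> nat set set" where
  "cycle_edges n = (\<lambda>i. {i, Suc i mod n}) ` {..<n}"

definition endpoint_local_monotone_rule ::
    "'v set set \<Rightarrow> ('v set \<Rightarrow> 'v \<times> 'v) \<Rightarrow> ('v set \<Rightarrow> int \<Rightarrow> real) \<Rightarrow> bool" where
  "endpoint_local_monotone_rule E ori p \<longleftrightarrow>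
     (\<forall>e\<in>E. e = {fst (ori e), snd (ori e)} \<and> antimono (p e) \<and> (\<forall>d. p e d \<in> {0..1}))"

definition ring_update ::
    "('v set \<Rightarrow> 'v \<times> 'v) \<Rightarrow> ('v set \<Rightarrow> int \<Rightarrow> real) \<Rightarrow> 'v set \<Rightarrow> real \<Rightarrow> ('v \<Rightarrow> int) \<Rightarrow> ('v \<Rightarrow> int)" where
  "ring_update ori p e r x =
     (let (u, v) = ori e; w = (if r \<le> p e (x u - x v) then u else v) in x(w := x w + 1))"

text \<open>\<open>S e k\<close> is the waiting time between ring \<open>k - 1\<close> (time 0 if \<open>k = 0\<close>) and ring \<open>k\<close> of the
  edge \<open>e\<close>, and \<open>U e k\<close> is the mark drawn at ring \<open>k\<close> of \<open>e\<close>. The independent rate-one Poisson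
  processes are given by i.i.d. standard exponential waiting times.

  The product \<open>\<sigma>\<close>-algebra makes \<open>X0 \<omega>\<close> a function that is \<^term>\<open>undefined\<close> outside \<open>V\<close>; the law
  of \<open>X0\<close> is otherwise arbitrary.\<close>

locale clocks_and_marks = prob_space M
  for M :: "'w measure" and V :: "'v set" and E :: "'v set set"
    and S :: "'v set \<Rightarrow> nat \<Rightarrow> 'w \<Rightarrow> real" and U :: "'v set \<Rightarrow> nat \<Rightarrow> 'w \<Rightarrow> real"
    and X0 :: "'w \<Rightarrow> 'v \<Rightarrow> int" +
  assumes waiting_times: "e \<in> E \<Longrightarrow> distributed M lborel (S e k) (exponential_density 1)"
    and marks: "e \<in> E \<Longrightarrow> distributed M lborel (U e k) (indicator {0<..<1})"
    and indep_clocks_marks: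
      "indep_vars (\<lambda>_. borel) (case_sum (\<lambda>(e, k). S e k) (\<lambda>(e, k). U e k))
         ((E \<times> UNIV) <+> (E \<times> UNIV))"
    and initial: "X0 \<in> M \<rightarrow>\<^sub>M PiM V (\<lambda>_. count_space UNIV)"
    and indep_initial:
      "indep_set
         (sets (vimage_algebra (space M) X0 (PiM V (\<lambda>_. count_space UNIV))))
         (sets (vimage_algebra (space M)
            (\<lambda>\<omega>. \<lambda>j\<in>(E \<times> UNIV) <+> (E \<times> UNIV).
               case_sum (\<lambda>(e, k). S e k) (\<lambda>(e, k). U e k) j \<omega>)
            (PiM ((E \<times> UNIV) <+> (E \<times> UNIV)) (\<lambda>_. borel :: real measure))))"

definition ring_time :: "('v set \<Rightarrow> nat \<Rightarrow> 'w \<Rightarrow> real) \<Rightarrow> 'w \<Rightarrow> 'v set \<times> nat \<Rightarrow> real" where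
  "ring_time S \<omega> = (\<lambda>(e, k). \<Sum>j\<le>k. S e j \<omega>)"

text \<open>The rings up to time \<open>t\<close> in chronological order. A strictly sorted list of all of them is
  unique if it exists, and it fails to exist only on the null event that there are infinitely many
  rings by time \<open>t\<close> or that two of them are simultaneous; the value there is a dummy.\<close>

definition rings_upto ::
    "'v set set \<Rightarrow> ('v set \<Rightarrow> nat \<Rightarrow> 'w \<Rightarrow> real) \<Rightarrow> real \<Rightarrow> 'w \<Rightarrow> ('v set \<times> nat) list" where
  "rings_upto E S t \<omega> =
     (let chronological = (\<lambda>l. sorted_wrt (\<lambda>a b. ring_time S \<omega> a < ring_time S \<omega> b) l \<and>
                               set l = {a \<in> E \<times> UNIV. ring_time S \<omega> a \<le> t})
      in if \<exists>l. chronological l then THE l. chronological l else [])"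

definition load_process ::
    "'v set set \<Rightarrow> ('v set \<Rightarrow> 'v \<times> 'v) \<Rightarrow> ('v set \<Rightarrow> int \<Rightarrow> real) \<Rightarrow>
     ('v set \<Rightarrow> nat \<Rightarrow> 'w \<Rightarrow> real) \<Rightarrow> ('v set \<Rightarrow> nat \<Rightarrow> 'w \<Rightarrow> real) \<Rightarrow> ('w \<Rightarrow> 'v \<Rightarrow> int) \<Rightarrow>
     real \<Rightarrow> 'w \<Rightarrow> ('v \<Rightarrow> int)" where
  "load_process E ori p S U X0 t \<omega> =
     fold (\<lambda>(e, k). ring_update ori p e (U e k \<omega>)) (rings_upto E S t \<omega>) (X0 \<omega>)"

end

theory Submission
  imports Defs
begin

text \<open>Only the jump chain matters: the number of rings by time \<open>t\<close> is Poisson with mean \<open>nt\<close> and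
  independent of the chosen edges and the marks. Let \<open>F = \<Sum> \<phi>\<^sub>v x\<^sub>v\<close>, where \<open>\<phi>\<close> consists of two
  opposite tents of width \<open>2h\<close>, so that \<open>|F| \<le> h\<^sup>2 Gap\<close>, and let \<open>N\<close> be the sum over the rings of the
  mean \<open>\<psi>\<close> of \<open>\<phi>\<close> over the ringing edge. The rule has no influence on \<open>N\<close>, a symmetric random walk
  with variance about \<open>4 m h\<^sup>3 / (3 n)\<close> after \<open>m\<close> rings.

  The difference \<open>F - N\<close> fluctuates much less. By monotonicity, two rings fail to commute only if
  they put their ball on the same vertex, and then either of them alone leads to the same state.
  Hence a Hoeffding decomposition of two consecutive rings shows that the conditional variance of
  \<open>T\<^sup>k F - N\<close> in one step, where \<open>T\<close> is the transition operator, grows in \<open>k\<close> at most by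
  the average of \<open>(\<psi>\<^sub>e - \<psi>\<^sub>f)\<^sup>2\<close> over intersecting pairs of edges, which is
  of order \<open>h / n\<^sup>2\<close>. With \<open>m = n b\<^sup>2\<close>, \<open>h = 100 b\<close> and \<open>b\<close> of order \<open>min n (sqrt t)\<close>, \<open>F\<close> is of order
  \<open>b\<^sup>5\<^sup>/\<^sup>2\<close> and the gap of order \<open>sqrt b\<close>. The bounds hold from every initial state, so they survive the
  rings before the last \<open>m\<close> by conditioning. For small \<open>n\<close> or \<open>t\<close> it suffices that the gap is
  positive unless \<open>n\<close> divides the total load.\<close>

section \<open>A variance inequality for two exchangeable steps\<close>

text \<open>The rule leaves the drift of \<open>F\<close> uncontrolled, so its mean \<open>a\<close>
  is never estimated; what is needed are lower bounds for \<open>a + N\<close> uniform in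
  \<open>a\<close>. The opposite signs of the tents serve twice. They make \<open>F\<close>
  insensitive to a constant load, hence controlled by the gap, and they make the law of
  \<open>N\<close> symmetric: since one of \<open>\<bar>a + z\<bar>\<close>,
  \<open>\<bar>a - z\<bar>\<close> is at least \<open>\<bar>z\<bar>\<close>, averaging over
  \<open>z\<close> and \<open>-z\<close> removes \<open>a\<close>, and the second and fourth moments
  of \<open>N\<close> suffice. The variance of \<open>N\<close> is linear in \<open>m\<close>, but
  the bound for that of \<open>F - N\<close> is essentially quadratic, about
  \<open>4 * m\<^sup>2 * h / n\<^sup>2\<close>. Their ratio is about
  \<open>3 * m / (n * h\<^sup>2)\<close>, so \<open>m\<close> must stay below a small multiple of
  \<open>n * h\<^sup>2\<close>, while \<open>4 * h \<le> n\<close> for the tents to fit. Hence only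
  the last \<open>m\<close> rings are used, and the bound stops growing at \<open>sqrt n\<close>.
  With \<open>h = 100 * b\<close> the ratio is about 3/10000, whatever \<open>n\<close> is. The law
  of the process is found by summing over all finite edge sequences, each integrated explicitly over
  its clocks and marks.\<close>

text \<open>For independent \<open>a\<close>, \<open>b\<close> with law \<open>q\<close> this bounds
  the variance of the row mean \<open>f\<close> by the mean over \<open>a\<close> of the variance of
  \<open>H a b\<close> in \<open>b\<close>, plus an error supported on the pairs where
  \<open>H\<close> is not symmetric. For symmetric \<open>H\<close> it is the positivity of the
  second-order term of the Hoeffding decomposition.\<close>

lemma two_step_variance:
  fixes A :: "'a set" and q :: "'a \<Rightarrow> real" and H D :: "'a \<Rightarrow> 'a \<Rightarrow> real"
  defines "f \<equiv> \<lambda>a. \<Sum>b\<in>A. q b * H a b"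
  assumes fin: "finite A" and q0: "\<And>a. a \<in> A \<Longrightarrow> 0 \<le> q a" and q1: "sum q A = 1"
    and D: "\<And>a b. a \<in> A \<Longrightarrow> b \<in> A \<Longrightarrow> H a b \<noteq> H b a \<Longrightarrow> f b - f a = D a b"
  shows "2 * (\<Sum>a\<in>A. q a * (f a)\<^sup>2) \<le>
    (\<Sum>a\<in>A. q a * (\<Sum>b\<in>A. q b * (H a b)\<^sup>2)) + (\<Sum>a\<in>A. q a * f a)\<^sup>2
    + (\<Sum>a\<in>A. q a * (\<Sum>b\<in>A. q b * (if H a b \<noteq> H b a then (D a b)\<^sup>2 else 0)))"
proof -
  define EE where "EE G = (\<Sum>a\<in>A. q a * (\<Sum>b\<in>A. q b * G a b))" for G :: "'a \<Rightarrow> 'a \<Rightarrow> real"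
  define \<mu> where "\<mu> = (\<Sum>a\<in>A. q a * f a)"
  define K where "K a b = (if H a b \<noteq> H b a then (D a b)\<^sup>2 else 0)" for a b
  have add: "EE (\<lambda>a b. G a b + G' a b) = EE G + EE G'" for G G'
    by (simp add: EE_def distrib_left sum.distrib)
  have cm: "EE (\<lambda>a b. c * G a b) = c * EE G" for c G
    by (simp add: EE_def sum_distrib_left algebra_simps)
  have swap: "EE (\<lambda>a b. G b a) = EE G" for G
    unfolding EE_def sum_distrib_left by (subst sum.swap) (simp add: algebra_simps)
  have left: "EE (\<lambda>a b. g a) = (\<Sum>a\<in>A. q a * g a)" for g
    by (simp add: EE_def sum_distrib_right[symmetric] q1)
  have const: "EE (\<lambda>a b. c) = c" for c
    using left[of "\<lambda>_. c"] q1 by (simp add: sum_distrib_right[symmetric])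
  have right: "EE (\<lambda>a b. g b) = (\<Sum>a\<in>A. q a * g a)" for g
    by (simp add: EE_def sum_distrib_right[symmetric] q1)
  have prod: "EE (\<lambda>a b. f a * f b) = \<mu>\<^sup>2"
    by (simp add: EE_def \<mu>_def power2_eq_square sum_distrib_left sum_distrib_right algebra_simps)
  have Hf: "EE (\<lambda>a b. H a b * f a) = (\<Sum>a\<in>A. q a * (f a)\<^sup>2)"
    by (simp add: EE_def f_def power2_eq_square sum_distrib_left sum_distrib_right algebra_simps)
  have HfT: "EE (\<lambda>a b. H b a * f b) = (\<Sum>a\<in>A. q a * (f a)\<^sup>2)"
    using swap[of "\<lambda>a b. H a b * f a"] Hf by simp
  have H1: "EE H = \<mu>" by (simp add: EE_def \<mu>_def f_def)
  have H1T: "EE (\<lambda>a b. H b a) = \<mu>" using swap[of H] H1 by simp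
  have H2T: "EE (\<lambda>a b. (H b a)\<^sup>2) = EE (\<lambda>a b. (H a b)\<^sup>2)"
    by (rule swap)
  \<comment> \<open>This is the expansion of the two nonnegative terms in \<open>point\<close>. They
    are chosen so that the products \<open>H a b * f b\<close> and \<open>H b a * f a\<close>, whose
    means would involve column means of \<open>H\<close>, cancel.\<close>
  define W where "W a b = (1/2) * (H a b)\<^sup>2 + ((1/2) * (H b a)\<^sup>2 + (K a b + ((f a)\<^sup>2 + ((f b)\<^sup>2 +
      (2 * (f a * f b) + (\<mu>\<^sup>2 + (\<mu> * H a b + (\<mu> * H b a + ((-2*\<mu>) * f a + ((-2*\<mu>) * f b +
      ((-2) * (H a b * f a) + (-2) * (H b a * f b))))))))))))" for a b
  have point: "0 \<le> W a b" if "a \<in> A" "b \<in> A" for a b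
  proof -
    have *: "0 \<le> K a b + (H a b - H b a)\<^sup>2 / 4 + (H a b - H b a) * (f b - f a)"
    proof (cases "H a b = H b a")
      case False
      have "K a b = (f b - f a)\<^sup>2" using D[OF that False] False by (simp add: K_def)
      moreover have "0 \<le> ((H a b - H b a) / 2 + (f b - f a))\<^sup>2" by simp
      ultimately show ?thesis by (simp add: power2_eq_square field_simps)
    qed (simp add: K_def)
    have **: "0 \<le> ((H a b + H b a) / 2 - f a - f b + \<mu>)\<^sup>2" by simp
    have "W a b = ((H a b + H b a) / 2 - f a - f b + \<mu>)\<^sup>2
      + (K a b + (H a b - H b a)\<^sup>2 / 4 + (H a b - H b a) * (f b - f a))"
      unfolding W_def by (simp add: power2_eq_square field_simps)
    then show ?thesis using * ** by linarith
  qed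
  have "0 \<le> EE W"
    unfolding EE_def using point q0 by (intro sum_nonneg mult_nonneg_nonneg) auto
  also have "EE W = EE (\<lambda>a b. (H a b)\<^sup>2) + \<mu>\<^sup>2 + EE K - 2 * (\<Sum>a\<in>A. q a * (f a)\<^sup>2)"
    unfolding W_def add cm
    unfolding left[of "\<lambda>a. (f a)\<^sup>2"] right[of "\<lambda>a. (f a)\<^sup>2"] left[of f] right[of f]
      prod Hf HfT H1 H1T H2T const \<mu>_def[symmetric]
    by (simp add: power2_eq_square algebra_simps)
  finally show ?thesis by (simp add: EE_def K_def[abs_def] \<mu>_def)
qed

section \<open>The embedded chain\<close>

definition ring_choice ::
    "('v set \<Rightarrow> 'v \<times> 'v) \<Rightarrow> ('v set \<Rightarrow> int \<Rightarrow> real) \<Rightarrow> 'v set \<Rightarrow> real \<Rightarrow> ('v \<Rightarrow> int) \<Rightarrow> 'v" where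
  "ring_choice ori p e r x =
     (if r \<le> p e (x (fst (ori e)) - x (snd (ori e))) then fst (ori e) else snd (ori e))"

lemma ring_update_choice:
  "ring_update ori p e r x = (let w = ring_choice ori p e r x in x(w := x w + 1))"
  by (simp add: ring_update_def ring_choice_def split_beta Let_def)

locale local_rule =
  fixes E :: "'v set set" and ori :: "'v set \<Rightarrow> 'v \<times> 'v" and p :: "'v set \<Rightarrow> int \<Rightarrow> real"
  assumes finite_E: "finite E" and E_ne: "E \<noteq> {}" and rule: "endpoint_local_monotone_rule E ori p"
begin

definition edge_diff :: "'v set \<Rightarrow> ('v \<Rightarrow> int) \<Rightarrow> int" where
  "edge_diff e x = x (fst (ori e)) - x (snd (ori e))"

definition edge_mean :: "'v set \<Rightarrow> (('v \<Rightarrow> int) \<Rightarrow> real) \<Rightarrow> ('v \<Rightarrow> int) \<Rightarrow> real" where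
  "edge_mean e f x = p e (edge_diff e x) * f (x(fst (ori e) := x (fst (ori e)) + 1))
     + (1 - p e (edge_diff e x)) * f (x(snd (ori e) := x (snd (ori e)) + 1))"

definition mean_step :: "(('v \<Rightarrow> int) \<Rightarrow> real) \<Rightarrow> ('v \<Rightarrow> int) \<Rightarrow> real" where
  "mean_step f x = (\<Sum>e\<in>E. edge_mean e f x) / real (card E)"

text \<open>The second argument of \<open>f\<close> accumulates the weights of the edges that ring.\<close>

definition weighted_step ::
    "('v set \<Rightarrow> real) \<Rightarrow> (('v \<Rightarrow> int) \<Rightarrow> real \<Rightarrow> real) \<Rightarrow> ('v \<Rightarrow> int) \<Rightarrow> real \<Rightarrow> real" where
  "weighted_step \<psi> f x y = (\<Sum>e\<in>E. edge_mean e (\<lambda>x'. f x' (y + \<psi> e)) x) / real (card E)"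

text \<open>For weights with sum 0 over \<open>E\<close> this is the variance, over one step from
  \<open>x\<close>, of \<open>w\<close> minus the weight of the ringing edge.\<close>

definition step_var :: "('v set \<Rightarrow> real) \<Rightarrow> (('v \<Rightarrow> int) \<Rightarrow> real) \<Rightarrow> ('v \<Rightarrow> int) \<Rightarrow> real" where
  "step_var \<psi> w x =
     (\<Sum>e\<in>E. edge_mean e (\<lambda>x'. (w x' - \<psi> e)\<^sup>2) x) / real (card E) - (mean_step w x)\<^sup>2"

definition edge_interaction :: "('v set \<Rightarrow> real) \<Rightarrow> real" where
  "edge_interaction \<psi> =
     (\<Sum>e\<in>E. \<Sum>f\<in>E. if e \<inter> f \<noteq> {} then (\<psi> e - \<psi> f)\<^sup>2 else 0) / (real (card E))\<^sup>2"

lemma card_pos: "real (card E) > 0"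
  using finite_E E_ne by (simp add: card_gt_0_iff)

lemma edge_eq: "e \<in> E \<Longrightarrow> e = {fst (ori e), snd (ori e)}"
  using rule by (auto simp: endpoint_local_monotone_rule_def)

lemma p_antimono: "e \<in> E \<Longrightarrow> d \<le> d' \<Longrightarrow> p e d' \<le> p e d"
  using rule by (auto simp: endpoint_local_monotone_rule_def antimono_def)

lemma p_nonneg: "e \<in> E \<Longrightarrow> 0 \<le> p e d" and p_le_1: "e \<in> E \<Longrightarrow> p e d \<le> 1"
  using rule by (auto simp: endpoint_local_monotone_rule_def)

lemma choice_in_edge: "e \<in> E \<Longrightarrow> ring_choice ori p e r x \<in> e"
  by (subst edge_eq) (auto simp: ring_choice_def)

text \<open>Monotonicity of the rule enters only here.\<close>

lemma choice_stable:
  assumes "e \<in> E" "v \<noteq> ring_choice ori p e r x"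
  shows "ring_choice ori p e r (x(v := x v + 1)) = ring_choice ori p e r x"
proof (cases "fst (ori e) = snd (ori e)")
  case True
  then show ?thesis by (simp add: ring_choice_def)
next
  case False
  have "p e (x (fst (ori e)) - x (snd (ori e))) \<le> p e (x (fst (ori e)) - (x (snd (ori e)) + 1))"
    "p e ((x (fst (ori e)) + 1) - x (snd (ori e))) \<le> p e (x (fst (ori e)) - x (snd (ori e)))"
    by (rule p_antimono[OF assms(1)], simp)+
  then show ?thesis using assms(2) False by (auto simp: ring_choice_def split: if_splits)
qed

text \<open>Each ring adds its ball away from the vertex chosen by the other, so by
  \<open>choice_stable\<close> neither choice depends on the order.\<close>

lemma updates_commute:
  assumes "e \<in> E" "f \<in> E" "ring_choice ori p e r x \<noteq> ring_choice ori p f s x"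
  shows "ring_update ori p f s (ring_update ori p e r x)
       = ring_update ori p e r (ring_update ori p f s x)"
  using choice_stable[OF assms(1), of "ring_choice ori p f s x" r x]
    choice_stable[OF assms(2), of "ring_choice ori p e r x" s x] assms(3)
  by (auto simp: ring_update_choice Let_def fun_upd_twist)

text \<open>As far as the states reached from \<open>x\<close> by at most one ring are concerned, the mark of the
  edge \<open>e\<close> may be replaced by one with the four values \<open>mark x e i\<close> taken with the probabilities
  \<open>mark_prob x e i\<close>.\<close>

definition mark :: "('v \<Rightarrow> int) \<Rightarrow> 'v set \<Rightarrow> nat \<Rightarrow> real" where
  "mark x e i = (if i = 0 then p e (edge_diff e x + 1) else if i = 1 then p e (edge_diff e x)
     else if i = 2 then p e (edge_diff e x - 1) else 2)"

definition mark_prob :: "('v \<Rightarrow> int) \<Rightarrow> 'v set \<Rightarrow> nat \<Rightarrow> real" where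
  "mark_prob x e i = (if i = 0 then p e (edge_diff e x + 1)
     else if i = 1 then p e (edge_diff e x) - p e (edge_diff e x + 1)
     else if i = 2 then p e (edge_diff e x - 1) - p e (edge_diff e x)
     else 1 - p e (edge_diff e x - 1))"

lemma mark_prob_nonneg: "e \<in> E \<Longrightarrow> 0 \<le> mark_prob x e i"
  by (auto simp: mark_prob_def p_nonneg p_le_1 p_antimono)

lemma sum_mark_prob: "(\<Sum>i<4. mark_prob x e i) = 1"
  by (simp add: mark_prob_def eval_nat_numeral)

text \<open>One ball changes the difference across \<open>e\<close> by at most 1, so a uniform mark
  matters only through its position relative to three thresholds of \<open>p e\<close>. One
  representative per interval, built at \<open>x\<close>, serves for the next state too, so two
  consecutive rings become independent draws from one finite set. The value 2 exceeds every
  probability and always selects the second endpoint.\<close>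

lemma mark_mean:
  assumes e: "e \<in> E" and y: "\<bar>edge_diff e y - edge_diff e x\<bar> \<le> 1"
  shows "(\<Sum>i<4. mark_prob x e i * g (ring_update ori p e (mark x e i) y)) = edge_mean e g y"
proof -
  let ?d = "edge_diff e x"
  have *: "p e (?d + 1) \<le> p e ?d" "p e ?d \<le> p e (?d - 1)" "p e (?d - 1) < 2" "p e ?d < 2" "p e (?d + 1) < 2"
    using p_antimono[OF e] p_le_1[OF e, of "?d - 1"] p_le_1[OF e, of "?d"] p_le_1[OF e, of "?d + 1"]
    by auto
  have up: "ring_update ori p e r y = (if r \<le> p e (edge_diff e y) then y(fst (ori e) := y (fst (ori e)) + 1)
      else y(snd (ori e) := y (snd (ori e)) + 1))" for r
    by (simp add: ring_update_def split_beta edge_diff_def Let_def)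
  define a b c P where abc: "a = p e (?d + 1)" "b = p e ?d" "c = p e (?d - 1)" "P = p e (edge_diff e y)"
  consider "edge_diff e y = ?d - 1" | "edge_diff e y = ?d" | "edge_diff e y = ?d + 1" using y by linarith
  then have "P = a \<or> P = b \<or> P = c" by cases (auto simp: abc)
  moreover have "a < b \<or> a = b" "b < c \<or> b = c" "a < 2" "b < 2" "c < 2"
    using * by (auto simp: abc)
  ultimately show ?thesis
    unfolding mark_def mark_prob_def edge_mean_def up abc[symmetric]
    by (elim disjE) (simp_all add: eval_nat_numeral algebra_simps)
qed

lemma edge_diff_add: "\<bar>edge_diff e (x(v := x v + 1)) - edge_diff e x\<bar> \<le> 1"
  by (auto simp: edge_diff_def)

lemma sum_mark_pairs:
  "(\<Sum>a\<in>E \<times> {..<4}. (case a of (e, i) \<Rightarrow> mark_prob x e i / real (card E)) * g a)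
     = (\<Sum>e\<in>E. \<Sum>i<4. mark_prob x e i * g (e, i)) / real (card E)"
  by (simp add: sum.cartesian_product' sum_divide_distrib split_beta)

text \<open>\<open>two_step_variance\<close> is applied to two consecutive rings from
  \<open>x\<close>, each a pair of an edge and a mark value. The variance of \<open>f\<close> is the
  left-hand side, and the mean of \<open>H\<^sup>2\<close> minus that of \<open>f\<^sup>2\<close> is
  \<open>mean_step (step_var \<psi> w) x\<close>.\<close>

lemma step_var_mean_step:
  assumes \<psi>0: "sum \<psi> E = 0"
  shows "step_var \<psi> (mean_step w) x \<le> mean_step (step_var \<psi> w) x + edge_interaction \<psi>"
proof -
  define D where "D = real (card E)"
  have D: "D > 0" using card_pos by (simp add: D_def)
  define A where "A = E \<times> {..<4::nat}"
  define q where "q a = (case a of (e, i) \<Rightarrow> mark_prob x e i / real (card E))" for a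
  define up where "up a = ring_update ori p (fst a) (mark x (fst a) (snd a))" for a
  define H where "H a b = w (up b (up a x)) - \<psi> (fst a) - \<psi> (fst b)" for a b
  define f where "f a = (\<Sum>b\<in>A. q b * H a b)" for a
  have one: "\<bar>edge_diff e' (up a x) - edge_diff e' x\<bar> \<le> 1" for e' a
    unfolding up_def ring_update_choice Let_def by (rule edge_diff_add)
  have q1: "sum q A = 1"
    using sum_mark_pairs[of x "\<lambda>_. 1"] card_pos
    by (simp add: q_def A_def sum_mark_prob cong: sum.cong)
  \<comment> \<open>The marks built at \<open>x\<close> also average correctly at
    \<open>up a x\<close>, where every edge difference is within 1 of its value at
    \<open>x\<close>.\<close>
  have EA: "(\<Sum>b\<in>A. q b * g (fst b) (up b y)) = (\<Sum>e\<in>E. edge_mean e (g e) y) / D"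
    if "\<And>e. \<bar>edge_diff e y - edge_diff e x\<bar> \<le> 1" for g y
    unfolding q_def A_def sum_mark_pairs D_def up_def
    by (intro arg_cong[where f="\<lambda>z. z / _"] sum.cong) (simp_all add: mark_mean[OF _ that])
  have EAx: "(\<Sum>b\<in>A. q b * g (fst b) (up b x)) = (\<Sum>e\<in>E. edge_mean e (g e) x) / D" for g
    by (rule EA) simp
  have EAa: "(\<Sum>b\<in>A. q b * g (fst b) (up b (up a x))) = (\<Sum>e\<in>E. edge_mean e (g e) (up a x)) / D" for g a
    by (rule EA[OF one])
  have em_const: "edge_mean e (\<lambda>_. c) y = c" for e c y
    by (simp add: edge_mean_def algebra_simps)
  have Epsi: "(\<Sum>b\<in>A. q b * \<psi> (fst b)) = 0"
    using EAx[of "\<lambda>e _. \<psi> e"] by (simp add: em_const \<psi>0)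
  have f_eq: "f a = mean_step w (up a x) - \<psi> (fst a)" for a
  proof -
    have "f a = (\<Sum>b\<in>A. q b * w (up b (up a x))) - (\<Sum>b\<in>A. q b) * \<psi> (fst a) - (\<Sum>b\<in>A. q b * \<psi> (fst b))"
      by (simp add: f_def H_def right_diff_distrib sum_subtractf sum_distrib_right)
    then show ?thesis using EAa[of "\<lambda>_. w" a] q1 Epsi by (simp add: mean_step_def D_def)
  qed
  have "finite A" "\<And>a. a \<in> A \<Longrightarrow> 0 \<le> q a"
    using finite_E by (auto simp: A_def q_def mark_prob_nonneg divide_nonneg_nonneg)
  note fA = this
  \<comment> \<open>If \<open>H\<close> is not symmetric at \<open>a\<close>, \<open>b\<close>, both
    rings choose the same vertex, so \<open>up a x = up b x\<close> and the values of
    \<open>f\<close> differ only by the weights of the edges.\<close>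
  have comm: "f b - f a = \<psi> (fst a) - \<psi> (fst b) \<and> fst a \<inter> fst b \<noteq> {}"
    if "a \<in> A" "b \<in> A" "H a b \<noteq> H b a" for a b
  proof -
    have e: "fst a \<in> E" "fst b \<in> E" using that by (auto simp: A_def)
    have ch: "ring_choice ori p (fst a) (mark x (fst a) (snd a)) x
        = ring_choice ori p (fst b) (mark x (fst b) (snd b)) x"
    proof (rule ccontr)
      assume "\<not> ?thesis"
      then have "up b (up a x) = up a (up b x)" unfolding up_def by (rule updates_commute[OF e])
      then show False using that(3) by (simp add: H_def)
    qed
    then have "up a x = up b x" by (simp add: up_def ring_update_choice)
    moreover have "fst a \<inter> fst b \<noteq> {}"
      using ch choice_in_edge[OF e(1)] choice_in_edge[OF e(2)] by (metis disjoint_iff)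
    ultimately show ?thesis by (simp add: f_eq)
  qed
  have main: "2 * (\<Sum>a\<in>A. q a * (f a)\<^sup>2) \<le>
    (\<Sum>a\<in>A. q a * (\<Sum>b\<in>A. q b * (H a b)\<^sup>2)) + (\<Sum>a\<in>A. q a * f a)\<^sup>2
    + (\<Sum>a\<in>A. q a * (\<Sum>b\<in>A. q b * (if H a b \<noteq> H b a then (\<psi> (fst a) - \<psi> (fst b))\<^sup>2 else 0)))"
    unfolding f_def by (rule two_step_variance[OF fA q1]) (use comm in \<open>auto simp: f_def\<close>)
  have "(\<Sum>a\<in>A. q a * (\<Sum>b\<in>A. q b * (if H a b \<noteq> H b a then (\<psi> (fst a) - \<psi> (fst b))\<^sup>2 else 0)))
    \<le> (\<Sum>a\<in>A. q a * (\<Sum>b\<in>A. q b * (if fst a \<inter> fst b \<noteq> {} then (\<psi> (fst a) - \<psi> (fst b))\<^sup>2 else 0)))"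
    by (intro sum_mono mult_left_mono fA) (use comm in auto)
  also have "\<dots> = (\<Sum>a\<in>A. q a * ((\<Sum>f\<in>E. if fst a \<inter> f \<noteq> {} then (\<psi> (fst a) - \<psi> f)\<^sup>2 else 0) / D))"
    by (intro sum.cong refl arg_cong2[where f="(*)"])
       (use EAx[of "\<lambda>f _. if fst a \<inter> f \<noteq> {} then (\<psi> (fst a) - \<psi> f)\<^sup>2 else 0" for a] in \<open>simp add: em_const\<close>)
  also have "\<dots> = edge_interaction \<psi>"
    using EAx[of "\<lambda>e _. (\<Sum>f\<in>E. if e \<inter> f \<noteq> {} then (\<psi> e - \<psi> f)\<^sup>2 else 0) / D"]
    by (simp add: em_const edge_interaction_def D_def sum_divide_distrib power2_eq_square)
  finally have K: "(\<Sum>a\<in>A. q a * (\<Sum>b\<in>A. q b * (if H a b \<noteq> H b a then (\<psi> (fst a) - \<psi> (fst b))\<^sup>2 else 0)))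
    \<le> edge_interaction \<psi>" .
  define s where "s y = (\<Sum>e\<in>E. edge_mean e (\<lambda>x'. (w x' - \<psi> e)\<^sup>2) y) / D" for y
  define t where "t y = (\<Sum>e\<in>E. edge_mean e (\<lambda>x'. w x' - \<psi> e) y) / D" for y
  have t_eq: "t (up a x) = mean_step w (up a x)" for a
    using EAa[of "\<lambda>e x'. w x' - \<psi> e" a] EAa[of "\<lambda>e x'. w x'" a] Epsi
    by (auto simp: t_def mean_step_def D_def right_diff_distrib sum_subtractf)
  have H2: "(\<Sum>b\<in>A. q b * (H a b)\<^sup>2) = s (up a x) - 2 * \<psi> (fst a) * t (up a x) + (\<psi> (fst a))\<^sup>2" for a
  proof -
    have "(\<Sum>b\<in>A. q b * (H a b)\<^sup>2) = (\<Sum>b\<in>A. q b * (w (up b (up a x)) - \<psi> (fst b))\<^sup>2)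
       - 2 * \<psi> (fst a) * (\<Sum>b\<in>A. q b * (w (up b (up a x)) - \<psi> (fst b))) + (\<Sum>b\<in>A. q b) * (\<psi> (fst a))\<^sup>2"
      unfolding sum_distrib_left sum_distrib_right sum_subtractf[symmetric] sum.distrib[symmetric]
      by (intro sum.cong refl) (simp add: H_def power2_eq_square algebra_simps)
    then show ?thesis
      using EAa[of "\<lambda>e x'. (w x' - \<psi> e)\<^sup>2" a] EAa[of "\<lambda>e x'. w x' - \<psi> e" a] q1
      by (simp add: s_def t_def)
  qed
  have 1: "step_var \<psi> (mean_step w) x = (\<Sum>a\<in>A. q a * (f a)\<^sup>2) - (\<Sum>a\<in>A. q a * f a)\<^sup>2"
  proof -
    have "(\<Sum>a\<in>A. q a * f a) = (\<Sum>a\<in>A. q a * mean_step w (up a x)) - (\<Sum>a\<in>A. q a * \<psi> (fst a))"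
      by (simp add: f_eq right_diff_distrib sum_subtractf)
    then have "(\<Sum>a\<in>A. q a * f a) = mean_step (mean_step w) x"
      using EAx[of "\<lambda>_. mean_step w"] Epsi by (simp add: mean_step_def[of "mean_step w"] D_def)
    then show ?thesis
      using EAx[of "\<lambda>e x'. (mean_step w x' - \<psi> e)\<^sup>2"] by (simp add: f_eq step_var_def D_def)
  qed
  have 2: "mean_step (step_var \<psi> w) x
      = (\<Sum>a\<in>A. q a * (\<Sum>b\<in>A. q b * (H a b)\<^sup>2)) - (\<Sum>a\<in>A. q a * (f a)\<^sup>2)"
  proof -
    have "mean_step (step_var \<psi> w) x = (\<Sum>a\<in>A. q a * step_var \<psi> w (up a x))"
      using EAx[of "\<lambda>_. step_var \<psi> w"] by (simp add: mean_step_def[of "step_var \<psi> w"] D_def)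
    moreover have "step_var \<psi> w (up a x) = s (up a x) - (mean_step w (up a x))\<^sup>2" for a
      by (simp add: step_var_def s_def D_def)
    then have "(\<Sum>a\<in>A. q a * step_var \<psi> w (up a x)) = (\<Sum>a\<in>A. q a * ((\<Sum>b\<in>A. q b * (H a b)\<^sup>2) - (f a)\<^sup>2))"
      by (intro sum.cong refl arg_cong2[where f="(*)"])
         (simp add: H2 f_eq t_eq power2_diff)
    ultimately show ?thesis by (simp add: right_diff_distrib sum_subtractf)
  qed
  show ?thesis using main K unfolding 1 2 by linarith
qed

section \<open>Averages over runs of the chain with accumulated weights\<close>

lemma edge_mean_mono: "e \<in> E \<Longrightarrow> (\<And>x. f x \<le> g x) \<Longrightarrow> edge_mean e f x \<le> edge_mean e g x"
  unfolding edge_mean_def by (intro add_mono mult_left_mono) (auto simp: p_nonneg p_le_1)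

lemma edge_mean_add: "edge_mean e (\<lambda>x. f x + g x) x = edge_mean e f x + edge_mean e g x"
  and edge_mean_cmult: "edge_mean e (\<lambda>x. c * f x) x = c * edge_mean e f x"
  and edge_mean_const: "edge_mean e (\<lambda>_. c) x = c"
  by (simp_all add: edge_mean_def algebra_simps)

text \<open>A backward operator: the factor applied first to the observable is the last ring in
  time. Inductions therefore peel off the last ring and generalise over the observable.\<close>

definition weighted_run ::
    "('v set \<Rightarrow> real) \<Rightarrow> nat \<Rightarrow> (('v \<Rightarrow> int) \<Rightarrow> real \<Rightarrow> real) \<Rightarrow> ('v \<Rightarrow> int) \<Rightarrow> real \<Rightarrow> real" where
  "weighted_run \<psi> m = weighted_step \<psi> ^^ m"

lemma weighted_run_0: "weighted_run \<psi> 0 f = f"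
  by (simp add: weighted_run_def)

lemma weighted_run_Suc: "weighted_run \<psi> (Suc m) f = weighted_run \<psi> m (weighted_step \<psi> f)"
  by (simp add: weighted_run_def funpow_swap1)

lemma weighted_step_mono: "(\<And>x y. f x y \<le> g x y) \<Longrightarrow> weighted_step \<psi> f x y \<le> weighted_step \<psi> g x y"
  unfolding weighted_step_def by (intro divide_right_mono sum_mono edge_mean_mono) auto

lemma weighted_step_add:
  "weighted_step \<psi> (\<lambda>x y. f x y + g x y) = (\<lambda>x y. weighted_step \<psi> f x y + weighted_step \<psi> g x y)"
  by (intro ext) (simp add: weighted_step_def edge_mean_add sum.distrib add_divide_distrib)

lemma weighted_step_cmult:
  "weighted_step \<psi> (\<lambda>x y. c * f x y) = (\<lambda>x y. c * weighted_step \<psi> f x y)"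
  by (intro ext) (simp add: weighted_step_def edge_mean_cmult sum_distrib_left[symmetric])

lemma weighted_step_weight:
  "weighted_step \<psi> (\<lambda>_. g) = (\<lambda>x y. (\<Sum>e\<in>E. g (y + \<psi> e)) / real (card E))"
  by (intro ext) (simp add: weighted_step_def edge_mean_const)

lemma weighted_step_state: "weighted_step \<psi> (\<lambda>x _. \<phi> x) = (\<lambda>x _. mean_step \<phi> x)"
  by (intro ext) (simp add: weighted_step_def mean_step_def)

lemma weighted_run_mono:
  "(\<And>x y. f x y \<le> g x y) \<Longrightarrow> weighted_run \<psi> m f x y \<le> weighted_run \<psi> m g x y"
proof (induction m arbitrary: f g)
  case (Suc m)
  show ?case unfolding weighted_run_Suc by (intro Suc.IH weighted_step_mono Suc.prems)
qed (simp add: weighted_run_0)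

lemma weighted_run_add:
  "weighted_run \<psi> m (\<lambda>x y. f x y + g x y) x y = weighted_run \<psi> m f x y + weighted_run \<psi> m g x y"
  by (induction m arbitrary: f g) (simp_all add: weighted_run_0 weighted_run_Suc weighted_step_add)

lemma weighted_run_cmult:
  "weighted_run \<psi> m (\<lambda>x y. c * f x y) x y = c * weighted_run \<psi> m f x y"
  by (induction m arbitrary: f) (simp_all add: weighted_run_0 weighted_run_Suc weighted_step_cmult)

lemma weighted_run_state: "weighted_run \<psi> m (\<lambda>x _. \<phi> x) x y = (mean_step ^^ m) \<phi> x"
  by (induction m arbitrary: \<phi>)
     (simp_all add: weighted_run_0 weighted_run_Suc weighted_step_state funpow_swap1)

lemma weighted_run_const: "weighted_run \<psi> m (\<lambda>_ _. c) x y = c"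
  by (induction m) (use card_pos in \<open>simp_all add: weighted_run_0 weighted_run_Suc weighted_step_weight\<close>)

lemma mean_step_le_const: "(\<And>x. f x \<le> c) \<Longrightarrow> mean_step f x \<le> c"
  using weighted_step_mono[of "\<lambda>x _. f x" "\<lambda>_ _. c" \<psi> x y for \<psi> y] card_pos
  unfolding weighted_step_state by (simp add: mean_step_def[of "\<lambda>_. c"] edge_mean_const)

lemma funpow_mean_step_ge_const: "(\<And>x. c \<le> f x) \<Longrightarrow> c \<le> (mean_step ^^ m) f x"
  using weighted_run_mono[of "\<lambda>_ _. c" "\<lambda>x _. f x" \<psi> m x y for \<psi> y]
  unfolding weighted_run_state[of _ _ f] weighted_run_const by blast

lemma weighted_step_shift: "weighted_step \<psi> f x (y + a) = weighted_step \<psi> (\<lambda>x y. f x (y + a)) x y"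
  by (simp add: weighted_step_def algebra_simps)

lemma weighted_run_shift: "weighted_run \<psi> m f x (y + a) = weighted_run \<psi> m (\<lambda>x y. f x (y + a)) x y"
  by (induction m arbitrary: f) (simp_all add: weighted_run_0 weighted_run_Suc weighted_step_shift)

text \<open>The weights have mean 0, so the accumulator \<open>y\<close> is compared with the mean
  of \<open>w\<close> only, and the rest is the fluctuation of \<open>w\<close> minus the
  weight.\<close>

lemma weighted_step_square:
  assumes \<psi>0: "sum \<psi> E = 0"
  shows "weighted_step \<psi> (\<lambda>x y. (w x - y)\<^sup>2) x y = step_var \<psi> w x + (mean_step w x - y)\<^sup>2"
proof -
  have *: "edge_mean e (\<lambda>x'. (w x' - (y + \<psi> e))\<^sup>2) x = edge_mean e (\<lambda>x'. (w x' - \<psi> e)\<^sup>2) x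
     + (-2 * y) * edge_mean e w x + (2 * y) * \<psi> e + y\<^sup>2" for e
    by (simp add: edge_mean_def power2_eq_square algebra_simps)
  have "weighted_step \<psi> (\<lambda>x y. (w x - y)\<^sup>2) x y
     = (\<Sum>e\<in>E. edge_mean e (\<lambda>x'. (w x' - \<psi> e)\<^sup>2) x) / real (card E)
       + (-2 * y) * mean_step w x + (2 * y) * sum \<psi> E / real (card E) + y\<^sup>2"
    unfolding weighted_step_def * sum.distrib sum_distrib_left[symmetric] add_divide_distrib mean_step_def
    using card_pos by simp
  then show ?thesis
    using \<psi>0 by (simp add: step_var_def power2_eq_square algebra_simps)
qed

text \<open>Peeling off the last \<open>j\<close> rings replaces \<open>w\<close> by
  \<open>(mean_step ^^ j) w\<close>, whose \<open>step_var\<close> is at most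
  \<open>\<rho> + j * edge_interaction \<psi>\<close> by \<open>step_var_mean_step\<close>. Summing
  over \<open>j < m\<close> gives the last two terms; the square is the remaining bias.\<close>

lemma weighted_run_square:
  assumes \<psi>0: "sum \<psi> E = 0" and "\<And>x. step_var \<psi> w x \<le> \<rho>"
  shows "weighted_run \<psi> m (\<lambda>x y. (w x - y)\<^sup>2) x y
    \<le> ((mean_step ^^ m) w x - y)\<^sup>2 + real m * \<rho> + real m * (real m - 1) / 2 * edge_interaction \<psi>"
  using assms(2)
proof (induction m arbitrary: w \<rho>)
  case (Suc m)
  have "step_var \<psi> (mean_step w) x \<le> \<rho> + edge_interaction \<psi>" for x
    using step_var_mean_step[OF \<psi>0, of w x] mean_step_le_const[of "step_var \<psi> w" \<rho> x] Suc.prems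
    by fastforce
  note IH = Suc.IH[OF this]
  have "weighted_run \<psi> (Suc m) (\<lambda>x y. (w x - y)\<^sup>2) x y
     = weighted_run \<psi> m (\<lambda>x y. step_var \<psi> w x + (mean_step w x - y)\<^sup>2) x y"
    unfolding weighted_run_Suc by (simp add: weighted_step_square[OF \<psi>0, abs_def])
  also have "\<dots> \<le> weighted_run \<psi> m (\<lambda>x y. \<rho> + (mean_step w x - y)\<^sup>2) x y"
    by (intro weighted_run_mono add_mono Suc.prems order_refl)
  also have "\<dots> = \<rho> + weighted_run \<psi> m (\<lambda>x y. (mean_step w x - y)\<^sup>2) x y"
    by (simp add: weighted_run_add weighted_run_const)
  also have "\<dots> \<le> \<rho> + (((mean_step ^^ m) (mean_step w) x - y)\<^sup>2 + real m * (\<rho> + edge_interaction \<psi>)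
     + real m * (real m - 1) / 2 * edge_interaction \<psi>)"
    using IH by simp
  finally show ?case by (simp add: funpow_swap1 field_simps)
qed (simp add: weighted_run_0)

definition weight_moment :: "('v set \<Rightarrow> real) \<Rightarrow> nat \<Rightarrow> real" where
  "weight_moment \<psi> k = (\<Sum>e\<in>E. \<psi> e ^ k) / real (card E)"

lemma weighted_run_pow2:
  assumes "sum \<psi> E = 0"
  shows "weighted_run \<psi> m (\<lambda>_ y. y ^ 2) x y = y ^ 2 + real m * weight_moment \<psi> 2"
proof (induction m)
  case (Suc m)
  have "(\<Sum>e\<in>E. (y + \<psi> e) ^ 2) / real (card E) = y ^ 2 + weight_moment \<psi> 2" for y
    using assms card_pos
    by (simp add: power2_sum sum.distrib add_divide_distrib weight_moment_def sum_distrib_left[symmetric])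
  then show ?case
    by (simp add: weighted_run_Suc weighted_step_weight weighted_run_add weighted_run_const Suc algebra_simps)
qed (simp add: weighted_run_0)

text \<open>Fourth moment of a random walk started at \<open>y\<close>: in the expansion of one step
  the odd powers of the weight average to 0.\<close>

lemma weighted_run_pow4:
  assumes "sum \<psi> E = 0" "(\<Sum>e\<in>E. \<psi> e ^ 3) = 0"
  shows "weighted_run \<psi> m (\<lambda>_ y. y ^ 4) x y = y ^ 4 + 6 * real m * weight_moment \<psi> 2 * y ^ 2
    + 3 * real m * (real m - 1) * (weight_moment \<psi> 2)\<^sup>2 + real m * weight_moment \<psi> 4"
proof (induction m)
  case (Suc m)
  have *: "(y + a) ^ 4 = y ^ 4 + (4 * y ^ 3) * a + (6 * y ^ 2) * a ^ 2 + (4 * y) * a ^ 3 + a ^ 4" for y a :: real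
    by (simp add: eval_nat_numeral algebra_simps)
  have "(\<Sum>e\<in>E. (y + \<psi> e) ^ 4) / real (card E)
      = y ^ 4 + ((6 * weight_moment \<psi> 2) * y ^ 2 + weight_moment \<psi> 4)" for y
    unfolding * sum.distrib sum_distrib_left[symmetric] assms
    using card_pos by (simp add: add_divide_distrib weight_moment_def)
  then show ?case
    by (simp add: weighted_run_Suc weighted_step_weight weighted_run_add weighted_run_cmult
        weighted_run_const Suc weighted_run_pow2[OF assms(1)])
       (simp add: algebra_simps power2_eq_square)
qed (simp add: weighted_run_0)

lemma weighted_run_reflect:
  assumes "\<And>g :: real \<Rightarrow> real. (\<Sum>e\<in>E. g (\<psi> e)) = (\<Sum>e\<in>E. g (- \<psi> e))"
  shows "weighted_run \<psi> m (\<lambda>_ y. g (- y)) x y = weighted_run \<psi> m (\<lambda>_. g) x (- y)"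
proof (induction m arbitrary: g)
  case (Suc m)
  have "(\<Sum>e\<in>E. g (- (y + \<psi> e))) = (\<Sum>e\<in>E. g (- y + \<psi> e))" for y
    using assms[of "\<lambda>z. g (- y + z)"] by simp
  then show ?case
    using Suc[of "\<lambda>y. (\<Sum>e\<in>E. g (y + \<psi> e)) / real (card E)"]
    by (simp add: weighted_run_Suc weighted_step_weight)
qed (simp add: weighted_run_0)

text \<open>By \<open>weighted_run_square\<close>, after \<open>m\<close> steps from \<open>x\<close> the functional \<open>F\<close> is close in mean square
  to \<open>a + N\<close>, where \<open>a\<close> is its mean and \<open>N\<close> the symmetric sum of the weights of the rung edges.\<close>

lemma funpow_mean_step_lower:
  fixes F \<phi> :: "('v \<Rightarrow> int) \<Rightarrow> real" and g :: "real \<Rightarrow> real"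
  assumes symm: "\<And>h :: real \<Rightarrow> real. (\<Sum>e\<in>E. h (\<psi> e)) = (\<Sum>e\<in>E. h (- \<psi> e))"
    and var: "\<And>x. step_var \<psi> F x \<le> \<rho>" and c: "0 \<le> c"
    and \<phi>: "\<And>x y. g y - c * (F x - y)\<^sup>2 \<le> \<phi> x"
    and g: "\<And>a z. A + B * z ^ 2 + C * z ^ 4 \<le> (g (a + z) + g (a - z)) / 2"
  shows "A + B * (real m * weight_moment \<psi> 2)
      + C * (3 * real m * (real m - 1) * (weight_moment \<psi> 2)\<^sup>2 + real m * weight_moment \<psi> 4)
      - c * (real m * \<rho> + real m * (real m - 1) / 2 * edge_interaction \<psi>) \<le> (mean_step ^^ m) \<phi> x"
proof -
  have \<psi>0: "sum \<psi> E = 0" using symm[of "\<lambda>z. z"] by (simp add: sum_negf)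
  have \<psi>3: "(\<Sum>e\<in>E. \<psi> e ^ 3) = 0" using symm[of "\<lambda>z. z ^ 3"] by (simp add: sum_negf)
  \<comment> \<open>Starting the accumulator at this mean annihilates the bias term of
    \<open>weighted_run_square\<close>.\<close>
  define a where "a = (mean_step ^^ m) F x"
  have "A + B * (real m * weight_moment \<psi> 2)
      + C * (3 * real m * (real m - 1) * (weight_moment \<psi> 2)\<^sup>2 + real m * weight_moment \<psi> 4)
     = weighted_run \<psi> m (\<lambda>_ z. A + B * z ^ 2 + C * z ^ 4) x 0"
    by (simp add: weighted_run_add weighted_run_cmult weighted_run_const
        weighted_run_pow2[OF \<psi>0] weighted_run_pow4[OF \<psi>0 \<psi>3])
  \<comment> \<open>The walk is symmetric, so a lower bound for the average of \<open>g\<close> over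
    \<open>a + z\<close> and \<open>a - z\<close> is enough, and it has to hold for every centre
    because \<open>a\<close> is unknown.\<close>
  also have "\<dots> \<le> weighted_run \<psi> m (\<lambda>_ z. (1/2) * g (z + a) + (1/2) * g (- z + a)) x 0"
    by (rule weighted_run_mono) (use g[of _ a] in \<open>simp add: add.commute field_simps\<close>)
  also have "\<dots> = weighted_run \<psi> m (\<lambda>_ z. g (z + a)) x 0"
    by (simp only: weighted_run_add weighted_run_cmult
        weighted_run_reflect[where \<psi> = \<psi> and g = "\<lambda>z. g (z + a)", OF symm]) simp
  also have "\<dots> = weighted_run \<psi> m (\<lambda>_. g) x a"
    using weighted_run_shift[of \<psi> m "\<lambda>_. g" x 0 a] by simp
  finally have 1: "A + B * (real m * weight_moment \<psi> 2)
      + C * (3 * real m * (real m - 1) * (weight_moment \<psi> 2)\<^sup>2 + real m * weight_moment \<psi> 4)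
      \<le> weighted_run \<psi> m (\<lambda>_. g) x a" .
  have "weighted_run \<psi> m (\<lambda>x y. (F x - y)\<^sup>2) x a
      \<le> real m * \<rho> + real m * (real m - 1) / 2 * edge_interaction \<psi>"
    using weighted_run_square[OF \<psi>0 var, of m x a] by (simp add: a_def)
  then have 2: "- c * (real m * \<rho> + real m * (real m - 1) / 2 * edge_interaction \<psi>)
      \<le> - c * weighted_run \<psi> m (\<lambda>x y. (F x - y)\<^sup>2) x a"
    using c by (simp add: mult_left_mono)
  have "weighted_run \<psi> m (\<lambda>_. g) x a + - c * weighted_run \<psi> m (\<lambda>x y. (F x - y)\<^sup>2) x a
     = weighted_run \<psi> m (\<lambda>x y. g y + - c * (F x - y)\<^sup>2) x a"
    by (simp only: weighted_run_add weighted_run_cmult)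
  also have "\<dots> \<le> weighted_run \<psi> m (\<lambda>x _. \<phi> x) x a"
    by (rule weighted_run_mono) (use \<phi> in simp)
  also have "\<dots> = (mean_step ^^ m) \<phi> x" by (rule weighted_run_state)
  finally show ?thesis using 1 2 by simp
qed
end

text \<open>A variance is at most the second moment about any point, here about \<open>F x\<close>.
  As \<open>\<eta>\<close> bounds the error at both endpoints, the probabilities \<open>p\<close>
  drop out.\<close>

lemma (in local_rule) step_var_le:
  assumes \<psi>0: "sum \<psi> E = 0"
    and \<eta>: "\<And>e v. e \<in> E \<Longrightarrow> v \<in> {fst (ori e), snd (ori e)} \<Longrightarrow> (F (x(v := x v + 1)) - F x - \<psi> e)\<^sup>2 \<le> \<eta> e"
  shows "step_var \<psi> F x \<le> (\<Sum>e\<in>E. \<eta> e) / real (card E)"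
proof -
  define D where "D = real (card E)"
  have D: "D > 0" using card_pos by (simp add: D_def)
  define k where "k e = edge_mean e F x - F x - \<psi> e" for e
  have *: "edge_mean e (\<lambda>x'. (F x' - \<psi> e)\<^sup>2) x
      = (F x)\<^sup>2 + (2 * F x) * k e + edge_mean e (\<lambda>x'. (F x' - F x - \<psi> e)\<^sup>2) x" for e
    by (simp add: edge_mean_def k_def power2_eq_square algebra_simps)
  have "edge_mean e (\<lambda>x'. (F x' - F x - \<psi> e)\<^sup>2) x \<le> \<eta> e" if "e \<in> E" for e
  proof -
    have "edge_mean e (\<lambda>x'. (F x' - F x - \<psi> e)\<^sup>2) x
        \<le> p e (edge_diff e x) * \<eta> e + (1 - p e (edge_diff e x)) * \<eta> e"
      unfolding edge_mean_def using p_nonneg[OF that] p_le_1[OF that]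
      by (intro add_mono mult_left_mono \<eta>[OF that]) auto
    then show ?thesis by (simp add: algebra_simps)
  qed
  then have \<eta>': "(\<Sum>e\<in>E. edge_mean e (\<lambda>x'. (F x' - F x - \<psi> e)\<^sup>2) x) / D \<le> (\<Sum>e\<in>E. \<eta> e) / D"
    using D by (intro divide_right_mono sum_mono) auto
  have m: "mean_step F x = F x + sum k E / D"
    using D \<psi>0 by (simp add: mean_step_def k_def sum_subtractf D_def diff_divide_distrib)
  have "step_var \<psi> F x = (F x)\<^sup>2 + (2 * F x) * (sum k E / D)
      + (\<Sum>e\<in>E. edge_mean e (\<lambda>x'. (F x' - F x - \<psi> e)\<^sup>2) x) / D - (F x + sum k E / D)\<^sup>2"
    unfolding step_var_def m * sum.distrib sum_distrib_left[symmetric] using D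
    by (simp add: D_def add_divide_distrib)
  also have "\<dots> \<le> (\<Sum>e\<in>E. \<eta> e) / D"
    using \<eta>' zero_le_power2[of "sum k E / D"] unfolding power2_sum by linarith
  finally show ?thesis by (simp add: D_def)
qed

section \<open>The cycle\<close>

text \<open>Two triangular bumps of opposite sign on two adjacent arcs of length \<open>2h\<close>.\<close>

definition tent :: "nat \<Rightarrow> nat \<Rightarrow> real" where
  "tent h v = min (real v) (2 * real h - real v)"

definition bump :: "nat \<Rightarrow> nat \<Rightarrow> real" where
  "bump h v = (if v < 2 * h then tent h v else if v < 4 * h then - tent h (v - 2 * h) else 0)"

definition bump_mid :: "nat \<Rightarrow> nat \<Rightarrow> real" where
  "bump_mid h i = (bump h i + bump h (Suc i)) / 2"

definition bump_weight :: "nat \<Rightarrow> nat set \<Rightarrow> real" where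
  "bump_weight h e = (\<Sum>v\<in>e. bump h v) / 2"

definition bump_sum :: "nat \<Rightarrow> nat \<Rightarrow> (nat \<Rightarrow> int) \<Rightarrow> real" where
  "bump_sum n h x = (\<Sum>v<n. bump h v * real_of_int (x v))"

lemma tent_eq: "tent h v = (if v \<le> h then real v else 2 * real h - real v)"
  by (auto simp: tent_def)

lemma bump_mid_eq:
  "bump_mid h i = (if i < h then real i + 1/2 else if i < 2 * h then 2 * real h - real i - 1/2
    else if i < 3 * h then - (real i - 2 * real h + 1/2) else if i < 4 * h then - (4 * real h - real i - 1/2)
    else 0)"
  by (auto simp: bump_mid_def bump_def tent_eq field_simps of_nat_diff not_less)

lemma sum_lessThan_add:
  fixes f :: "nat \<Rightarrow> 'a :: comm_monoid_add"
  shows "(\<Sum>i<a + b. f i) = (\<Sum>i<a. f i) + (\<Sum>i<b. f (i + a))"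
  by (induction b) (simp_all add: add_ac)

text \<open>Along the four slopes the weights run through the half-integers below \<open>h\<close>,
  twice with each sign, and vanish beyond. The second and fourth slopes run backwards and are
  reindexed by reflection. Symmetry and second moment of the weights follow from this.\<close>

lemma sum_bump_mid:
  assumes "4 * h \<le> n"
  shows "(\<Sum>i<n. g (bump_mid h i)) =
    2 * (\<Sum>i<h. g (real i + 1/2)) + 2 * (\<Sum>i<h. g (- (real i + 1/2))) + real (n - 4 * h) * (g 0 :: real)"
proof -
  have refl: "(\<Sum>i<h. f (h - Suc i)) = (\<Sum>i<h. f i)" for f :: "nat \<Rightarrow> real"
    by (rule sum.nat_diff_reindex)
  have 1: "(\<Sum>i<h. g (bump_mid h i)) = (\<Sum>i<h. g (real i + 1/2))"
    by (intro sum.cong) (auto simp: bump_mid_eq)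
  have 2: "(\<Sum>i<h. g (bump_mid h (i + h))) = (\<Sum>i<h. g (real i + 1/2))"
    by (subst refl[symmetric], intro sum.cong) (auto simp: bump_mid_eq of_nat_diff algebra_simps)
  have 3: "(\<Sum>i<h. g (bump_mid h (i + (h + h)))) = (\<Sum>i<h. g (- (real i + 1/2)))"
    by (intro sum.cong) (auto simp: bump_mid_eq)
  have 4: "(\<Sum>i<h. g (bump_mid h (i + (h + h + h)))) = (\<Sum>i<h. g (- (real i + 1/2)))"
    by (subst refl[symmetric], intro sum.cong) (auto simp: bump_mid_eq of_nat_diff algebra_simps)
  have 5: "(\<Sum>i<n - 4 * h. g (bump_mid h (i + (h + h + h + h)))) = real (n - 4 * h) * g 0"
    by (simp add: bump_mid_eq)
  have "n = h + h + h + h + (n - 4 * h)" using assms by simp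
  then have "(\<Sum>i<n. g (bump_mid h i)) = (\<Sum>i<h + h + h + h + (n - 4 * h). g (bump_mid h i))" by simp
  then show ?thesis unfolding sum_lessThan_add 1 2 3 4 5 by simp
qed

lemma abs_bump_mid_le: "\<bar>bump_mid h i\<bar> \<le> real h"
  by (auto simp: bump_mid_eq)

lemma bump_diff: "\<bar>bump h (Suc i) - bump h i\<bar> \<le> (if i < 4 * h then 1 else 0)"
  by (auto simp: bump_def tent_def min_def of_nat_diff not_less field_simps)

lemma bump_mid_diff: "\<bar>bump_mid h (Suc i) - bump_mid h i\<bar> \<le> (if i < 4 * h then 1 else 0)"
  by (auto simp: bump_mid_eq)

lemma sum_half_squares: "(\<Sum>i<h. (real i + 1/2)\<^sup>2) = (4 * real h ^ 3 - real h) / 12"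
  by (induction h) (simp_all add: eval_nat_numeral field_simps)

lemma sum_tent: "(\<Sum>v<2 * h. tent h v) = (real h)\<^sup>2"
proof -
  have "(\<Sum>v<k. real v) = real k * (real k - 1) / 2" for k
    by (induction k) (simp_all add: field_simps)
  note * = this
  have "(\<Sum>v<2 * h. tent h v) = (\<Sum>v<h. tent h v) + (\<Sum>v<h. tent h (v + h))"
    unfolding mult_2 by (rule sum_lessThan_add)
  also have "(\<Sum>v<h. tent h v) = (\<Sum>v<h. real v)"
    by (intro sum.cong) (auto simp: tent_def)
  also have "(\<Sum>v<h. tent h (v + h)) = (\<Sum>v<h. real h - real v)"
    by (intro sum.cong) (auto simp: tent_def)
  finally show ?thesis by (simp add: sum_subtractf * power2_eq_square)
qed

text \<open>The bumps give \<open>v\<close> and \<open>v + 2 * h\<close> opposite weights, so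
  \<open>bump_sum\<close> is a combination of load differences whose coefficients, by
  \<open>sum_tent\<close>, have total \<open>(real h)\<^sup>2\<close>.\<close>

lemma abs_bump_sum_le:
  assumes "4 * h \<le> n" "n > 0"
  shows "\<bar>bump_sum n h x\<bar> \<le> (real h)\<^sup>2 * real_of_int (gap (cycle_verts n) x)"
proof -
  have "n = 2 * h + 2 * h + (n - 4 * h)" using assms by simp
  then have "bump_sum n h x = (\<Sum>v<2 * h + 2 * h + (n - 4 * h). bump h v * real_of_int (x v))"
    by (simp add: bump_sum_def)
  also have "\<dots> = (\<Sum>v<2 * h. tent h v * real_of_int (x v)) + (\<Sum>v<2 * h. - tent h v * real_of_int (x (v + 2 * h)))"
    unfolding sum_lessThan_add by (simp add: bump_def)
  also have "\<dots> = (\<Sum>v<2 * h. tent h v * real_of_int (x v - x (v + 2 * h)))"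
    by (simp add: sum.distrib[symmetric] algebra_simps)
  also have "\<bar>\<dots>\<bar> \<le> (\<Sum>v<2 * h. tent h v * real_of_int (gap (cycle_verts n) x))"
  proof (rule order_trans[OF sum_abs], rule sum_mono)
    fix v assume v: "v \<in> {..<2 * h}"
    have "\<bar>x a - x b\<bar> \<le> gap (cycle_verts n) x" if "a < n" "b < n" for a b
    proof -
      have "x a \<le> Max (x ` {..<n})" "x b \<le> Max (x ` {..<n})"
        "Min (x ` {..<n}) \<le> x a" "Min (x ` {..<n}) \<le> x b"
        using that by (auto intro!: Max_ge Min_le)
      then show ?thesis by (simp add: gap_def cycle_verts_def)
    qed
    then have "\<bar>x v - x (v + 2 * h)\<bar> \<le> gap (cycle_verts n) x" using v assms by auto
    then have "\<bar>real_of_int (x v - x (v + 2 * h))\<bar> \<le> real_of_int (gap (cycle_verts n) x)" by linarith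
    moreover have "0 \<le> tent h v" using v by (auto simp: tent_def)
    ultimately show "\<bar>tent h v * real_of_int (x v - x (v + 2 * h))\<bar>
        \<le> tent h v * real_of_int (gap (cycle_verts n) x)"
      by (simp only: abs_mult abs_of_nonneg mult_left_mono)
  qed
  also have "\<dots> = (real h)\<^sup>2 * real_of_int (gap (cycle_verts n) x)"
    by (simp add: sum_distrib_right[symmetric] sum_tent)
  finally show ?thesis .
qed

section \<open>Weights of the edges of the cycle\<close>

definition cycle_edge :: "nat \<Rightarrow> nat \<Rightarrow> nat set" where
  "cycle_edge n i = {i, Suc i mod n}"

lemma Suc_mod_cases: "i < n \<Longrightarrow> Suc i mod n = (if Suc i = n then 0 else Suc i)"
  by auto

lemma sum_cycle_edges:
  assumes "n \<ge> 3"
  shows "(\<Sum>e\<in>cycle_edges n. g e) = (\<Sum>i<n. g (cycle_edge n i))" and "card (cycle_edges n) = n"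
proof -
  have inj: "inj_on (cycle_edge n) {..<n}"
    using assms by (auto simp: inj_on_def cycle_edge_def doubleton_eq_iff Suc_mod_cases split: if_splits)
  have "cycle_edges n = cycle_edge n ` {..<n}" by (auto simp: cycle_edges_def cycle_edge_def)
  then show "(\<Sum>e\<in>cycle_edges n. g e) = (\<Sum>i<n. g (cycle_edge n i))" "card (cycle_edges n) = n"
    by (simp_all add: sum.reindex[OF inj] card_image[OF inj])
qed

lemma cycle_edge_meets:
  "i < n \<Longrightarrow> j < n \<Longrightarrow> cycle_edge n i \<inter> cycle_edge n j \<noteq> {} \<Longrightarrow> i = j \<or> j = Suc i mod n \<or> i = Suc j mod n"
  by (auto simp: cycle_edge_def Suc_mod_cases split: if_splits)

lemma bump_weight_cycle_edge:
  assumes "4 * h \<le> n" "n \<ge> 3" "i < n"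
  shows "bump_weight h (cycle_edge n i) = bump_mid h i"
proof -
  \<comment> \<open>The wrapping edge is no exception: \<open>bump h\<close> vanishes at 0 and,
    since \<open>4 * h \<le> n\<close>, also at \<open>n\<close>.\<close>
  have "bump h (Suc i mod n) = bump h (Suc i)" "i \<noteq> Suc i mod n"
    using assms by (auto simp: Suc_mod_cases bump_def tent_def)
  then show ?thesis by (simp add: bump_weight_def bump_mid_def cycle_edge_def)
qed

locale cycle_rule = local_rule "cycle_edges n" ori p
  for n :: nat and ori :: "nat set \<Rightarrow> nat \<times> nat" and p :: "nat set \<Rightarrow> int \<Rightarrow> real" +
  assumes n3: "n \<ge> 3"
begin

lemma sum_bump_weight:
  assumes "4 * h \<le> n"
  shows "(\<Sum>e\<in>cycle_edges n. g (bump_weight h e) :: real) = (\<Sum>i<n. g (bump_mid h i))"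
  unfolding sum_cycle_edges[OF n3] by (intro sum.cong) (simp_all add: bump_weight_cycle_edge[OF assms n3])

lemma bump_weight_symmetric:
  assumes "4 * h \<le> n"
  shows "(\<Sum>e\<in>cycle_edges n. g (bump_weight h e) :: real) = (\<Sum>e\<in>cycle_edges n. g (- bump_weight h e))"
  using sum_bump_weight[OF assms, of g] sum_bump_weight[OF assms, of "\<lambda>z. g (- z)"]
    sum_bump_mid[OF assms, of g] sum_bump_mid[OF assms, of "\<lambda>z. g (- z)"] by (simp add: add.commute)

lemma bump_moment_2:
  assumes "4 * h \<le> n"
  shows "weight_moment (bump_weight h) 2 = (4 * real h ^ 3 - real h) / 3 / real n"
  unfolding weight_moment_def sum_cycle_edges(2)[OF n3] sum_bump_weight[OF assms, of "\<lambda>z. z ^ 2"]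
    sum_bump_mid[OF assms, of "\<lambda>z. z ^ 2"] power2_minus sum_half_squares
  using n3 by (simp add: field_simps)

lemma bump_moment_4:
  assumes "4 * h \<le> n"
  shows "weight_moment (bump_weight h) 4 \<le> (real h)\<^sup>2 * weight_moment (bump_weight h) 2"
proof -
  have "(\<Sum>i<n. bump_mid h i ^ 4) \<le> (\<Sum>i<n. (real h)\<^sup>2 * bump_mid h i ^ 2)"
  proof (rule sum_mono)
    fix i
    have "bump_mid h i ^ 2 \<le> (real h)\<^sup>2" using abs_bump_mid_le[of h i] by (simp add: abs_le_square_iff[symmetric])
    then have "bump_mid h i ^ 2 * bump_mid h i ^ 2 \<le> (real h)\<^sup>2 * bump_mid h i ^ 2"
      by (rule mult_right_mono) simp
    then show "bump_mid h i ^ 4 \<le> (real h)\<^sup>2 * bump_mid h i ^ 2"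
      by (simp add: power2_eq_square power4_eq_xxxx mult.assoc)
  qed
  then show ?thesis
    unfolding weight_moment_def sum_cycle_edges(2)[OF n3] sum_bump_weight[OF assms, of "\<lambda>z. z ^ 2"]
      sum_bump_weight[OF assms, of "\<lambda>z. z ^ 4"] sum_distrib_left[symmetric]
    by (simp add: divide_right_mono)
qed

lemma sum_bump_weight_0: "4 * h \<le> n \<Longrightarrow> sum (bump_weight h) (cycle_edges n) = 0"
  using bump_weight_symmetric[of h "\<lambda>z. z"] by (simp add: sum_negf)

text \<open>A ring changes \<open>bump_sum\<close> by the value of \<open>bump\<close> at an
  endpoint, which misses the edge weight by half the slope, at most 1/2. The slope is nonzero on at
  most \<open>4 * h\<close> edges, whence \<open>4 * h * (1/4)\<close>.\<close>

lemma step_var_bump: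
  assumes "4 * h \<le> n"
  shows "step_var (bump_weight h) (bump_sum n h) x \<le> real h / real n"
proof -
  define \<eta> where "\<eta> e = (\<Sum>v\<in>e. (bump h v - bump_weight h e)\<^sup>2) / 2" for e
  have \<eta>i: "\<eta> (cycle_edge n i) = ((bump h (Suc i) - bump h i) / 2)\<^sup>2" if "i < n" for i
  proof -
    have "bump h (Suc i mod n) = bump h (Suc i)" "i \<noteq> Suc i mod n"
      using assms that n3 by (auto simp: Suc_mod_cases bump_def tent_def)
    then show ?thesis
      by (simp add: \<eta>_def bump_weight_cycle_edge[OF assms n3 that] bump_mid_def)
         (simp add: cycle_edge_def bump_mid_def power2_eq_square field_simps)
  qed
  have "(bump_sum n h (x(v := x v + 1)) - bump_sum n h x - bump_weight h e)\<^sup>2 \<le> \<eta> e"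
    if e: "e \<in> cycle_edges n" and v: "v \<in> {fst (ori e), snd (ori e)}" for e v
  proof -
    obtain i where i: "i < n" "e = cycle_edge n i" using e by (auto simp: cycle_edges_def cycle_edge_def)
    have ve: "v \<in> e" using v edge_eq[OF e] by auto
    then have v': "v = i \<or> v = Suc i mod n" and vn: "v < n" using i by (auto simp: cycle_edge_def)
    have "bump_sum n h (x(v := x v + 1)) - bump_sum n h x
        = (\<Sum>w<n. if w = v then bump h w else 0)"
      unfolding bump_sum_def sum_subtractf[symmetric] by (intro sum.cong) (auto simp: algebra_simps)
    then have 1: "bump_sum n h (x(v := x v + 1)) - bump_sum n h x = bump h v" using vn by simp
    have "bump h (Suc i mod n) = bump h (Suc i)"
      using assms i n3 by (auto simp: Suc_mod_cases bump_def tent_def)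
    then show ?thesis
      using v' unfolding 1 i(2) \<eta>i[OF i(1)] bump_weight_cycle_edge[OF assms n3 i(1)]
      by (auto simp: bump_mid_def power2_eq_square field_simps)
  qed
  then have "step_var (bump_weight h) (bump_sum n h) x \<le> (\<Sum>e\<in>cycle_edges n. \<eta> e) / real n"
    using step_var_le[OF sum_bump_weight_0[OF assms], of "bump_sum n h" x \<eta>] sum_cycle_edges(2)[OF n3] by simp
  also have "(\<Sum>e\<in>cycle_edges n. \<eta> e) = (\<Sum>i<n. ((bump h (Suc i) - bump h i) / 2)\<^sup>2)"
    unfolding sum_cycle_edges[OF n3] by (intro sum.cong) (simp_all add: \<eta>i)
  also have "\<dots> \<le> (\<Sum>i<n. if i < 4 * h then 1/4 else 0)"
  proof (rule sum_mono)
    fix i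
    show "((bump h (Suc i) - bump h i) / 2)\<^sup>2 \<le> (if i < 4 * h then 1/4 else 0)"
      using bump_diff[of h i] abs_le_square_iff[of "bump h (Suc i) - bump h i" 1]
      by (auto simp: power_divide split: if_splits)
  qed
  also have "\<dots> = (\<Sum>i<4 * h. 1/4)"
    using assms by (intro sum.mono_neutral_cong_right) auto
  finally show ?thesis using n3 by (simp add: divide_right_mono)
qed

text \<open>Only neighbouring edges contribute. Their weights differ by at most 1 and are equal
  beyond the bumps; the extra 1 allows for the pair meeting at vertex 0, where the numbering wraps.
  The factor 2 counts both orders.\<close>

lemma edge_interaction_bump:
  assumes "4 * h \<le> n"
  shows "edge_interaction (bump_weight h) \<le> 2 * (4 * real h + 1) / (real n)\<^sup>2"
proof -
  define d where "d i = (bump_mid h i - bump_mid h (Suc i mod n))\<^sup>2" for i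
  have "(\<Sum>e\<in>cycle_edges n. \<Sum>f\<in>cycle_edges n.
        if e \<inter> f \<noteq> {} then (bump_weight h e - bump_weight h f)\<^sup>2 else 0)
     = (\<Sum>i<n. \<Sum>j<n. if cycle_edge n i \<inter> cycle_edge n j \<noteq> {} then (bump_mid h i - bump_mid h j)\<^sup>2 else 0)"
    unfolding sum_cycle_edges[OF n3]
    by (intro sum.cong refl) (simp add: bump_weight_cycle_edge[OF assms n3])
  also have "\<dots> \<le> (\<Sum>i<n. \<Sum>j<n. (if j = Suc i mod n then d i else 0) + (if i = Suc j mod n then d j else 0))"
  proof (intro sum_mono)
    fix i j assume "i \<in> {..<n}" "j \<in> {..<n}"
    then show "(if cycle_edge n i \<inter> cycle_edge n j \<noteq> {} then (bump_mid h i - bump_mid h j)\<^sup>2 else 0)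
      \<le> (if j = Suc i mod n then d i else 0) + (if i = Suc j mod n then d j else 0)"
      using cycle_edge_meets[of i n j] by (auto simp: d_def power2_commute)
  qed
  also have "\<dots> = (\<Sum>i<n. d i) + (\<Sum>j<n. d j)"
  proof -
    have "(\<Sum>i<n. \<Sum>j<n. if i = Suc j mod n then d j else 0) = (\<Sum>j<n. \<Sum>i<n. if i = Suc j mod n then d j else 0)"
      by (rule sum.swap)
    then show ?thesis using n3 by (simp add: sum.distrib)
  qed
  also have "(\<Sum>i<n. d i) \<le> (\<Sum>i<n. (if i < 4 * h then 1 else 0) + (if i = n - 1 then 1 else 0))"
  proof (rule sum_mono)
    fix i assume i: "i \<in> {..<n}"
    show "d i \<le> (if i < 4 * h then 1 else 0) + (if i = n - 1 then 1 else 0)"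
    proof (cases "Suc i = n")
      case True
      then have "\<bar>bump_mid h i - bump_mid h 0\<bar> \<le> 1" using assms by (auto simp: bump_mid_eq)
      then have "d i \<le> 1" using True by (simp add: d_def abs_square_le_1)
      then show ?thesis using True by auto
    next
      case False
      then have "\<bar>bump_mid h i - bump_mid h (Suc i mod n)\<bar> \<le> (if i < 4 * h then 1 else 0)"
        using bump_mid_diff[of h i] i by (simp add: Suc_mod_cases abs_minus_commute)
      then have "d i \<le> (if i < 4 * h then 1 else 0)" by (auto simp: d_def abs_square_le_1 split: if_splits)
      then show ?thesis by auto
    qed
  qed
  also have "\<dots> = (\<Sum>i<4 * h. 1) + 1"
  proof -
    have "(\<Sum>i<n. if i < 4 * h then 1 else 0) = (\<Sum>i<4 * h. 1::real)"
      using assms by (intro sum.mono_neutral_cong_right) auto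
    then show ?thesis using n3 by (simp add: sum.distrib)
  qed
  finally have "(\<Sum>e\<in>cycle_edges n. \<Sum>f\<in>cycle_edges n.
        if e \<inter> f \<noteq> {} then (bump_weight h e - bump_weight h f)\<^sup>2 else 0) \<le> 2 * (4 * real h + 1)" by simp
  then show ?thesis
    unfolding edge_interaction_def sum_cycle_edges(2)[OF n3] by (rule divide_right_mono) simp
qed

section \<open>From the moments of the walk to bounds for the gap\<close>

lemma funpow_mean_step_mono:
  "(\<And>x. f x \<le> g x) \<Longrightarrow> (mean_step ^^ m) f x \<le> (mean_step ^^ m) g x"
  using weighted_run_mono[of "\<lambda>x _. f x" "\<lambda>x _. g x" "\<lambda>_. 0" m x 0] unfolding weighted_run_state by simp

text \<open>\<open>S b\<close> is the variance of \<open>N\<close> after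
  \<open>n * b\<^sup>2\<close> rings. The fourth moment is at most 3.001 times its square, hardly
  above the Gaussian value 3, and the mean square of \<open>F - N\<close> about its mean is at most
  4/10000 of \<open>S b\<close>. The fourth moment is bounded only from above, hence
  \<open>C \<le> 0\<close>.\<close>

lemma bump_lower:
  fixes \<phi> :: "(nat \<Rightarrow> int) \<Rightarrow> real" and g :: "real \<Rightarrow> real"
  defines "S \<equiv> \<lambda>b. (real b)\<^sup>2 * (4 * real (100 * b) ^ 3 - real (100 * b)) / 3"
  assumes b: "b \<ge> 10" "400 * b \<le> n" and c: "0 \<le> c" and C: "C \<le> 0"
    and \<phi>: "\<And>x y. g y - c * (bump_sum n (100 * b) x - y)\<^sup>2 \<le> \<phi> x"
    and g: "\<And>a z. A + B * z ^ 2 + C * z ^ 4 \<le> (g (a + z) + g (a - z)) / 2"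
  shows "A + B * S b + C * ((3001/1000) * (S b)\<^sup>2) - c * (S b * (4 / 10000)) \<le> (mean_step ^^ (n * b\<^sup>2)) \<phi> x"
proof -
  define \<beta> where "\<beta> = real b"
  define h where "h = 100 * b"
  define m where "m = real (n * b\<^sup>2)"
  define w2 where "w2 = weight_moment (bump_weight h) 2"
  define w4 where "w4 = weight_moment (bump_weight h) 4"
  define \<kappa> where "\<kappa> = edge_interaction (bump_weight h)"
  have h: "4 * h \<le> n" "real h = 100 * \<beta>" using b by (simp_all add: h_def \<beta>_def)
  have n: "real n > 0" using n3 by simp
  have \<beta>: "\<beta> \<ge> 10" using b by (simp add: \<beta>_def)
  have m: "m = real n * \<beta>\<^sup>2" by (simp add: m_def \<beta>_def)
  have m1: "m \<ge> 1" using b n3 by (simp add: m_def) (metis One_nat_def Suc_leI mult_pos_pos of_nat_1 of_nat_le_iff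
     of_nat_mult of_nat_power zero_less_power less_le_trans zero_less_numeral)
  have S: "S b = \<beta>\<^sup>2 * (4000000 * \<beta> ^ 3 - 100 * \<beta>) / 3"
    by (simp add: S_def \<beta>_def power_mult_distrib)
  have mw2: "m * w2 = S b"
    using n by (simp add: m w2_def bump_moment_2[OF h(1)] S h(2) power_mult_distrib)
  \<comment> \<open>With \<open>b \<ge> 10\<close> the lower powers of \<open>\<beta>\<close> are
    small enough for the numerical constants below.\<close>
  have pw: "\<beta> ^ 5 \<ge> 10 * \<beta> ^ 4" "\<beta> ^ 5 \<ge> 100 * \<beta> ^ 3" "\<beta> ^ 5 \<ge> 1000 * \<beta> ^ 2" "\<beta> ^ 3 > 0"
  proof -
    have "\<beta> ^ k * 10 \<le> \<beta> ^ k * \<beta>" for k using \<beta> by (intro mult_left_mono) auto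
    from this[of 4] this[of 3] this[of 2]
    show "\<beta> ^ 5 \<ge> 10 * \<beta> ^ 4" "\<beta> ^ 5 \<ge> 100 * \<beta> ^ 3" "\<beta> ^ 5 \<ge> 1000 * \<beta> ^ 2"
      by (simp_all add: eval_nat_numeral)
    show "\<beta> ^ 3 > 0" using \<beta> by simp
  qed
  have S': "S b = (4000000 * \<beta> ^ 5 - 100 * \<beta> ^ 3) / 3"
    unfolding S by (simp add: eval_nat_numeral algebra_simps)
  have S0: "S b > 0" 
  proof -
    have "100 * \<beta> ^ 3 < 4000000 * \<beta> ^ 5" by (rule le_less_trans[OF pw(2)]) (use \<beta> in simp)
    then show ?thesis by (simp add: S')
  qed
  have w2: "w2 = S b / m" using mw2 m1 by (simp add: field_simps)
  \<comment> \<open>To leading order the interaction contributes \<open>400 * \<beta> ^ 5\<close>,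
    against about \<open>533 * \<beta> ^ 5\<close> on the right.\<close>
  have V: "m * (real h / real n) + m * (m - 1) / 2 * \<kappa> \<le> S b * (4 / 10000)"
  proof -
    have "m * (m - 1) / 2 * \<kappa> \<le> m * (m - 1) / 2 * (2 * (4 * real h + 1) / (real n)\<^sup>2)"
      unfolding \<kappa>_def using m1 by (intro mult_left_mono edge_interaction_bump h) auto
    also have "\<dots> \<le> m * m / 2 * (2 * (4 * real h + 1) / (real n)\<^sup>2)"
      using m1 by (intro mult_right_mono divide_right_mono mult_left_mono) auto
    also have "\<dots> = \<beta> ^ 4 * (400 * \<beta> + 1)"
      using n by (simp add: m h power2_eq_square power4_eq_xxxx)
    also have "\<dots> = 400 * \<beta> ^ 5 + \<beta> ^ 4" by (simp add: eval_nat_numeral algebra_simps)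
    finally have "m * (m - 1) / 2 * \<kappa> \<le> 400 * \<beta> ^ 5 + \<beta> ^ 4" .
    moreover have "m * (real h / real n) = 100 * \<beta> ^ 3"
      using n by (simp add: m h eval_nat_numeral)
    moreover have "Y + X \<le> (4000000 * u - 100 * w) / 3 * (4 / 10000)"
      if "X \<le> 400 * u + v" "Y = 100 * w" "u \<ge> 10 * v" "u \<ge> 100 * w" "w > 0" for X Y u v w :: real
      using that by (simp add: field_simps)
    ultimately show ?thesis using pw unfolding S' by blast
  qed
  \<comment> \<open>The weights are at most \<open>h\<close> in absolute value, so this non-Gaussian
    part is at most \<open>(real h)\<^sup>2 * S b\<close>, and \<open>S b\<close> is at least
    \<open>1000 * (real h)\<^sup>2\<close>.\<close>
  have "m * w4 \<le> m * ((real h)\<^sup>2 * w2)"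
    unfolding w4_def w2_def using m1 by (intro mult_left_mono bump_moment_4 h) auto
  also have "\<dots> = (real h)\<^sup>2 * S b" using mw2 by (simp add: algebra_simps)
  also have "\<dots> \<le> (S b / 1000) * S b"
  proof (rule mult_right_mono[OF _ less_imp_le[OF S0]])
    have "30000000 * z \<le> 4000000 * u - 100 * w" if "u \<ge> 1000 * z" "u \<ge> 100 * w" "w > 0" for u w z :: real
      using that by simp
    then have "30000000 * \<beta> ^ 2 \<le> 4000000 * \<beta> ^ 5 - 100 * \<beta> ^ 3" using pw by blast
    then show "(real h)\<^sup>2 \<le> S b / 1000" by (simp add: h S' power_mult_distrib)
  qed
  finally have "m * w4 \<le> (S b)\<^sup>2 / 1000" by (simp add: power2_eq_square)
  moreover have "3 * m * (m - 1) * w2\<^sup>2 \<le> 3 * m * m * w2\<^sup>2"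
    using m1 by (intro mult_right_mono mult_left_mono) auto
  moreover have "3 * m * m * w2\<^sup>2 = 3 * (S b)\<^sup>2" unfolding mw2[symmetric] by (simp add: power2_eq_square)
  ultimately have F: "3 * m * (m - 1) * w2\<^sup>2 + m * w4 \<le> 3001/1000 * (S b)\<^sup>2" by simp
  have "A + B * (m * w2) + C * (3 * m * (m - 1) * w2\<^sup>2 + m * w4)
      - c * (m * (real h / real n) + m * (m - 1) / 2 * \<kappa>) \<le> (mean_step ^^ (n * b\<^sup>2)) \<phi> x"
    unfolding m_def w2_def w4_def \<kappa>_def
    by (rule funpow_mean_step_lower[OF bump_weight_symmetric[OF h(1)] step_var_bump[OF h(1)] c \<phi>[folded h_def] g])
  moreover have "C * (3 * m * (m - 1) * w2\<^sup>2 + m * w4) \<ge> C * ((3001/1000) * (S b)\<^sup>2)"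
    by (rule mult_left_mono_neg[OF F C])
  moreover have "c * (m * (real h / real n) + m * (m - 1) / 2 * \<kappa>) \<le> c * (S b * (4 / 10000))"
    by (rule mult_left_mono[OF V c])
  ultimately show ?thesis unfolding mw2 by linarith
qed

text \<open>With \<open>h = 100 * b\<close>, \<open>bump_sum\<close> is at most
  \<open>h\<^sup>2\<close> times the gap, and \<open>\<sigma>\<close> is about
  \<open>h\<^sup>2 * sqrt (b / 75)\<close>. The constant 57/500 lies slightly below
  \<open>1 / sqrt 75\<close>.\<close>

lemma bump_sum_gap:
  fixes b :: nat
  defines "\<sigma> \<equiv> sqrt ((real b)\<^sup>2 * (4 * real (100 * b) ^ 3 - real (100 * b)) / 3)"
  assumes b: "b \<ge> 10" "400 * b \<le> n"
  shows "0 < \<sigma>" and "\<bar>bump_sum n (100 * b) x\<bar> * sqrt (real b) * (57/500) \<le> \<sigma> * real_of_int (gap (cycle_verts n) x)"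
proof -
  define \<beta> where "\<beta> = real b"
  have \<beta>: "\<beta> \<ge> 10" using b by (simp add: \<beta>_def)
  have "\<beta> ^ 3 * 10 \<le> \<beta> ^ 3 * \<beta>" "\<beta> ^ 4 * 10 \<le> \<beta> ^ 4 * \<beta>" using \<beta> by (intro mult_left_mono; auto)+
  moreover have "\<beta> ^ 3 * \<beta> = \<beta> ^ 4" "\<beta> ^ 4 * \<beta> = \<beta> ^ 5" by (simp_all add: eval_nat_numeral)
  moreover have "\<beta> ^ 3 > 0" using \<beta> by simp
  ultimately have pw: "\<beta> ^ 5 \<ge> 100 * \<beta> ^ 3" by linarith
  have eq: "(real b)\<^sup>2 * (4 * real (100 * b) ^ 3 - real (100 * b)) / 3 = (4000000 * \<beta> ^ 5 - 100 * \<beta> ^ 3) / 3"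
    by (simp add: \<beta>_def power_mult_distrib eval_nat_numeral algebra_simps)
  have "100 * \<beta> ^ 3 < 4000000 * \<beta> ^ 5" by (rule le_less_trans[OF pw]) (use \<beta> in simp)
  then show pos: "0 < \<sigma>" unfolding \<sigma>_def eq by simp
  have "sqrt \<beta> * (57/500) * (real (100 * b))\<^sup>2 \<le> \<sigma>"
    unfolding \<sigma>_def eq
  proof (rule real_le_rsqrt)
    have "(sqrt \<beta> * (57/500) * (real (100 * b))\<^sup>2)\<^sup>2 = 12996/1000000 * 100000000 * \<beta> ^ 5"
      using \<beta> by (simp add: power_mult_distrib \<beta>_def power2_eq_square eval_nat_numeral)
    also have "\<dots> \<le> (4000000 * \<beta> ^ 5 - 100 * \<beta> ^ 3) / 3"
    proof -
      have "0 \<le> \<beta> ^ 5" using \<beta> by simp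
      moreover have "12996 / 1000000 * 100000000 * u \<le> (4000000 * u - 100 * w) / 3"
        if "0 \<le> u" "u \<ge> 100 * w" for u w :: real using that by (simp add: field_simps)
      ultimately show ?thesis using pw by blast
    qed
    finally show "(sqrt \<beta> * (57/500) * (real (100 * b))\<^sup>2)\<^sup>2 \<le> (4000000 * \<beta> ^ 5 - 100 * \<beta> ^ 3) / 3" .
  qed
  note 1 = this
  have g: "\<bar>bump_sum n (100 * b) x\<bar> \<le> (real (100 * b))\<^sup>2 * real_of_int (gap (cycle_verts n) x)"
    using abs_bump_sum_le[of "100 * b" n x] b n3 by simp
  have g0: "0 \<le> real_of_int (gap (cycle_verts n) x)"
  proof (rule ccontr)
    assume "\<not> ?thesis"
    then have "(real (100 * b))\<^sup>2 * real_of_int (gap (cycle_verts n) x) < 0"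
      using b by (intro mult_pos_neg) auto
    then show False using g by linarith
  qed
  have "\<bar>bump_sum n (100 * b) x\<bar> * (sqrt \<beta> * (57/500))
      \<le> ((real (100 * b))\<^sup>2 * real_of_int (gap (cycle_verts n) x)) * (sqrt \<beta> * (57/500))"
    using g \<beta> by (intro mult_right_mono) auto
  also have "\<dots> = (sqrt \<beta> * (57/500) * (real (100 * b))\<^sup>2) * real_of_int (gap (cycle_verts n) x)"
    by simp
  also have "\<dots> \<le> \<sigma> * real_of_int (gap (cycle_verts n) x)"
    by (rule mult_right_mono[OF 1 g0])
  finally show "\<bar>bump_sum n (100 * b) x\<bar> * sqrt (real b) * (57/500) \<le> \<sigma> * real_of_int (gap (cycle_verts n) x)"
    by (simp add: \<beta>_def mult.assoc)
qed

text \<open>The test function is the indicator of \<open>\<sigma>/4 \<le> \<bar>y\<bar>\<close>. If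
  \<open>\<bar>z\<bar> \<ge> \<sigma>/4\<close>, then \<open>a + z\<close> or \<open>a - z\<close>
  passes this threshold whatever \<open>a\<close> is, so the symmetrised test function is at least
  1/2. Lowering the threshold to \<open>\<sigma>/20\<close> for \<open>F\<close> leaves a margin of
  \<open>\<sigma>/5\<close>, which the penalty with factor \<open>25 / S\<close> pays for.\<close>

lemma prob_gap_lower:
  assumes b: "b \<ge> 10" "400 * b \<le> n"
  shows "7/50 \<le> (mean_step ^^ (n * b\<^sup>2))
    (\<lambda>x. of_bool (sqrt (real b) / 180 \<le> real_of_int (gap (cycle_verts n) x))) x"
proof -
  define S where "S = (real b)\<^sup>2 * (4 * real (100 * b) ^ 3 - real (100 * b)) / 3"
  define \<sigma> where "\<sigma> = sqrt S"
  have \<sigma>: "\<sigma> > 0" using bump_sum_gap(1)[OF b] by (simp add: \<sigma>_def S_def)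
  then have S0: "S > 0" and S\<sigma>: "S = \<sigma>\<^sup>2" by (simp_all add: \<sigma>_def)
  let ?F = "bump_sum n (100 * b)"
  \<comment> \<open>The expansion of \<open>1/2 - 128/2209 * (z ^ 2 / S - 3)\<^sup>2\<close> with
    the moment bounds inserted: about 0.152, less 0.01 for the penalty.\<close>
  have "(1/2 - 1152/2209) + (768/2209/S) * S + (- (128/2209/S\<^sup>2)) * ((3001/1000) * S\<^sup>2) - (25/S) * (S * (4/10000))
     \<le> (mean_step ^^ (n * b\<^sup>2)) (\<lambda>x. of_bool (\<sigma>/20 \<le> \<bar>?F x\<bar>)) x"
    unfolding S_def
  proof (rule bump_lower[OF b, where g = "\<lambda>y. of_bool (\<sigma>/4 \<le> \<bar>y\<bar>)"], unfold S_def[symmetric])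
    show "0 \<le> 25 / S" "- (128/2209/S\<^sup>2) \<le> 0" using S0 by simp_all
    show "of_bool (\<sigma>/4 \<le> \<bar>y\<bar>) - 25 / S * (?F x - y)\<^sup>2 \<le> of_bool (\<sigma>/20 \<le> \<bar>?F x\<bar>)" for x y
    proof (cases "\<sigma>/4 \<le> \<bar>y\<bar> \<and> \<not> \<sigma>/20 \<le> \<bar>?F x\<bar>")
      case True
      then have "\<sigma> / 5 \<le> \<bar>?F x - y\<bar>" by linarith
      then have "(\<sigma> / 5)\<^sup>2 \<le> (?F x - y)\<^sup>2" using \<sigma> by (simp add: abs_le_square_iff[symmetric])
      then have "1 \<le> 25 / S * (?F x - y)\<^sup>2" using \<sigma> by (simp add: S\<sigma> field_simps)
      then show ?thesis using True by simp
    next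
      case False
      moreover have "0 \<le> 25 / S * (?F x - y)\<^sup>2" using S0 by simp
      ultimately show ?thesis by (auto simp: of_bool_def)
    qed
    show "1/2 - 1152/2209 + 768/2209/S * z ^ 2 + - (128/2209/S\<^sup>2) * z ^ 4
        \<le> (of_bool (\<sigma>/4 \<le> \<bar>a + z\<bar>) + of_bool (\<sigma>/4 \<le> \<bar>a - z\<bar>)) / 2" for a z
    proof -
      text \<open>The factor \<open>128/2209\<close> makes this vanish at \<open>z = \<sigma>/4\<close>; the centre \<open>3\<close> is close to the
        optimal one for a variable with the moments of a Gaussian.\<close>
      have poly: "1/2 - 1152/2209 + 768/2209/S * z ^ 2 + - (128/2209/S\<^sup>2) * z ^ 4
          = 1/2 - 128/2209 * (z ^ 2 / S - 3)\<^sup>2"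
        using S0 by (simp add: power2_eq_square power4_eq_xxxx field_simps)
      show ?thesis
      proof (cases "\<sigma>/4 \<le> \<bar>z\<bar>")
        case True
        then have "\<sigma>/4 \<le> \<bar>a + z\<bar> \<or> \<sigma>/4 \<le> \<bar>a - z\<bar>" by linarith
        then have "1/2 \<le> (of_bool (\<sigma>/4 \<le> \<bar>a + z\<bar>) + of_bool (\<sigma>/4 \<le> \<bar>a - z\<bar>)) / (2::real)"
          by (auto simp: of_bool_def)
        moreover have "0 \<le> 128/2209 * (z ^ 2 / S - 3)\<^sup>2" by simp
        ultimately show ?thesis unfolding poly by linarith
      next
        case False
        then have "\<bar>z\<bar>\<^sup>2 < (\<sigma>/4)\<^sup>2" by (intro power_strict_mono) auto
        then have "z ^ 2 / S < 1/16" using S0 by (simp add: S\<sigma> power_divide field_simps)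
        then have "47/16 \<le> 3 - z ^ 2 / S" by simp
        then have "(47/16)\<^sup>2 \<le> (3 - z ^ 2 / S)\<^sup>2" by (rule power_mono) simp
        then have "1/2 - 128/2209 * (z ^ 2 / S - 3)\<^sup>2 \<le> 0" by (simp add: power2_commute power_divide)
        also have "0 \<le> (of_bool (\<sigma>/4 \<le> \<bar>a + z\<bar>) + of_bool (\<sigma>/4 \<le> \<bar>a - z\<bar>)) / (2::real)" by simp
        finally show ?thesis unfolding poly .
      qed
    qed
  qed
  then have "7/50 \<le> (mean_step ^^ (n * b\<^sup>2)) (\<lambda>x. of_bool (\<sigma>/20 \<le> \<bar>?F x\<bar>)) x"
    using S0 by simp
  also have "\<dots> \<le> (mean_step ^^ (n * b\<^sup>2))
    (\<lambda>x. of_bool (sqrt (real b) / 180 \<le> real_of_int (gap (cycle_verts n) x))) x"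
  proof (rule funpow_mean_step_mono)
    fix x
    have "sqrt (real b) / 180 \<le> real_of_int (gap (cycle_verts n) x)" if "\<sigma>/20 \<le> \<bar>?F x\<bar>"
    proof -
      have "\<sigma>/20 * (sqrt (real b) * (57/500)) \<le> \<bar>?F x\<bar> * (sqrt (real b) * (57/500))"
        by (rule mult_right_mono[OF that]) simp
      also have "\<dots> \<le> \<sigma> * real_of_int (gap (cycle_verts n) x)"
        using bump_sum_gap(2)[OF b, of x] by (simp add: \<sigma>_def S_def mult.assoc)
      finally have "\<sigma> * (sqrt (real b) * (57/500) / 20) \<le> \<sigma> * real_of_int (gap (cycle_verts n) x)" by simp
      then have "sqrt (real b) * (57/500) / 20 \<le> real_of_int (gap (cycle_verts n) x)"
        using \<sigma> by (simp only: mult_le_cancel_left_pos)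
      moreover have "0 \<le> sqrt (real b)" by simp
      ultimately show ?thesis by linarith
    qed
    then show "of_bool (\<sigma>/20 \<le> \<bar>?F x\<bar>)
        \<le> (of_bool (sqrt (real b) / 180 \<le> real_of_int (gap (cycle_verts n) x)) :: real)"
      by (simp add: of_bool_def)
  qed
  finally show ?thesis .
qed

text \<open>The test function is \<open>\<bar>y\<bar> - \<sigma>/20\<close>: by AM-GM the quadratic
  penalty and \<open>\<sigma>/20\<close> together cover \<open>\<bar>F - y\<bar>\<close>. For the
  walk, \<open>\<bar>z\<bar>\<close> is bounded below by an even quartic touching it at
  \<open>\<bar>z\<bar> = 2 * \<sigma>\<close>, near the best point \<open>sqrt 3 * \<sigma>\<close>
  for Gaussian moments. The total is about \<open>0.51 * \<sigma>\<close>.\<close>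

lemma mean_gap_lower:
  assumes b: "b \<ge> 10" "400 * b \<le> n"
  shows "sqrt (real b) / 18 \<le> (mean_step ^^ (n * b\<^sup>2)) (\<lambda>x. real_of_int (gap (cycle_verts n) x)) x"
proof -
  define S where "S = (real b)\<^sup>2 * (4 * real (100 * b) ^ 3 - real (100 * b)) / 3"
  define \<sigma> where "\<sigma> = sqrt S"
  have \<sigma>: "\<sigma> > 0" using bump_sum_gap(1)[OF b] by (simp add: \<sigma>_def S_def)
  then have S0: "S > 0" and S\<sigma>: "S = \<sigma>\<^sup>2" by (simp_all add: \<sigma>_def)
  let ?F = "bump_sum n (100 * b)"
  have "(- \<sigma>/20) + (3/(4*\<sigma>)) * S + (- (1/(16*\<sigma>^3))) * ((3001/1000) * S\<^sup>2) - (5/\<sigma>) * (S * (4/10000))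
     \<le> (mean_step ^^ (n * b\<^sup>2)) (\<lambda>x. \<bar>?F x\<bar>) x"
    unfolding S_def
  proof (rule bump_lower[OF b, where g = "\<lambda>y. \<bar>y\<bar> - \<sigma>/20"])
    show "0 \<le> 5 / \<sigma>" "- (1/(16*\<sigma>^3)) \<le> 0" using \<sigma> by simp_all
    show "\<bar>y\<bar> - \<sigma>/20 - 5 / \<sigma> * (?F x - y)\<^sup>2 \<le> \<bar>?F x\<bar>" for x y
    proof -
      have "0 \<le> (10 * \<bar>?F x - y\<bar> - \<sigma>)\<^sup>2 / (20 * \<sigma>)" using \<sigma> by simp
      also have "\<dots> = 5 / \<sigma> * (?F x - y)\<^sup>2 - \<bar>?F x - y\<bar> + \<sigma>/20"
        using \<sigma> unfolding power2_diff power_mult_distrib power2_abs by (simp add: field_simps power2_eq_square)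
      finally show ?thesis by linarith
    qed
    show "- \<sigma>/20 + 3/(4*\<sigma>) * z ^ 2 + - (1/(16*\<sigma>^3)) * z ^ 4
        \<le> (\<bar>a + z\<bar> - \<sigma>/20 + (\<bar>a - z\<bar> - \<sigma>/20)) / 2" for a z
    proof -
      text \<open>AM-GM: \<open>16 \<sigma>\<^sup>3 |z| + z\<^sup>4 \<ge> 12 \<sigma>\<^sup>2 z\<^sup>2\<close>.\<close>
      have "0 \<le> (\<bar>z\<bar> - 2 * \<sigma>)\<^sup>2 * (\<bar>z\<bar> * (\<bar>z\<bar> + 4 * \<sigma>))" using \<sigma> by simp
      also have "\<dots> = \<bar>z\<bar> ^ 4 - 12 * \<sigma>\<^sup>2 * \<bar>z\<bar> ^ 2 + 16 * \<sigma> ^ 3 * \<bar>z\<bar>"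
        by (simp add: eval_nat_numeral algebra_simps)
      finally have "12 * \<sigma>\<^sup>2 * z ^ 2 - z ^ 4 \<le> 16 * \<sigma> ^ 3 * \<bar>z\<bar>" by simp
      then have "(12 * \<sigma>\<^sup>2 * z ^ 2 - z ^ 4) / (16 * \<sigma> ^ 3) \<le> \<bar>z\<bar>"
        using \<sigma> by (simp add: divide_le_eq mult.commute)
      also have "(12 * \<sigma>\<^sup>2 * z ^ 2 - z ^ 4) / (16 * \<sigma> ^ 3) = 3/(4*\<sigma>) * z ^ 2 + - (1/(16*\<sigma>^3)) * z ^ 4"
        using \<sigma> by (simp add: field_simps eval_nat_numeral)
      finally have "3/(4*\<sigma>) * z ^ 2 + - (1/(16*\<sigma>^3)) * z ^ 4 \<le> \<bar>z\<bar>" .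
      moreover have "2 * \<bar>z\<bar> \<le> \<bar>a + z\<bar> + \<bar>a - z\<bar>" by linarith
      moreover have "- \<sigma>/20 + w \<le> (u - \<sigma>/20 + (v - \<sigma>/20)) / 2"
        if "w \<le> \<bar>z\<bar>" "2 * \<bar>z\<bar> \<le> u + v" for u v w using that by (simp add: field_simps)
      ultimately show ?thesis unfolding add.assoc by blast
    qed
  qed
  also have "(- \<sigma>/20) + (3/(4*\<sigma>)) * S + (- (1/(16*\<sigma>^3))) * ((3001/1000) * S\<^sup>2) - (5/\<sigma>) * (S * (4/10000))
      = \<sigma> * (- 1/20 + 3/4 - 3001/16000 - 20/10000)"
    using \<sigma> by (simp add: S\<sigma> field_simps eval_nat_numeral)
  also have "\<sigma> / 2 \<le> \<dots>" using \<sigma> by simp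
  finally have 1: "\<sigma> / 2 \<le> (mean_step ^^ (n * b\<^sup>2)) (\<lambda>x. \<bar>?F x\<bar>) x" by simp
  let ?c = "sqrt (real b) * (57/500) / \<sigma>"
  have "sqrt (real b) / 18 \<le> ?c * (\<sigma> / 2)" using \<sigma> by simp
  also have "\<dots> \<le> ?c * (mean_step ^^ (n * b\<^sup>2)) (\<lambda>x. \<bar>?F x\<bar>) x"
    using \<sigma> by (intro mult_left_mono 1) auto
  also have "\<dots> = (mean_step ^^ (n * b\<^sup>2)) (\<lambda>x. ?c * \<bar>?F x\<bar>) x"
    using weighted_run_cmult[of "\<lambda>_. 0" "n * b\<^sup>2" ?c "\<lambda>x _. \<bar>?F x\<bar>" x 0]
    by (simp only: weighted_run_state)
  also have "\<dots> \<le> (mean_step ^^ (n * b\<^sup>2)) (\<lambda>x. real_of_int (gap (cycle_verts n) x)) x"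
  proof (rule funpow_mean_step_mono)
    fix x
    show "?c * \<bar>?F x\<bar> \<le> real_of_int (gap (cycle_verts n) x)"
      using bump_sum_gap(2)[OF b, of x] \<sigma> by (simp add: \<sigma>_def S_def field_simps)
  qed
  finally show ?thesis .
qed
end

section \<open>Histories of rings\<close>

text \<open>A history lists the edges in the reverse order of their rings. The clocks and the marks
  are the values of a single family indexed by a sum type.\<close>

primrec ring_labels :: "'a list \<Rightarrow> ('a \<times> nat) list" where
  "ring_labels [] = []"
| "ring_labels (e # es) = ring_labels es @ [(e, count_list es e)]"

definition clock_time :: "('a \<times> nat + 'b \<Rightarrow> real) \<Rightarrow> 'a \<times> nat \<Rightarrow> real" where
  "clock_time w a = (\<Sum>j\<le>snd a. w (Inl (fst a, j)))"

text \<open>The time of the last ring of \<open>e\<close> in \<open>es\<close>, or 0 if there is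
  none: the moment from which the first unlisted waiting time of \<open>e\<close> runs.\<close>

definition prev_time :: "('a \<times> nat + 'b \<Rightarrow> real) \<Rightarrow> 'a list \<Rightarrow> 'a \<Rightarrow> real" where
  "prev_time w es e = (\<Sum>j<count_list es e. w (Inl (e, j)))"

primrec last_ring :: "('a \<times> nat + 'b \<Rightarrow> real) \<Rightarrow> 'a list \<Rightarrow> real" where
  "last_ring w [] = 0"
| "last_ring w (e # es) = clock_time w (e, count_list es e)"

primrec in_order :: "('a \<times> nat + 'b \<Rightarrow> real) \<Rightarrow> 'a list \<Rightarrow> bool" where
  "in_order w [] = True"
| "in_order w (e # es) \<longleftrightarrow> in_order w es \<and> last_ring w es < clock_time w (e, count_list es e)"

primrec run_hist ::
    "('v set \<Rightarrow> 'v \<times> 'v) \<Rightarrow> ('v set \<Rightarrow> int \<Rightarrow> real) \<Rightarrow> ('v \<Rightarrow> int) \<Rightarrow>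
     ('a + 'v set \<times> nat \<Rightarrow> real) \<Rightarrow> 'v set list \<Rightarrow> ('v \<Rightarrow> int)" where
  "run_hist ori p x w [] = x"
| "run_hist ori p x w (e # es) = ring_update ori p e (w (Inr (e, count_list es e))) (run_hist ori p x w es)"

lemma run_hist_fold:
  "run_hist ori p x w es = fold (\<lambda>(e, k). ring_update ori p e (w (Inr (e, k)))) (ring_labels es) x"
  by (induction es) auto

lemma set_ring_labels: "set (ring_labels es) = {(e, k). k < count_list es e}"
  by (induction es) (auto simp: less_Suc_eq split: if_splits)

lemma map_fst_ring_labels: "map fst (ring_labels es) = rev es"
  by (induction es) auto

lemma ring_labels_inj: "ring_labels es = ring_labels es' \<Longrightarrow> es = es'"
  by (metis map_fst_ring_labels rev_rev_ident)

lemma clock_time_prev: "clock_time w (e, count_list es e) = prev_time w es e + w (Inl (e, count_list es e))"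
  by (simp add: clock_time_def prev_time_def lessThan_Suc_atMost[symmetric])

lemma in_order_nonneg: "in_order w es \<Longrightarrow> 0 \<le> last_ring w es"
  by (induction es) auto

lemma in_order_le_last:
  "in_order w es \<Longrightarrow> a \<in> set (ring_labels es) \<Longrightarrow> clock_time w a \<le> last_ring w es"
  by (induction es) fastforce+

lemma in_order_sorted:
  "in_order w es \<Longrightarrow> sorted_wrt (\<lambda>a b. clock_time w a < clock_time w b) (ring_labels es)"
  by (induction es) (auto simp: sorted_wrt_append dest: in_order_le_last)

lemma prev_time_le_last:
  assumes "in_order w es"
  shows "prev_time w es e \<le> last_ring w es"
proof (cases "count_list es e")
  case 0
  then show ?thesis using in_order_nonneg[OF assms] by (simp add: prev_time_def)
next
  case (Suc k)
  have "prev_time w es e = clock_time w (e, k)"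
    by (simp add: prev_time_def clock_time_def Suc lessThan_Suc_atMost)
  also have "\<dots> \<le> last_ring w es"
    by (rule in_order_le_last[OF assms]) (simp add: set_ring_labels Suc)
  finally show ?thesis .
qed

text \<open>This converts the survival probabilities of the unlisted rings into the exponential
  weight that cancels the densities of the listed clocks in \<open>ordered_integral\<close>.\<close>

lemma sum_prev_time:
  assumes "finite E" "set es \<subseteq> E"
  shows "(\<Sum>e\<in>E. prev_time w es e) = (\<Sum>a\<in>set (ring_labels es). w (Inl a))"
proof -
  have "set (ring_labels es) = (SIGMA e:E. {..<count_list es e})"
    using assms(2) by (auto simp: set_ring_labels) (metis count_list_0_iff less_nat_zero_code subsetD)
  then show ?thesis
    using assms(1) by (simp add: prev_time_def sum.Sigma)
qed

section \<open>Effect of changing a single clock or mark\<close>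

lemma clock_time_upd_Inr [simp]: "clock_time (w(Inr b := y)) = clock_time w"
  by (intro ext) (simp add: clock_time_def)

lemma last_ring_upd_Inr [simp]: "last_ring (w(Inr b := y)) es = last_ring w es"
  by (cases es) simp_all

lemma in_order_upd_Inr [simp]: "in_order (w(Inr b := y)) es = in_order w es"
  by (induction es) (simp_all only: in_order.simps last_ring_upd_Inr clock_time_upd_Inr)

lemma clock_time_upd_Inl:
  "fst a = e \<Longrightarrow> snd a < k \<Longrightarrow> clock_time (w(Inl (e, k) := y)) a = clock_time w a"
  "fst a \<noteq> e \<Longrightarrow> clock_time (w(Inl (e, k) := y)) a = clock_time w a"
  by (auto simp: clock_time_def)

lemma prev_time_upd_Inl: "count_list es e \<le> k \<Longrightarrow> prev_time (w(Inl (e, k) := y)) es e' = prev_time w es e'"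
  by (auto simp: prev_time_def intro!: sum.cong)

lemma last_ring_upd_Inl: "count_list es e \<le> k \<Longrightarrow> last_ring (w(Inl (e, k) := y)) es = last_ring w es"
  by (cases es) (auto simp: clock_time_upd_Inl split: if_splits)

lemma in_order_upd_Inl: "count_list es e \<le> k \<Longrightarrow> in_order (w(Inl (e, k) := y)) es = in_order w es"
proof (induction es)
  case (Cons a es)
  then have k: "count_list es e \<le> k" and k': "a = e \<Longrightarrow> count_list es e < k" by (auto split: if_splits)
  have "clock_time (w(Inl (e, k) := y)) (a, count_list es a) = clock_time w (a, count_list es a)"
    using k' by (cases "a = e") (simp_all only: clock_time_upd_Inl fst_conv snd_conv simp_thms)
  then show ?case by (simp only: in_order.simps Cons.IH[OF k] last_ring_upd_Inl[OF k])
qed simp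

lemma run_hist_upd_Inr:
  "count_list es e \<le> k \<Longrightarrow> run_hist ori p x (w(Inr (e, k) := y)) es = run_hist ori p x w es"
  by (induction es) (auto split: if_splits)

text \<open>Completeness of the list up to \<open>t\<close> is expressed through the first unlisted
  ring of each edge, so that for finite \<open>E\<close> the event depends on finitely many
  clocks.\<close>

definition hist_event :: "'a set \<Rightarrow> real \<Rightarrow> 'a list \<Rightarrow> ('a \<times> nat + 'b \<Rightarrow> real) \<Rightarrow> bool" where
  "hist_event E t es w \<longleftrightarrow> in_order w es \<and> last_ring w es \<le> t \<and> (\<forall>e\<in>E. t < clock_time w (e, count_list es e))"

lemma pred_countable_Ball:
  assumes "countable X" "\<And>i. i \<in> X \<Longrightarrow> Measurable.pred M (\<lambda>x. P x i)"
  shows "Measurable.pred M (\<lambda>x. \<forall>i\<in>X. P x i)"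
proof -
  have "{x \<in> space M. \<not> P x i} \<in> sets M" if "i \<in> X" for i
  proof -
    note [measurable] = assms(2)[OF that]
    show ?thesis by measurable
  qed
  then have "space M - (\<Union>i\<in>X. {x \<in> space M. \<not> P x i}) \<in> sets M"
    using assms(1) by (intro sets.Diff sets.top sets.countable_UN') auto
  also have "space M - (\<Union>i\<in>X. {x \<in> space M. \<not> P x i}) = {x \<in> space M. \<forall>i\<in>X. P x i}" by auto
  finally show ?thesis unfolding pred_def .
qed

section \<open>Histories and the chronological list of rings\<close>

lemma strictly_sorted_key_unique:
  fixes f :: "'a \<Rightarrow> 'b :: linorder"
  assumes "sorted_wrt (\<lambda>a b. f a < f b) xs" "sorted_wrt (\<lambda>a b. f a < f b) ys" "set xs = set ys"
  shows "xs = ys"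
proof -
  have "map f xs = map f ys"
    using assms by (intro strict_sorted_equal) (simp_all add: sorted_wrt_map)
  moreover have "inj_on f (set xs)"
    using assms(1) by (metis distinct_map sorted_wrt_map strict_sorted_iff)
  ultimately show ?thesis using assms(3) by (metis map_inj_on Un_absorb)
qed

lemma rings_upto_eqI:
  assumes "sorted_wrt (\<lambda>a b. ring_time S \<omega> a < ring_time S \<omega> b) l"
    and "set l = {a \<in> E \<times> UNIV. ring_time S \<omega> a \<le> t}"
  shows "rings_upto E S t \<omega> = l"
proof -
  let ?P = "\<lambda>l. sorted_wrt (\<lambda>a b. ring_time S \<omega> a < ring_time S \<omega> b) l \<and>
      set l = {a \<in> E \<times> UNIV. ring_time S \<omega> a \<le> t}"
  have "(THE l. ?P l) = l"
    by (rule the_equality) (use assms strictly_sorted_key_unique[of "ring_time S \<omega>"] in auto)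
  then show ?thesis using assms unfolding rings_upto_def Let_def by auto
qed

text \<open>Nonnegative waiting times make the ring times of an edge monotone, so a first unlisted
  ring after \<open>t\<close> excludes all later ones.\<close>

lemma rings_upto_hist:
  assumes ev: "hist_event E t es w" and es: "set es \<subseteq> E"
    and w: "\<And>e k. e \<in> E \<Longrightarrow> w (Inl (e, k)) = S e k \<omega>" and S: "\<And>e k. e \<in> E \<Longrightarrow> 0 \<le> S e k \<omega>"
  shows "rings_upto E S t \<omega> = ring_labels es"
proof -
  have time: "ring_time S \<omega> a = clock_time w a" if "fst a \<in> E" for a
    using that by (simp add: ring_time_def clock_time_def split_beta w)
  have lab: "fst a \<in> E" if "a \<in> set (ring_labels es)" for a
    using that es by (auto simp: set_ring_labels) (metis count_list_0_iff less_nat_zero_code subsetD)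
  have 1: "sorted_wrt (\<lambda>a b. ring_time S \<omega> a < ring_time S \<omega> b) (ring_labels es)"
    by (rule sorted_wrt_mono_rel[rotated, OF in_order_sorted])
       (use ev lab time in \<open>auto simp: hist_event_def\<close>)
  have "ring_time S \<omega> (e, k) \<le> t \<longleftrightarrow> k < count_list es e" if e: "e \<in> E" for e k
  proof
    assume "k < count_list es e"
    then have "clock_time w (e, k) \<le> last_ring w es"
      using ev by (intro in_order_le_last) (auto simp: hist_event_def set_ring_labels)
    then show "ring_time S \<omega> (e, k) \<le> t" using ev time[of "(e, k)"] e by (simp add: hist_event_def)
  next
    assume le: "ring_time S \<omega> (e, k) \<le> t"
    show "k < count_list es e"
    proof (rule ccontr)
      assume "\<not> ?thesis"
      then have "clock_time w (e, count_list es e) \<le> clock_time w (e, k)"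
        unfolding clock_time_def fst_conv snd_conv using S[OF e] w[OF e] by (intro sum_mono2) auto
      then show False using ev le e time[of "(e, k)"] by (force simp: hist_event_def)
    qed
  qed
  then have "set (ring_labels es) = {a \<in> E \<times> UNIV. ring_time S \<omega> a \<le> t}"
    using lab by (auto simp: set_ring_labels)
  with 1 show ?thesis by (rule rings_upto_eqI)
qed

section \<open>Integrating out the clocks and the marks\<close>

definition exp_clock :: "real measure" where
  "exp_clock = density lborel (exponential_density 1)"

definition unif_mark :: "real measure" where
  "unif_mark = density lborel (indicator {0<..<1})"

definition clock_mark :: "'a + 'b \<Rightarrow> real measure" where
  "clock_mark i = (case i of Inl _ \<Rightarrow> exp_clock | Inr _ \<Rightarrow> unif_mark)"

lemma sets_exp_clock [simp, measurable_cong]: "sets exp_clock = sets borel"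
  and sets_unif_mark [simp, measurable_cong]: "sets unif_mark = sets borel"
  by (simp_all add: exp_clock_def unif_mark_def)

lemma sets_clock_mark [simp, measurable_cong]: "sets (clock_mark i) = sets borel"
  by (cases i) (simp_all add: clock_mark_def)

lemma prob_space_exp_clock: "prob_space exp_clock"
  unfolding exp_clock_def by (rule prob_space_exponential_density) simp

lemma prob_space_unif_mark: "prob_space unif_mark"
  by (rule prob_spaceI) (simp add: unif_mark_def emeasure_density)

lemma prob_space_clock_mark: "prob_space (clock_mark i)"
  by (cases i) (simp_all add: clock_mark_def prob_space_exp_clock prob_space_unif_mark)

lemma nn_integral_exp_clock:
  assumes "f \<in> borel_measurable borel"
  shows "(\<integral>\<^sup>+y. f y \<partial>exp_clock) = (\<integral>\<^sup>+y. ennreal (exponential_density 1 y) * f y \<partial>lborel)"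
  unfolding exp_clock_def using assms by (intro nn_integral_density) auto

lemma exp_clock_tail:
  assumes "0 \<le> c"
  shows "(\<integral>\<^sup>+y. ennreal (of_bool (c < y)) \<partial>exp_clock) = ennreal (exp (- c))"
proof -
  interpret prob_space exp_clock by (rule prob_space_exp_clock)
  have D: "distributed exp_clock lborel (\<lambda>y. y) (exponential_density 1)"
    by (auto simp: distributed_def exp_clock_def distr_id2 sets_density)
  have "(\<integral>\<^sup>+y. ennreal (of_bool (c < y)) \<partial>exp_clock) = (\<integral>\<^sup>+y. indicator {y \<in> space exp_clock. c < y} y \<partial>exp_clock)"
    by (intro nn_integral_cong) (auto simp: indicator_def)
  also have "\<dots> = emeasure exp_clock {y \<in> space exp_clock. c < y}"
    by (intro nn_integral_indicator) simp
  also have "\<dots> = ennreal (exp (- c))"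
    using exponential_distributedD_gt[OF D assms] by (simp add: emeasure_eq_measure)
  finally show ?thesis .
qed

text \<open>The factor \<open>exp y\<close> cancels the exponential density, leaving the integral of
  \<open>(b - y) ^ k / fact k\<close> from \<open>a\<close> to \<open>b\<close>. This is the
  induction step of \<open>ordered_integral\<close>.\<close>

lemma exp_clock_ordered:
  assumes "0 \<le> a" "a \<le> b"
  shows "(\<integral>\<^sup>+y. ennreal (of_bool (a < y \<and> y \<le> b) * exp y * (b - y) ^ k / fact k) \<partial>exp_clock)
     = ennreal ((b - a) ^ Suc k / fact (Suc k))"
proof -
  have "(\<integral>\<^sup>+y. ennreal (of_bool (a < y \<and> y \<le> b) * exp y * (b - y) ^ k / fact k) \<partial>exp_clock)
    = (\<integral>\<^sup>+y. ennreal (exponential_density 1 y) *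
        ennreal (of_bool (a < y \<and> y \<le> b) * exp y * (b - y) ^ k / fact k) \<partial>lborel)"
    by (rule nn_integral_exp_clock) measurable
  also have "\<dots> = (\<integral>\<^sup>+y. ennreal ((b - y) ^ k / fact k) * indicator {a..b} y \<partial>lborel)"
  proof (rule nn_integral_cong_AE)
    show "AE y in lborel. ennreal (exponential_density 1 y) *
        ennreal (of_bool (a < y \<and> y \<le> b) * exp y * (b - y) ^ k / fact k)
      = ennreal ((b - y) ^ k / fact k) * indicator {a..b} y"
      using AE_lborel_singleton[of a]
    proof eventually_elim
      case (elim y)
      show ?case
      proof (cases "a < y \<and> y \<le> b")
        case True
        then have "exponential_density 1 y * (exp y * (b - y) ^ k / fact k) = (b - y) ^ k / fact k"
          using assms by (simp add: exponential_density_def exp_minus field_simps)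
        then show ?thesis using True assms by (simp add: ennreal_mult'[symmetric] exponential_density_nonneg)
      qed (use elim in \<open>auto simp: indicator_def\<close>)
    qed
  qed
  also have "\<dots> = ennreal ((- ((b - b) ^ Suc k / fact (Suc k))) - (- ((b - a) ^ Suc k / fact (Suc k))))"
  proof (rule nn_integral_FTC_Icc)
    fix y assume y: "y \<in> {a..b}"
    have "((\<lambda>y. - ((b - y) ^ Suc k / fact (Suc k))) has_real_derivative
        - (real (Suc k) * (b - y) ^ k * (- 1) / fact (Suc k))) (at y)"
      by (rule derivative_eq_intros refl | simp)+
    then show "((\<lambda>y. - ((b - y) ^ Suc k / fact (Suc k))) has_real_derivative (b - y) ^ k / fact k) (at y)"
      by (simp add: fact_Suc del: of_nat_Suc)
    show "0 \<le> (b - y) ^ k / fact k" using y by simp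
  qed (use assms in auto)
  finally show ?thesis by simp
qed

lemma unif_mark_le:
  assumes q: "0 \<le> q" "q \<le> 1" and "0 \<le> A" "0 \<le> B"
  shows "(\<integral>\<^sup>+y. ennreal (if y \<le> q then A else B) \<partial>unif_mark) = ennreal (q * A + (1 - q) * B)"
proof -
  have "(\<integral>\<^sup>+y. ennreal (if y \<le> q then A else B) \<partial>unif_mark)
     = (\<integral>\<^sup>+y. indicator {0<..<1} y * ennreal (if y \<le> q then A else B) \<partial>lborel)"
    unfolding unif_mark_def by (intro nn_integral_density) auto
  also have "\<dots> = (\<integral>\<^sup>+y. ennreal A * indicator {0..q} y + ennreal B * indicator {q..1} y \<partial>lborel)"
  proof (rule nn_integral_cong_AE)
    show "AE y in lborel. indicator {0<..<1} y * ennreal (if y \<le> q then A else B)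
        = ennreal A * indicator {0..q} y + ennreal B * indicator {q..1} y"
      using AE_lborel_singleton[of 0] AE_lborel_singleton[of 1] AE_lborel_singleton[of q]
      by eventually_elim (use q in \<open>auto simp: indicator_def\<close>)
  qed
  also have "\<dots> = ennreal A * emeasure lborel {0..q} + ennreal B * emeasure lborel {q..1}"
    by (simp add: nn_integral_add nn_integral_cmult_indicator)
  also have "\<dots> = ennreal (q * A + (1 - q) * B)"
    using assms by (simp add: ennreal_mult'[symmetric] ennreal_plus[symmetric] mult.commute del: ennreal_plus)
  finally show ?thesis .
qed

interpretation clock_mark: product_sigma_finite "clock_mark :: 'a + 'b \<Rightarrow> real measure"
  by (intro product_sigma_finite.intro prob_space_imp_sigma_finite prob_space_clock_mark)

lemma component_borel: "i \<in> J \<Longrightarrow> (\<lambda>w. w i) \<in> borel_measurable (PiM J clock_mark)"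
  using measurable_component_singleton[of i J clock_mark]
  unfolding measurable_cong_sets[OF refl sets_clock_mark] .

lemma clock_time_borel:
  assumes "\<And>j. j \<le> snd a \<Longrightarrow> Inl (fst a, j) \<in> J"
  shows "(\<lambda>w. clock_time w a) \<in> borel_measurable (PiM J clock_mark)"
  unfolding clock_time_def by (intro borel_measurable_sum component_borel assms) auto

lemma prev_time_borel:
  assumes "\<And>j. j < count_list es e \<Longrightarrow> Inl (e, j) \<in> J"
  shows "(\<lambda>w. prev_time w es e) \<in> borel_measurable (PiM J clock_mark)"
  unfolding prev_time_def by (intro borel_measurable_sum component_borel assms) auto

lemma last_ring_borel:
  assumes "Inl ` set (ring_labels es) \<subseteq> J"
  shows "(\<lambda>w. last_ring w es) \<in> borel_measurable (PiM J clock_mark)"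
proof (cases es)
  case (Cons e es')
  have "(\<lambda>w. clock_time w (e, count_list es' e)) \<in> borel_measurable (PiM J clock_mark)"
    using assms unfolding Cons by (intro clock_time_borel) (auto simp: set_ring_labels image_subset_iff le_less)
  then show ?thesis by (simp add: Cons)
qed simp

lemma in_order_borel:
  assumes "Inl ` set (ring_labels es) \<subseteq> J"
  shows "Measurable.pred (PiM J clock_mark) (\<lambda>w. in_order w es)"
  using assms
proof (induction es)
  case (Cons e es)
  then have sub: "Inl ` set (ring_labels es) \<subseteq> J" by auto
  have [measurable]: "Measurable.pred (PiM J clock_mark) (\<lambda>w. in_order w es)" by (rule Cons.IH[OF sub])
  have [measurable]: "(\<lambda>w. last_ring w es) \<in> borel_measurable (PiM J clock_mark)"
    "(\<lambda>w. clock_time w (e, count_list es e)) \<in> borel_measurable (PiM J clock_mark)"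
    using last_ring_borel[OF sub] last_ring_borel[OF Cons.prems] by simp_all
  show ?case unfolding in_order.simps by measurable
qed simp

text \<open>The exponential weight cancels the densities of the listed clocks and leaves the volume
  of the ordered ring times. The factor \<open>(t - last_ring w es) ^ k / fact k\<close> is the
  volume of \<open>k\<close> further ordered times; with it the induction closes, since integrating
  the latest waiting time first raises \<open>k\<close> by one.\<close>

lemma ordered_integral:
  fixes es :: "'a list"
  assumes t: "0 \<le> t"
  shows "(\<integral>\<^sup>+w. ennreal (of_bool (in_order w es \<and> last_ring w es \<le> t) *
        exp (\<Sum>a\<in>set (ring_labels es). w (Inl a)) * (t - last_ring w es) ^ k / fact k)
      \<partial>PiM (Inl ` set (ring_labels es)) (clock_mark :: 'a \<times> nat + 'b \<Rightarrow> real measure))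
    = ennreal (t ^ (length es + k) / fact (length es + k))"
proof (induction es arbitrary: k)
  case Nil
  show ?case using t by (simp add: nn_integral_count_space_finite PiM_empty)
next
  case (Cons e es)
  define c where "c = count_list es e"
  define J :: "('a \<times> nat + 'b) set" where "J = Inl ` set (ring_labels es)"
  have ins: "Inl ` set (ring_labels (e # es)) = insert (Inl (e, c)) J"
    by (simp add: J_def c_def)
  have "finite J" by (simp add: J_def)
  moreover have "Inl (e, c) \<notin> J" by (auto simp: J_def c_def set_ring_labels)
  ultimately have J: "finite J" "Inl (e, c) \<notin> J" .
  let ?s = "\<lambda>w. \<Sum>a\<in>set (ring_labels es). w (Inl a :: 'a \<times> nat + 'b) :: real"
  have set: "set (ring_labels (e # es)) = insert (e, c) (set (ring_labels es))" "(e, c) \<notin> set (ring_labels es)"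
    by (auto simp: c_def set_ring_labels)
  let ?f = "\<lambda>w. ennreal (of_bool (in_order w (e # es) \<and> last_ring w (e # es) \<le> t) *
        exp (\<Sum>a\<in>set (ring_labels (e # es)). w (Inl a :: 'a \<times> nat + 'b)) * (t - last_ring w (e # es)) ^ k / fact k)"
  have meas: "?f \<in> borel_measurable (PiM (insert (Inl (e, c)) J) clock_mark)"
  proof -
    have sub: "Inl ` set (ring_labels (e # es)) \<subseteq> insert (Inl (e, c)) J" by (simp only: ins order_refl)
    note [measurable] = in_order_borel[OF sub] last_ring_borel[OF sub]
    have [measurable]: "(\<lambda>w. \<Sum>a\<in>set (ring_labels (e # es)). w (Inl a))
        \<in> borel_measurable (PiM (insert (Inl (e, c)) J) clock_mark)"
      by (intro borel_measurable_sum component_borel) (auto simp: J_def c_def)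
    show ?thesis by measurable
  qed
  have inner: "(\<integral>\<^sup>+y. ?f (w(Inl (e, c) := y)) \<partial>clock_mark (Inl (e, c) :: 'a \<times> nat + 'b))
     = ennreal (of_bool (in_order w es \<and> last_ring w es \<le> t) * exp (?s w) * (t - last_ring w es) ^ Suc k / fact (Suc k))"
    for w
  proof (cases "in_order w es \<and> last_ring w es \<le> t")
    case True
    \<comment> \<open>The latest ring falls after the earlier ones and by time \<open>t\<close>
      exactly when its waiting time exceeds \<open>a\<close> and is at most
      \<open>b\<close>.\<close>
    define a where "a = last_ring w es - prev_time w es e"
    define b where "b = t - prev_time w es e"
    have ab: "0 \<le> a" "a \<le> b" using True prev_time_le_last[of w es e] by (auto simp: a_def b_def)
    have eq: "?f (w(Inl (e, c) := y)) = ennreal (exp (?s w)) *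
        ennreal (of_bool (a < y \<and> y \<le> b) * exp y * (b - y) ^ k / fact k)" for y
    proof -
      have c: "count_list es e \<le> c" by (simp add: c_def)
      have last: "last_ring (w(Inl (e, c) := y)) (e # es) = prev_time w es e + y"
        using clock_time_prev[of "w(Inl (e, c) := y)" e es]
        by (simp add: prev_time_upd_Inl[OF c] c_def[symmetric])
      have ord: "in_order (w(Inl (e, c) := y)) (e # es) \<longleftrightarrow> a < y"
        using last True
        by (simp add: in_order_upd_Inl[OF c] last_ring_upd_Inl[OF c] a_def c_def[symmetric] algebra_simps)
      have "(\<Sum>a\<in>set (ring_labels es). (w(Inl (e, c) := y)) (Inl a)) = ?s w"
        using set(2) by (intro sum.cong) auto
      then have sum: "(\<Sum>a\<in>set (ring_labels (e # es)). (w(Inl (e, c) := y)) (Inl a)) = y + ?s w"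
        unfolding set(1) using set(2) by simp
      have le: "prev_time w es e + y \<le> t \<longleftrightarrow> y \<le> b" "t - (prev_time w es e + y) = b - y"
        by (auto simp: b_def)
      show ?thesis
        unfolding ord last sum le exp_add
        by (simp add: ennreal_mult'[symmetric] mult_ac)
    qed
    have "(\<integral>\<^sup>+y. ?f (w(Inl (e, c) := y)) \<partial>clock_mark (Inl (e, c) :: 'a \<times> nat + 'b))
       = ennreal (exp (?s w)) * (\<integral>\<^sup>+y. ennreal (of_bool (a < y \<and> y \<le> b) * exp y * (b - y) ^ k / fact k) \<partial>exp_clock)"
      unfolding eq clock_mark_def sum.case by (intro nn_integral_cmult) measurable
    also have "\<dots> = ennreal (exp (?s w)) * ennreal ((b - a) ^ Suc k / fact (Suc k))"
      by (simp only: exp_clock_ordered[OF ab])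
    also have "b - a = t - last_ring w es" by (simp add: a_def b_def)
    also have "ennreal (exp (?s w)) * ennreal ((t - last_ring w es) ^ Suc k / fact (Suc k))
       = ennreal (of_bool (in_order w es \<and> last_ring w es \<le> t) * exp (?s w) * (t - last_ring w es) ^ Suc k / fact (Suc k))"
      using True by (simp add: ennreal_mult'[symmetric])
    finally show ?thesis .
  next
    case False
    have "\<not> (in_order (w(Inl (e, c) := y)) (e # es) \<and> last_ring (w(Inl (e, c) := y)) (e # es) \<le> t)" for y
      using False by (auto simp: in_order_upd_Inl last_ring_upd_Inl c_def simp del: fun_upd_apply)
    then have zero: "?f (w(Inl (e, c) := y)) = 0" for y by (simp only: of_bool_eq_0_iff[THEN iffD2] simp_thms mult_zero_left div_0 ennreal_0)
    have "ennreal (of_bool (in_order w es \<and> last_ring w es \<le> t) * exp (?s w) * (t - last_ring w es) ^ Suc k / fact (Suc k)) = 0"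
      using False by auto
    then show ?thesis by (simp only: zero nn_integral_const mult_zero_left)
  qed
  have "integral\<^sup>N (PiM (insert (Inl (e, c)) J) clock_mark) ?f
     = (\<integral>\<^sup>+w. ennreal (of_bool (in_order w es \<and> last_ring w es \<le> t) * exp (?s w) *
          (t - last_ring w es) ^ Suc k / fact (Suc k)) \<partial>PiM J clock_mark)"
    unfolding clock_mark.product_nn_integral_insert[OF J meas] inner ..
  also have "\<dots> = ennreal (t ^ (length es + Suc k) / fact (length es + Suc k))"
    unfolding J_def by (rule Cons.IH)
  finally show ?case unfolding ins by simp
qed

text \<open>The first unlisted waiting time of \<open>e\<close> exceeds
  \<open>t - prev_time w es e\<close> with the exponential tail probability; \<open>b0\<close>
  confines the integral to the region where this number is nonnegative. The induction absorbs each
  such factor into \<open>b\<close>, which is why \<open>b\<close> is general.\<close>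

lemma residual_integral:
  fixes es :: "'a list"
  assumes A: "finite A" and J: "finite J" "\<And>e. e \<in> A \<Longrightarrow> Inl (e, count_list es e) \<notin> J"
    and lab: "\<And>e j. e \<in> A \<Longrightarrow> j < count_list es e \<Longrightarrow> Inl (e, j) \<in> J"
    and b: "b \<in> borel_measurable (PiM J clock_mark)"
    and b0: "\<And>w e. e \<in> A \<Longrightarrow> t < prev_time w es e \<Longrightarrow> b w = 0"
    and b_upd: "\<And>w e y. e \<in> A \<Longrightarrow> b (w(Inl (e, count_list es e) := y)) = b w"
    and b_meas: "\<And>J'. J \<subseteq> J' \<Longrightarrow> b \<in> borel_measurable (PiM J' clock_mark)"
  shows "(\<integral>\<^sup>+w. b w * ennreal (of_bool (\<forall>e\<in>A. t < clock_time w (e, count_list es e)))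
      \<partial>PiM (J \<union> (\<lambda>e. Inl (e, count_list es e)) ` A) (clock_mark :: 'a \<times> nat + 'b \<Rightarrow> real measure))
    = (\<integral>\<^sup>+w. b w * ennreal (exp (- (\<Sum>e\<in>A. t - prev_time w es e))) \<partial>PiM J clock_mark)"
  using A J(2) lab b b0 b_upd b_meas
proof (induction A arbitrary: b rule: finite_induct)
  case empty
  then show ?case by simp
next
  case (insert e A)
  define i :: "'a \<times> nat + 'b" where "i = Inl (e, count_list es e)"
  define R :: "('a \<times> nat + 'b) set" where "R = J \<union> (\<lambda>e. Inl (e, count_list es e)) ` A"
  have R: "finite R" "i \<notin> R" using insert.hyps insert.prems(1) J(1) by (auto simp: R_def i_def)
  have un: "J \<union> (\<lambda>e. Inl (e, count_list es e)) ` insert e A = insert i R" by (auto simp: R_def i_def)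
  have upd: "clock_time (w(i := y)) (f, count_list es f) = clock_time w (f, count_list es f)" if "f \<in> A" for w y f
    using that insert.hyps unfolding i_def by (intro clock_time_upd_Inl(2)) auto
  have upd_e: "clock_time (w(i := y)) (e, count_list es e) = prev_time w es e + y" for w y
    using clock_time_prev[of "w(i := y)" e es] by (simp add: i_def prev_time_upd_Inl)
  let ?f = "\<lambda>w. b w * ennreal (of_bool (\<forall>e\<in>insert e A. t < clock_time w (e, count_list es e)))"
  let ?g = "\<lambda>w. ennreal (of_bool (\<forall>e\<in>A. t < clock_time w (e, count_list es e)))"
  let ?b = "\<lambda>w. b w * ennreal (exp (- (t - prev_time w es e)))"
  have meas: "?f \<in> borel_measurable (PiM (insert i R) clock_mark)"
  proof -
    have [measurable]: "b \<in> borel_measurable (PiM (insert i R) clock_mark)"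
      by (rule insert.prems(6)) (auto simp: R_def)
    have [measurable]: "(\<lambda>w. clock_time w (f, count_list es f)) \<in> borel_measurable (PiM (insert i R) clock_mark)"
      if "f \<in> insert e A" for f
      using that insert.prems(2) by (intro clock_time_borel) (auto simp: R_def i_def le_less)
    have [measurable]: "Measurable.pred (PiM (insert i R) clock_mark) (\<lambda>w. \<forall>e\<in>insert e A. t < clock_time w (e, count_list es e))"
      by (rule pred_intros_finite) (use insert.hyps in \<open>auto intro!: borel_measurable_less[unfolded pred_def] simp: pred_def\<close>)
    show ?thesis by measurable
  qed
  have inner: "(\<integral>\<^sup>+y. ?f (w(i := y)) \<partial>clock_mark i) = ?b w * ?g w" for w
  proof (cases "t < prev_time w es e")
    case True
    have z1: "b w = 0" by (rule insert.prems(4)[OF insertI1 True])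
    have z: "b (w(i := y)) = 0" for y
      unfolding i_def insert.prems(5)[OF insertI1] by (rule z1)
    show ?thesis by (simp only: z z1 mult_zero_left nn_integral_const)
  next
    case False
    have eq: "?f (w(i := y)) = (b w * ?g w) * ennreal (of_bool (t - prev_time w es e < y))" for y
    proof -
      have "b (w(i := y)) = b w" unfolding i_def by (rule insert.prems(5)[OF insertI1])
      moreover have "(\<forall>f\<in>insert e A. t < clock_time (w(i := y)) (f, count_list es f)) \<longleftrightarrow>
          t - prev_time w es e < y \<and> (\<forall>f\<in>A. t < clock_time w (f, count_list es f))"
        using upd upd_e by (auto simp: algebra_simps)
      ultimately show ?thesis by (auto simp: mult.assoc)
    qed
    have "(\<integral>\<^sup>+y. ?f (w(i := y)) \<partial>clock_mark i)
       = (b w * ?g w) * (\<integral>\<^sup>+y. ennreal (of_bool (t - prev_time w es e < y)) \<partial>exp_clock)"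
      unfolding eq unfolding i_def clock_mark_def sum.case by (intro nn_integral_cmult) measurable
    then show ?thesis using False by (simp only: exp_clock_tail not_less diff_ge_0_iff_ge) (simp add: mult_ac)
  qed
  have "integral\<^sup>N (PiM (insert i R) clock_mark) ?f = (\<integral>\<^sup>+w. ?b w * ?g w \<partial>PiM R clock_mark)"
    unfolding clock_mark.product_nn_integral_insert[OF R meas] inner ..
  also have "\<dots> = (\<integral>\<^sup>+w. ?b w * ennreal (exp (- (\<Sum>e\<in>A. t - prev_time w es e))) \<partial>PiM J clock_mark)"
    unfolding R_def
  proof (rule insert.IH)
    fix J' :: "('a \<times> nat + 'b) set" assume "J \<subseteq> J'"
    then have [measurable]: "b \<in> borel_measurable (PiM J' clock_mark)"
      "(\<lambda>w. prev_time w es e) \<in> borel_measurable (PiM J' clock_mark)"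
      using insert.prems(2,6) by (auto intro!: prev_time_borel)
    show "?b \<in> borel_measurable (PiM J' clock_mark)" by measurable
  next
    show "?b \<in> borel_measurable (PiM J clock_mark)"
    proof -
      have [measurable]: "b \<in> borel_measurable (PiM J clock_mark)"
        "(\<lambda>w. prev_time w es e) \<in> borel_measurable (PiM J clock_mark)"
        using insert.prems(2,3) by (auto intro!: prev_time_borel)
      show ?thesis by measurable
    qed
  next
    fix w f y assume "f \<in> A"
    then have "b (w(Inl (f, count_list es f) := y)) = b w" by (intro insert.prems(5)) auto
    then show "?b (w(Inl (f, count_list es f) := y)) = ?b w" by (simp only: prev_time_upd_Inl[OF order_refl])
  next
    fix w :: "'a \<times> nat + 'b \<Rightarrow> real" and f assume "f \<in> A" "t < prev_time w es f"
    then have "b w = 0" by (intro insert.prems(4)[of f]) auto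
    then show "?b w = 0" by simp
  qed (use insert.prems(1,2,6) in auto)
  also have "\<dots> = (\<integral>\<^sup>+w. b w * ennreal (exp (- (\<Sum>e\<in>insert e A. t - prev_time w es e))) \<partial>PiM J clock_mark)"
    using insert.hyps
    by (intro nn_integral_cong) (simp add: mult.assoc ennreal_mult'[symmetric] exp_add[symmetric] algebra_simps)
  finally show ?case unfolding un .
qed

text \<open>Stated for all observables \<open>\<psi>\<close> at once: the induction replaces
  \<open>\<psi>\<close> by its composition with an update, and only real-valued functions have to be
  measurable.\<close>

lemma run_hist_measurable:
  fixes \<psi> :: "('v \<Rightarrow> int) \<Rightarrow> real"
  assumes X: "\<And>\<psi> :: ('v \<Rightarrow> int) \<Rightarrow> real. (\<lambda>\<omega>. \<psi> (X \<omega>)) \<in> borel_measurable M"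
    and W: "\<And>a. a \<in> set (ring_labels es) \<Longrightarrow> (\<lambda>\<omega>. W \<omega> (Inr a)) \<in> borel_measurable M"
  shows "(\<lambda>\<omega>. \<psi> (run_hist ori p (X \<omega>) (W \<omega>) es)) \<in> borel_measurable M"
  using W
proof (induction es arbitrary: \<psi>)
  case Nil
  then show ?case using X by simp
next
  case (Cons e es)
  let ?r = "\<lambda>\<omega>. run_hist ori p (X \<omega>) (W \<omega>) es"
  have IH [measurable]: "(\<lambda>\<omega>. \<psi> (?r \<omega>)) \<in> borel_measurable M" for \<psi> :: "('v \<Rightarrow> int) \<Rightarrow> real"
    by (rule Cons.IH) (use Cons.prems in auto)
  have [measurable]: "(\<lambda>\<omega>. W \<omega> (Inr (e, count_list es e))) \<in> borel_measurable M"
    by (rule Cons.prems) simp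
  have [measurable]: "(\<lambda>\<omega>. p e (?r \<omega> (fst (ori e)) - ?r \<omega> (snd (ori e)))) \<in> borel_measurable M"
    by (rule IH[of "\<lambda>x. p e (x (fst (ori e)) - x (snd (ori e)))"])
  have [measurable]: "(\<lambda>\<omega>. \<psi> ((?r \<omega>)(v := ?r \<omega> v + 1))) \<in> borel_measurable M" for v
    by (rule IH[of "\<lambda>x. \<psi> (x(v := x v + 1))"])
  have "(\<lambda>\<omega>. if W \<omega> (Inr (e, count_list es e)) \<le> p e (?r \<omega> (fst (ori e)) - ?r \<omega> (snd (ori e)))
      then \<psi> ((?r \<omega>)(fst (ori e) := ?r \<omega> (fst (ori e)) + 1))
      else \<psi> ((?r \<omega>)(snd (ori e) := ?r \<omega> (snd (ori e)) + 1))) \<in> borel_measurable M"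
    by measurable
  also have "(\<lambda>\<omega>. if W \<omega> (Inr (e, count_list es e)) \<le> p e (?r \<omega> (fst (ori e)) - ?r \<omega> (snd (ori e)))
      then \<psi> ((?r \<omega>)(fst (ori e) := ?r \<omega> (fst (ori e)) + 1))
      else \<psi> ((?r \<omega>)(snd (ori e) := ?r \<omega> (snd (ori e)) + 1)))
    = (\<lambda>\<omega>. \<psi> (run_hist ori p (X \<omega>) (W \<omega>) (e # es)))"
    by (simp add: ring_update_def split_beta Let_def fun_eq_iff)
  finally show ?case .
qed

context local_rule
begin

text \<open>The mean of \<open>\<phi>\<close> over the marks, given the edges in the history. The
  head is the last ring and hence acts first on the observable.\<close>

primrec hist_mean :: "'v set list \<Rightarrow> (('v \<Rightarrow> int) \<Rightarrow> real) \<Rightarrow> ('v \<Rightarrow> int) \<Rightarrow> real" where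
  "hist_mean [] \<phi> = \<phi>"
| "hist_mean (e # es) \<phi> = hist_mean es (edge_mean e \<phi>)"

lemma edge_mean_nonneg: "e \<in> E \<Longrightarrow> (\<And>x. 0 \<le> \<phi> x) \<Longrightarrow> 0 \<le> edge_mean e \<phi> x"
  using edge_mean_mono[of e "\<lambda>_. 0" \<phi> x] by (simp add: edge_mean_const)

text \<open>The mark of the last ring is integrated first: the state before it involves only earlier
  marks, and \<open>b\<close>, which will be the event for the clocks, involves none.\<close>

lemma marks_integral:
  fixes es :: "'v set list" and x :: "'v \<Rightarrow> int"
  assumes J: "finite J" "J \<inter> range Inr = {}" and es: "set es \<subseteq> E" and \<phi>: "\<And>x. 0 \<le> \<phi> x"
    and b_upd: "\<And>w a y. b (w(Inr a := y)) = b w"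
    and b_meas: "\<And>J'. J \<subseteq> J' \<Longrightarrow> b \<in> borel_measurable (PiM J' clock_mark)"
  shows "(\<integral>\<^sup>+w. b w * ennreal (\<phi> (run_hist ori p x w es)) \<partial>PiM (J \<union> Inr ` set (ring_labels es)) clock_mark)
    = (\<integral>\<^sup>+w. b w \<partial>PiM J (clock_mark :: 'a + 'v set \<times> nat \<Rightarrow> real measure)) * ennreal (hist_mean es \<phi> x)"
  using es \<phi>
proof (induction es arbitrary: \<phi>)
  case Nil
  then show ?case using b_meas[OF order_refl] by (simp add: nn_integral_multc)
next
  case (Cons e es)
  define i :: "'a + 'v set \<times> nat" where "i = Inr (e, count_list es e)"
  define R :: "('a + 'v set \<times> nat) set" where "R = J \<union> Inr ` set (ring_labels es)"
  have e: "e \<in> E" and es: "set es \<subseteq> E" using Cons.prems by auto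
  have R1: "finite R" using J by (simp add: R_def)
  have R2: "i \<notin> R" using J(2) by (auto simp: R_def i_def set_ring_labels)
  have un: "J \<union> Inr ` set (ring_labels (e # es)) = insert i R" by (auto simp: R_def i_def)
  let ?f = "\<lambda>w. b w * ennreal (\<phi> (run_hist ori p x w (e # es)))"
  have meas: "?f \<in> borel_measurable (PiM (insert i R) clock_mark)"
  proof -
    have [measurable]: "b \<in> borel_measurable (PiM (insert i R) clock_mark)"
      by (rule b_meas) (auto simp: R_def)
    have [measurable]: "(\<lambda>w. \<phi> (run_hist ori p x w (e # es))) \<in> borel_measurable (PiM (insert i R) clock_mark)"
      by (rule run_hist_measurable) (auto intro!: component_borel simp: R_def i_def)
    show ?thesis by measurable
  qed
  have inner: "(\<integral>\<^sup>+y. ?f (w(i := y)) \<partial>clock_mark i) = b w * ennreal (edge_mean e \<phi> (run_hist ori p x w es))" for w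
  proof -
    let ?z = "run_hist ori p x w es"
    define A where "A = \<phi> (?z(fst (ori e) := ?z (fst (ori e)) + 1))"
    define B where "B = \<phi> (?z(snd (ori e) := ?z (snd (ori e)) + 1))"
    have eq: "?f (w(i := y)) = b w * ennreal (if y \<le> p e (edge_diff e ?z) then A else B)" for y
    proof -
      have "run_hist ori p x (w(i := y)) (e # es) = ring_update ori p e y ?z"
        unfolding i_def run_hist.simps run_hist_upd_Inr[OF order_refl] by simp
      then have "\<phi> (run_hist ori p x (w(i := y)) (e # es)) = (if y \<le> p e (edge_diff e ?z) then A else B)"
        by (simp only:) (simp add: ring_update_def split_beta Let_def edge_diff_def A_def B_def)
      moreover have "b (w(i := y)) = b w" unfolding i_def by (rule b_upd)
      ultimately show ?thesis by (simp only:)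
    qed
    have "(\<integral>\<^sup>+y. ?f (w(i := y)) \<partial>clock_mark i)
       = b w * (\<integral>\<^sup>+y. ennreal (if y \<le> p e (edge_diff e ?z) then A else B) \<partial>unif_mark)"
      unfolding eq unfolding i_def clock_mark_def sum.case by (intro nn_integral_cmult) measurable
    also have "\<dots> = b w * ennreal (edge_mean e \<phi> ?z)"
      using Cons.prems(2)
      by (subst unif_mark_le[OF p_nonneg[OF e] p_le_1[OF e]]) (simp_all add: A_def B_def edge_mean_def)
    finally show ?thesis .
  qed
  have "integral\<^sup>N (PiM (insert i R) clock_mark) ?f
     = (\<integral>\<^sup>+w. b w * ennreal (edge_mean e \<phi> (run_hist ori p x w es)) \<partial>PiM R clock_mark)"
    unfolding clock_mark.product_nn_integral_insert[OF R1 R2 meas] inner ..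
  also have "\<dots> = (\<integral>\<^sup>+w. b w \<partial>PiM J clock_mark) * ennreal (hist_mean es (edge_mean e \<phi>) x)"
    unfolding R_def by (rule Cons.IH[OF es edge_mean_nonneg[OF e Cons.prems(2)]])
  finally show ?case unfolding un by simp
qed

text \<open>The finitely many coordinates that determine \<open>hist_event\<close> and
  \<open>run_hist\<close>: the listed clocks, the next clock of every edge, and the listed
  marks.\<close>

definition hist_indices :: "'v set list \<Rightarrow> ('v set \<times> nat + 'v set \<times> nat) set" where
  "hist_indices es = Inl ` set (ring_labels es) \<union> (\<lambda>e. Inl (e, count_list es e)) ` E \<union> Inr ` set (ring_labels es)"

lemma hist_event_borel:
  assumes "Inl ` set (ring_labels es) \<union> (\<lambda>e. Inl (e, count_list es e)) ` E \<subseteq> J"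
  shows "Measurable.pred (PiM J clock_mark) (hist_event E t es)"
proof -
  have sub: "Inl ` set (ring_labels es) \<subseteq> J" using assms by auto
  note [measurable] = in_order_borel[OF sub] last_ring_borel[OF sub]
  have [measurable]: "Measurable.pred (PiM J clock_mark) (\<lambda>w. \<forall>e\<in>E. t < clock_time w (e, count_list es e))"
  proof (rule pred_intros_finite)
    show "finite E" by (rule finite_E)
    fix e assume "e \<in> E"
    then have [measurable]: "(\<lambda>w. clock_time w (e, count_list es e)) \<in> borel_measurable (PiM J clock_mark)"
      using assms by (intro clock_time_borel) (auto simp: le_less set_ring_labels subset_iff)
    show "Measurable.pred (PiM J clock_mark) (\<lambda>w. t < clock_time w (e, count_list es e))" by measurable
  qed
  show ?thesis unfolding hist_event_def[abs_def] by measurable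
qed

text \<open>Marks and clocks separate. The factor from the clocks depends on \<open>es\<close> only
  through its length, which makes the number of rings Poisson and the edges uniform.\<close>

lemma hist_integral:
  fixes x :: "'v \<Rightarrow> int"
  assumes t: "0 \<le> t" and es: "set es \<subseteq> E" and \<phi>: "\<And>x. 0 \<le> \<phi> x"
  shows "(\<integral>\<^sup>+w. ennreal (of_bool (hist_event E t es w)) * ennreal (\<phi> (run_hist ori p x w es))
      \<partial>PiM (hist_indices es) clock_mark)
    = ennreal (exp (- (real (card E) * t)) * t ^ length es / fact (length es) * hist_mean es \<phi> x)"
proof -
  define J0 :: "('v set \<times> nat + 'v set \<times> nat) set" where "J0 = Inl ` set (ring_labels es)"
  define J where "J = J0 \<union> (\<lambda>e. Inl (e, count_list es e)) ` E"
  let ?b = "\<lambda>w. ennreal (of_bool (in_order w es \<and> last_ring w es \<le> t))"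
  have b_meas: "?b \<in> borel_measurable (PiM J' clock_mark)" if "J0 \<subseteq> J'" for J'
  proof -
    note [measurable] = in_order_borel[of es J'] last_ring_borel[of es J']
    show ?thesis using that unfolding J0_def by measurable
  qed
  have "(\<integral>\<^sup>+w. ennreal (of_bool (hist_event E t es w)) \<partial>PiM J clock_mark)
      = (\<integral>\<^sup>+w. ?b w * ennreal (of_bool (\<forall>e\<in>E. t < clock_time w (e, count_list es e))) \<partial>PiM J clock_mark)"
    by (intro nn_integral_cong) (auto simp: hist_event_def)
  also have "\<dots> = (\<integral>\<^sup>+w. ?b w * ennreal (exp (- (\<Sum>e\<in>E. t - prev_time w es e))) \<partial>PiM J0 clock_mark)"
    unfolding J_def
  proof (rule residual_integral[OF finite_E])
    show "?b w = 0" if "e \<in> E" "t < prev_time w es e" for w e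
      using that prev_time_le_last[of w es e] by auto
    show "?b (w(Inl (e, count_list es e) := y)) = ?b w" for w e y
      by (simp only: in_order_upd_Inl[OF order_refl] last_ring_upd_Inl[OF order_refl])
    show "finite J0" by (simp add: J0_def)
    show "?b \<in> borel_measurable (PiM J' clock_mark)" if "J0 \<subseteq> J'" for J' by (rule b_meas[OF that])
    show "?b \<in> borel_measurable (PiM J0 clock_mark)" by (rule b_meas[OF order_refl])
  qed (auto simp: J0_def set_ring_labels)
  \<comment> \<open>By \<open>sum_prev_time\<close> the survival exponent is
    \<open>- real (card E) * t\<close> plus the sum of the listed waiting times, the weight in
    \<open>ordered_integral\<close> for \<open>k = 0\<close>.\<close>
  also have "\<dots> = (\<integral>\<^sup>+w. ennreal (exp (- (real (card E) * t))) *
      ennreal (of_bool (in_order w es \<and> last_ring w es \<le> t) *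
        exp (\<Sum>a\<in>set (ring_labels es). w (Inl a)) * (t - last_ring w es) ^ 0 / fact 0) \<partial>PiM J0 clock_mark)"
    by (intro nn_integral_cong)
       (simp add: sum_subtractf sum_prev_time[OF finite_E es] ennreal_mult'[symmetric] exp_diff exp_minus field_simps)
  also have "\<dots> = ennreal (exp (- (real (card E) * t))) * ennreal (t ^ (length es + 0) / fact (length es + 0))"
  proof -
    have "(\<lambda>w. ennreal (of_bool (in_order w es \<and> last_ring w es \<le> t) *
        exp (\<Sum>a\<in>set (ring_labels es). w (Inl a)) * (t - last_ring w es) ^ 0 / fact 0))
        \<in> borel_measurable (PiM J0 clock_mark)"
    proof -
      have sub: "Inl ` set (ring_labels es) \<subseteq> J0" by (simp add: J0_def)
      note [measurable] = in_order_borel[OF sub] last_ring_borel[OF sub]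
      have [measurable]: "(\<lambda>w. \<Sum>a\<in>set (ring_labels es). w (Inl a)) \<in> borel_measurable (PiM J0 clock_mark)"
        by (intro borel_measurable_sum component_borel) (auto simp: J0_def)
      show ?thesis by measurable
    qed
    then show ?thesis by (subst nn_integral_cmult) (simp_all only: J0_def ordered_integral[OF t])
  qed
  finally have 1: "(\<integral>\<^sup>+w. ennreal (of_bool (hist_event E t es w)) \<partial>PiM J clock_mark)
    = ennreal (exp (- (real (card E) * t)) * t ^ length es / fact (length es))"
    using t by (simp add: ennreal_mult'[symmetric])
  have "(\<integral>\<^sup>+w. ennreal (of_bool (hist_event E t es w)) * ennreal (\<phi> (run_hist ori p x w es))
      \<partial>PiM (J \<union> Inr ` set (ring_labels es)) clock_mark)
    = (\<integral>\<^sup>+w. ennreal (of_bool (hist_event E t es w)) \<partial>PiM J clock_mark) * ennreal (hist_mean es \<phi> x)"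
  proof (rule marks_integral[OF _ _ es \<phi>])
    show "finite J" using finite_E by (simp add: J_def J0_def)
    show "J \<inter> range Inr = {}" by (auto simp: J_def J0_def)
    show "ennreal (of_bool (hist_event E t es (w(Inr a := y)))) = ennreal (of_bool (hist_event E t es w))" for w a y
      by (simp only: hist_event_def in_order_upd_Inr last_ring_upd_Inr clock_time_upd_Inr)
    show "(\<lambda>w. ennreal (of_bool (hist_event E t es w))) \<in> borel_measurable (PiM J' clock_mark)" if "J \<subseteq> J'" for J'
    proof -
      have [measurable]: "Measurable.pred (PiM J' clock_mark) (hist_event E t es)"
        using that by (intro hist_event_borel) (simp add: J_def J0_def)
      show ?thesis by measurable
    qed
  qed
  moreover have "hist_indices es = J \<union> Inr ` set (ring_labels es)"
    by (simp add: hist_indices_def J_def J0_def)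
  ultimately show ?thesis
    unfolding 1 using t by (simp add: ennreal_mult'[symmetric])
qed

end

section \<open>Dependence on finitely many coordinates, and the sum over histories\<close>

lemma last_ring_cong:
  assumes "\<And>a. a \<in> set (ring_labels es) \<Longrightarrow> w (Inl a) = w' (Inl a)"
  shows "last_ring w es = last_ring w' es"
proof (cases es)
  case (Cons e es')
  then show ?thesis using assms unfolding Cons last_ring.simps clock_time_def
    by (intro sum.cong refl) (auto simp: set_ring_labels le_less)
qed simp

lemma in_order_cong:
  assumes "\<And>a. a \<in> set (ring_labels es) \<Longrightarrow> w (Inl a) = w' (Inl a)"
  shows "in_order w es = in_order w' es"
  using assms
proof (induction es)
  case (Cons e es)
  have "last_ring w (e # es) = last_ring w' (e # es)" "last_ring w es = last_ring w' es"
    by (rule last_ring_cong, use Cons.prems in auto)+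
  then show ?case using Cons by simp
qed simp

lemma run_hist_cong:
  assumes "\<And>a. a \<in> set (ring_labels es) \<Longrightarrow> w (Inr a) = w' (Inr a)"
  shows "run_hist ori p x w es = run_hist ori p x w' es"
  using assms by (induction es) auto

lemma (in local_rule) hist_event_cong:
  assumes "\<And>i. i \<in> hist_indices es \<Longrightarrow> w i = w' i"
  shows "hist_event E t es w = hist_event E t es w'"
proof -
  have lab: "w (Inl a) = w' (Inl a)" if "a \<in> set (ring_labels es)" for a
    using that by (intro assms) (auto simp: hist_indices_def)
  have "clock_time w (e, count_list es e) = clock_time w' (e, count_list es e)" if "e \<in> E" for e
    unfolding clock_time_def
  proof (intro sum.cong refl)
    fix j assume "j \<in> {..snd (e, count_list es e)}"
    then have "j < count_list es e \<or> j = count_list es e" by auto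
    then show "w (Inl (fst (e, count_list es e), j)) = w' (Inl (fst (e, count_list es e), j))"
      using lab[of "(e, j)"] assms[of "Inl (e, count_list es e)"] that
      by (auto simp: set_ring_labels hist_indices_def)
  qed
  moreover have "in_order w es = in_order w' es" using lab by (rule in_order_cong)
  moreover have "last_ring w es = last_ring w' es" using lab by (rule last_ring_cong)
  ultimately show ?thesis by (simp add: hist_event_def)
qed

text \<open>Expanding the \<open>m\<close>-th power of the sum over edges in
  \<open>mean_step\<close> produces one term for each edge sequence of length
  \<open>m\<close>.\<close>

lemma (in local_rule) sum_hist_mean:
  "(\<Sum>es | set es \<subseteq> E \<and> length es = m. hist_mean es \<phi> x) = real (card E) ^ m * (mean_step ^^ m) \<phi> x"
proof (induction m arbitrary: \<phi>)
  case 0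
  have "{es. set es \<subseteq> E \<and> length es = 0} = {[]}" by auto
  then show ?case by simp
next
  case (Suc m)
  let ?L = "\<lambda>m. {es. set es \<subseteq> E \<and> length es = m}"
  have lin: "(\<Sum>e\<in>E. hist_mean es (edge_mean e \<phi>) x) = real (card E) * hist_mean es (mean_step \<phi>) x" for es
  proof -
    have sum: "hist_mean es (\<lambda>x. \<Sum>e\<in>E. f e x) x = (\<Sum>e\<in>E. hist_mean es (f e) x)" for f
    proof (induction es arbitrary: f)
      case (Cons a es)
      have "edge_mean a (\<lambda>x. \<Sum>e\<in>E. f e x) = (\<lambda>x. \<Sum>e\<in>E. edge_mean a (f e) x)"
        by (simp add: edge_mean_def fun_eq_iff sum_distrib_left sum.distrib)
      then show ?case by (simp add: Cons)
    qed simp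
    have cm: "hist_mean es (\<lambda>x. c * f x) x = c * hist_mean es f x" for c f
    proof (induction es arbitrary: f)
      case (Cons a es)
      have "edge_mean a (\<lambda>x. c * f x) = (\<lambda>x. c * edge_mean a f x)" by (simp add: edge_mean_cmult fun_eq_iff)
      then show ?case by (simp add: Cons)
    qed simp
    have "(\<lambda>x. real (card E) * mean_step \<phi> x) = (\<lambda>x. \<Sum>e\<in>E. edge_mean e \<phi> x)"
      using card_pos by (simp add: mean_step_def fun_eq_iff)
    then show ?thesis using cm[of "real (card E)" "mean_step \<phi>"] sum[of "\<lambda>e. edge_mean e \<phi>"] by simp
  qed
  have L: "?L (Suc m) = (\<lambda>(es, e). e # es) ` (?L m \<times> E)"
    by (auto simp: length_Suc_conv image_iff)
  have inj: "inj_on (\<lambda>(es, e). e # es) (?L m \<times> E)" by (auto simp: inj_on_def)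
  have "(\<Sum>es\<in>?L (Suc m). hist_mean es \<phi> x) = (\<Sum>(es, e)\<in>?L m \<times> E. hist_mean es (edge_mean e \<phi>) x)"
    unfolding L sum.reindex[OF inj] by (simp add: split_beta)
  also have "\<dots> = (\<Sum>es\<in>?L m. \<Sum>e\<in>E. hist_mean es (edge_mean e \<phi>) x)"
    by (simp add: sum.cartesian_product)
  also have "\<dots> = real (card E) * (\<Sum>es\<in>?L m. hist_mean es (mean_step \<phi>) x)"
    by (simp add: lin sum_distrib_left)
  finally show ?case by (simp add: Suc funpow_swap1)
qed

lemma (in local_rule) hist_mean_nonneg:
  "set es \<subseteq> E \<Longrightarrow> (\<And>x. 0 \<le> \<phi> x) \<Longrightarrow> 0 \<le> hist_mean es \<phi> x"
  by (induction es arbitrary: \<phi>) (auto intro!: edge_mean_nonneg)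

section \<open>The law of the load process\<close>

locale load_model = clocks_and_marks M V E S U X0 + local_rule E ori p
  for M :: "'w measure" and V :: "'v set" and E :: "'v set set"
    and S :: "'v set \<Rightarrow> nat \<Rightarrow> 'w \<Rightarrow> real" and U :: "'v set \<Rightarrow> nat \<Rightarrow> 'w \<Rightarrow> real"
    and X0 :: "'w \<Rightarrow> 'v \<Rightarrow> int" and ori :: "'v set \<Rightarrow> 'v \<times> 'v" and p :: "'v set \<Rightarrow> int \<Rightarrow> real" +
  assumes finite_V: "finite V"
begin

abbreviation indices :: "('v set \<times> nat + 'v set \<times> nat) set" where
  "indices \<equiv> (E \<times> UNIV) <+> (E \<times> UNIV)"

abbreviation field :: "'v set \<times> nat + 'v set \<times> nat \<Rightarrow> 'w \<Rightarrow> real" where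
  "field \<equiv> case_sum (\<lambda>(e, k). S e k) (\<lambda>(e, k). U e k)"

text \<open>The restriction to \<open>indices\<close> makes this literally the map in
  \<open>indep_initial\<close>.\<close>

definition field_map :: "'w \<Rightarrow> ('v set \<times> nat + 'v set \<times> nat \<Rightarrow> real)" where
  "field_map \<omega> = (\<lambda>j\<in>indices. field j \<omega>)"

lemma field_measurable: "i \<in> indices \<Longrightarrow> field i \<in> borel_measurable M"
  using indep_clocks_marks by (auto simp: indep_vars_def)

lemma field_map_measurable: "field_map \<in> M \<rightarrow>\<^sub>M PiM indices (\<lambda>_. borel)"
  unfolding field_map_def[abs_def] by (intro measurable_restrict field_measurable)

lemma distr_field:
  assumes "i \<in> indices"
  shows "distr M borel (field i) = clock_mark i"
proof -
  have cong: "distr M borel X = distr M lborel X" for X :: "'w \<Rightarrow> real"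
    by (rule distr_cong) simp_all
  show ?thesis
    using assms distributed_distr_eq_density[OF waiting_times] distributed_distr_eq_density[OF marks]
    by (auto simp: cong clock_mark_def exp_clock_def unif_mark_def)
qed

lemma indices_hist: "set es \<subseteq> E \<Longrightarrow> hist_indices es \<subseteq> indices"
  by (auto simp: hist_indices_def set_ring_labels) (metis count_list_0_iff less_nat_zero_code subsetD)+

text \<open>A finite subfamily of the independent clocks and marks has the product law, and
  \<open>h\<close> reads only the coordinates in \<open>J\<close>.\<close>

lemma nn_integral_field_map:
  assumes J: "finite J" "J \<noteq> {}" "J \<subseteq> indices" and h: "h \<in> borel_measurable (PiM J clock_mark)"
    and dep: "\<And>w w'. (\<And>i. i \<in> J \<Longrightarrow> w i = w' i) \<Longrightarrow> h w = h w'"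
  shows "(\<integral>\<^sup>+\<omega>. h (field_map \<omega>) \<partial>M) = (\<integral>\<^sup>+w. h w \<partial>PiM J clock_mark)"
proof -
  have "indep_vars (\<lambda>_. borel) field J"
    by (rule indep_vars_subset[OF indep_clocks_marks J(3)])
  then have "distr M (PiM J (\<lambda>_. borel)) (\<lambda>\<omega>. \<lambda>i\<in>J. field i \<omega>) = PiM J (\<lambda>i. distr M borel (field i))"
    using J field_measurable by (subst (asm) indep_vars_iff_distr_eq_PiM') auto
  also have "\<dots> = PiM J clock_mark"
    using J(3) by (intro PiM_cong refl distr_field) auto
  finally have D: "PiM J clock_mark = distr M (PiM J (\<lambda>_. borel)) (\<lambda>\<omega>. \<lambda>i\<in>J. field i \<omega>)" ..
  have "(\<integral>\<^sup>+w. h w \<partial>PiM J clock_mark) = (\<integral>\<^sup>+\<omega>. h (\<lambda>i\<in>J. field i \<omega>) \<partial>M)"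
    unfolding D
  proof (rule nn_integral_distr)
    show "(\<lambda>\<omega>. \<lambda>i\<in>J. field i \<omega>) \<in> M \<rightarrow>\<^sub>M PiM J (\<lambda>_. borel)"
      using J(3) by (intro measurable_restrict field_measurable) auto
    show "h \<in> borel_measurable (distr M (PiM J (\<lambda>_. borel)) (\<lambda>\<omega>. \<lambda>i\<in>J. field i \<omega>))"
      unfolding D[symmetric] by (rule h)
  qed
  also have "\<dots> = (\<integral>\<^sup>+\<omega>. h (field_map \<omega>) \<partial>M)"
    by (intro nn_integral_cong dep) (use J(3) in \<open>auto simp: field_map_def\<close>)
  finally show ?thesis ..
qed

definition hist_term :: "real \<Rightarrow> (('v \<Rightarrow> int) \<Rightarrow> real) \<Rightarrow> 'v set list \<Rightarrow> ('v \<Rightarrow> int) \<Rightarrow>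
    ('v set \<times> nat + 'v set \<times> nat \<Rightarrow> real) \<Rightarrow> ennreal" where
  "hist_term t \<phi> es x w = ennreal (of_bool (hist_event E t es w)) * ennreal (\<phi> (run_hist ori p x w es))"

lemma sets_PiM_clock_mark: "sets (PiM J clock_mark) = sets (PiM J (\<lambda>_. borel))"
  by (intro sets_PiM_cong) simp_all

lemma hist_event_indices:
  assumes "set es \<subseteq> E"
  shows "Measurable.pred (PiM indices (\<lambda>_. borel)) (hist_event E t es)"
proof -
  have "Measurable.pred (PiM indices clock_mark) (hist_event E t es)"
    using indices_hist[OF assms] by (intro hist_event_borel) (auto simp: hist_indices_def)
  then show ?thesis by (simp only: measurable_cong_sets[OF sets_PiM_clock_mark refl])
qed

lemma nn_integral_hist_term:
  assumes t: "0 \<le> t" and es: "set es \<subseteq> E" and \<phi>: "\<And>x. 0 \<le> \<phi> x"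
  shows "(\<integral>\<^sup>+\<omega>. hist_term t \<phi> es x (field_map \<omega>) \<partial>M)
    = ennreal (exp (- (real (card E) * t)) * t ^ length es / fact (length es) * hist_mean es \<phi> x)"
proof -
  have "(\<integral>\<^sup>+\<omega>. hist_term t \<phi> es x (field_map \<omega>) \<partial>M)
      = (\<integral>\<^sup>+w. hist_term t \<phi> es x w \<partial>PiM (hist_indices es) clock_mark)"
  proof (rule nn_integral_field_map)
    show "finite (hist_indices es)" "hist_indices es \<noteq> {}"
      using finite_E E_ne by (auto simp: hist_indices_def)
    show "hist_indices es \<subseteq> indices" by (rule indices_hist[OF es])
    have [measurable]: "Measurable.pred (PiM (hist_indices es) clock_mark) (hist_event E t es)"
      by (rule hist_event_borel) (auto simp: hist_indices_def)
    have [measurable]: "(\<lambda>w. \<phi> (run_hist ori p x w es)) \<in> borel_measurable (PiM (hist_indices es) clock_mark)"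
      by (rule run_hist_measurable) (auto intro!: component_borel simp: hist_indices_def)
    show "hist_term t \<phi> es x \<in> borel_measurable (PiM (hist_indices es) clock_mark)"
      unfolding hist_term_def[abs_def] by measurable
    show "hist_term t \<phi> es x w = hist_term t \<phi> es x w'" if "\<And>i. i \<in> hist_indices es \<Longrightarrow> w i = w' i" for w w'
    proof -
      have "run_hist ori p x w es = run_hist ori p x w' es"
        by (rule run_hist_cong) (auto intro!: that simp: hist_indices_def)
      then show ?thesis using hist_event_cong[OF that] by (simp add: hist_term_def)
    qed
  qed
  also have "\<dots> = ennreal (exp (- (real (card E) * t)) * t ^ length es / fact (length es) * hist_mean es \<phi> x)"
    unfolding hist_term_def by (rule hist_integral[OF t es \<phi>])
  finally show ?thesis .
qed

text \<open>For finite \<open>V\<close> the initial state lives in a discrete space, so every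
  observable of it is measurable.\<close>

lemma initial_count_space: "PiM V (\<lambda>_. count_space UNIV) = (count_space (PiE V (\<lambda>_. UNIV)) :: ('v \<Rightarrow> int) measure)"
  by (rule count_space_PiM_finite[OF finite_V]) simp

lemma hist_term_measurable:
  assumes es: "set es \<subseteq> E"
  shows "(\<lambda>(x, w). hist_term t \<phi> es x w)
    \<in> borel_measurable (PiM V (\<lambda>_. count_space UNIV) \<Otimes>\<^sub>M PiM indices (\<lambda>_. borel))"
proof -
  let ?N = "PiM V (\<lambda>_. count_space UNIV :: int measure) \<Otimes>\<^sub>M PiM indices (\<lambda>_. borel :: real measure)"
  note [measurable] = hist_event_indices[OF es]
  have [measurable]: "(\<lambda>z. \<phi> (run_hist ori p (fst z) (snd z) es)) \<in> borel_measurable ?N"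
  proof (rule run_hist_measurable)
    show "(\<lambda>z. \<psi> (fst z)) \<in> borel_measurable ?N" for \<psi> :: "('v \<Rightarrow> int) \<Rightarrow> real"
    proof (rule measurable_compose[OF measurable_fst])
      show "\<psi> \<in> borel_measurable (PiM V (\<lambda>_. count_space UNIV))" unfolding initial_count_space by simp
    qed
    show "(\<lambda>z. snd z (Inr a)) \<in> borel_measurable ?N" if "a \<in> set (ring_labels es)" for a
      by (rule measurable_compose[OF measurable_snd], rule measurable_component_singleton)
         (use that indices_hist[OF es] in \<open>auto simp: hist_indices_def\<close>)
  qed
  show ?thesis unfolding hist_term_def split_beta by measurable
qed

lemma joint_law:
  "distr M (PiM V (\<lambda>_. count_space UNIV)) X0 \<Otimes>\<^sub>M distr M (PiM indices (\<lambda>_. borel)) field_map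
    = distr M (PiM V (\<lambda>_. count_space UNIV) \<Otimes>\<^sub>M PiM indices (\<lambda>_. borel)) (\<lambda>\<omega>. (X0 \<omega>, field_map \<omega>))"
proof -
  let ?N1 = "PiM V (\<lambda>_. count_space UNIV :: int measure)"
  let ?N2 = "PiM indices (\<lambda>_. borel :: real measure)"
  note [measurable] = field_map_measurable initial
  interpret D1: prob_space "distr M ?N1 X0" by (rule prob_space_distr[OF initial])
  interpret D2: prob_space "distr M ?N2 field_map" by (rule prob_space_distr[OF field_map_measurable])
  show ?thesis
  proof (rule pair_measure_eqI)
    fix A B assume "A \<in> sets (distr M ?N1 X0)" "B \<in> sets (distr M ?N2 field_map)"
    then have AB [measurable]: "A \<in> sets ?N1" "B \<in> sets ?N2" by simp_all
    have "X0 -` A \<inter> space M \<in> sets (vimage_algebra (space M) X0 ?N1)"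
      "field_map -` B \<inter> space M \<in> sets (vimage_algebra (space M) field_map ?N2)"
      using AB by (auto intro!: in_vimage_algebra)
    then have "prob ((X0 -` A \<inter> space M) \<inter> (field_map -` B \<inter> space M))
        = prob (X0 -` A \<inter> space M) * prob (field_map -` B \<inter> space M)"
      by (intro indep_setD[OF indep_initial]) (simp_all add: field_map_def[abs_def])
    moreover have "(\<lambda>\<omega>. (X0 \<omega>, field_map \<omega>)) -` (A \<times> B) \<inter> space M
        = (X0 -` A \<inter> space M) \<inter> (field_map -` B \<inter> space M)" by auto
    ultimately show "emeasure (distr M ?N1 X0) A * emeasure (distr M ?N2 field_map) B
        = emeasure (distr M (?N1 \<Otimes>\<^sub>M ?N2) (\<lambda>\<omega>. (X0 \<omega>, field_map \<omega>))) (A \<times> B)"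
      by (simp add: emeasure_distr emeasure_eq_measure ennreal_mult')
  qed (auto intro: D1.sigma_finite_measure_axioms D2.sigma_finite_measure_axioms)
qed

text \<open>Almost surely at most one history occurs, and then the sum \<open>\<Phi>\<close> over
  all histories is \<open>\<phi>\<close> of the load; elsewhere it is 0, which
  \<open>\<phi> \<ge> 0\<close> dominates, hence an inequality. For a fixed initial state the mean
  of \<open>\<Phi>\<close> is explicit, and since \<open>B\<close> is uniform in that state it
  survives averaging over the independent \<open>X0\<close>.\<close>

lemma nn_integral_load_process_ge:
  assumes t: "0 \<le> t" and \<phi>: "\<And>x. 0 \<le> \<phi> x"
    and B: "\<And>x. B \<le> (\<Sum>m. ennreal (exp (- (real (card E) * t)) * (real (card E) * t) ^ m / fact m * (mean_step ^^ m) \<phi> x))"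
  shows "B \<le> (\<integral>\<^sup>+\<omega>. ennreal (\<phi> (load_process E ori p S U X0 t \<omega>)) \<partial>M)"
proof -
  let ?L = "\<lambda>m. {es. set es \<subseteq> E \<and> length es = m}"
  let ?N1 = "PiM V (\<lambda>_. count_space UNIV :: int measure)"
  let ?N2 = "PiM indices (\<lambda>_. borel :: real measure)"
  define \<Phi> where "\<Phi> x w = (\<Sum>m. \<Sum>es\<in>?L m. hist_term t \<phi> es x w)" for x w
  have finL: "finite (?L m)" for m using finite_lists_length_eq[OF finite_E] by simp
  note [measurable] = field_map_measurable initial
  have \<Phi>_meas [measurable]: "(\<lambda>(x, w). \<Phi> x w) \<in> borel_measurable (?N1 \<Otimes>\<^sub>M ?N2)"
    unfolding \<Phi>_def split_beta
    by (intro borel_measurable_suminf_order borel_measurable_sum hist_term_measurable[unfolded split_beta]) auto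
  have term_meas: "(\<lambda>\<omega>. hist_term t \<phi> es x (field_map \<omega>)) \<in> borel_measurable M"
    if "set es \<subseteq> E" "x \<in> space ?N1" for es x
    using measurable_compose[OF measurable_Pair[OF measurable_const[OF that(2)] field_map_measurable]
        hist_term_measurable[OF that(1), of t \<phi>]] by simp
  have fixed: "B \<le> (\<integral>\<^sup>+\<omega>. \<Phi> x (field_map \<omega>) \<partial>M)" if x: "x \<in> space ?N1" for x
  proof -
    have "(\<integral>\<^sup>+\<omega>. \<Phi> x (field_map \<omega>) \<partial>M) = (\<Sum>m. \<integral>\<^sup>+\<omega>. (\<Sum>es\<in>?L m. hist_term t \<phi> es x (field_map \<omega>)) \<partial>M)"
      unfolding \<Phi>_def by (intro nn_integral_suminf borel_measurable_sum term_meas x) auto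
    also have "\<dots> = (\<Sum>m. \<Sum>es\<in>?L m. \<integral>\<^sup>+\<omega>. hist_term t \<phi> es x (field_map \<omega>) \<partial>M)"
      by (intro arg_cong[where f = suminf] ext nn_integral_sum term_meas x) auto
    also have "\<dots> = (\<Sum>m. \<Sum>es\<in>?L m. ennreal (exp (- (real (card E) * t)) * t ^ m / fact m * hist_mean es \<phi> x))"
      by (intro arg_cong[where f = suminf] ext sum.cong refl) (auto simp: nn_integral_hist_term[OF t _ \<phi>])
    also have "\<dots> = (\<Sum>m. ennreal (exp (- (real (card E) * t)) * (real (card E) * t) ^ m / fact m * (mean_step ^^ m) \<phi> x))"
    proof (intro arg_cong[where f = suminf] ext)
      fix m
      have "(\<Sum>es\<in>?L m. ennreal (exp (- (real (card E) * t)) * t ^ m / fact m * hist_mean es \<phi> x))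
        = ennreal (\<Sum>es\<in>?L m. exp (- (real (card E) * t)) * t ^ m / fact m * hist_mean es \<phi> x)"
        using t \<phi> by (intro sum_ennreal) (auto intro!: mult_nonneg_nonneg divide_nonneg_nonneg hist_mean_nonneg)
      also have "\<dots> = ennreal (exp (- (real (card E) * t)) * (real (card E) * t) ^ m / fact m * (mean_step ^^ m) \<phi> x)"
        unfolding sum_distrib_left[symmetric] sum_hist_mean by (simp add: power_mult_distrib mult_ac)
      finally show "(\<Sum>es\<in>?L m. ennreal (exp (- (real (card E) * t)) * t ^ m / fact m * hist_mean es \<phi> x))
        = ennreal (exp (- (real (card E) * t)) * (real (card E) * t) ^ m / fact m * (mean_step ^^ m) \<phi> x)" .
    qed
    finally show ?thesis using B by simp
  qed
  let ?D1 = "distr M ?N1 X0" and ?D2 = "distr M ?N2 field_map"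
  interpret D1: prob_space ?D1 by (rule prob_space_distr[OF initial])
  interpret D2: prob_space ?D2 by (rule prob_space_distr[OF field_map_measurable])
  have "B = (\<integral>\<^sup>+x. B \<partial>?D1)" using D1.emeasure_space_1 by simp
  also have "\<dots> \<le> (\<integral>\<^sup>+x. (\<integral>\<^sup>+w. \<Phi> x w \<partial>?D2) \<partial>?D1)"
  proof (rule nn_integral_mono)
    fix x assume "x \<in> space ?D1"
    then have x: "x \<in> space ?N1" by simp
    have "(\<lambda>w. \<Phi> x w) \<in> borel_measurable ?N2"
      using measurable_compose[OF measurable_Pair1'[OF x] \<Phi>_meas] by simp
    then have "(\<integral>\<^sup>+w. \<Phi> x w \<partial>?D2) = (\<integral>\<^sup>+\<omega>. \<Phi> x (field_map \<omega>) \<partial>M)"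
      by (intro nn_integral_distr field_map_measurable) simp
    then show "B \<le> (\<integral>\<^sup>+w. \<Phi> x w \<partial>?D2)" using fixed[OF x] by simp
  qed
  also have "\<dots> = (\<integral>\<^sup>+z. (\<lambda>(x, w). \<Phi> x w) z \<partial>(?D1 \<Otimes>\<^sub>M ?D2))"
    by (subst D2.nn_integral_fst[symmetric]) simp_all
  also have "?D1 \<Otimes>\<^sub>M ?D2 = distr M (?N1 \<Otimes>\<^sub>M ?N2) (\<lambda>\<omega>. (X0 \<omega>, field_map \<omega>))"
    by (rule joint_law)
  also have "(\<integral>\<^sup>+z. (\<lambda>(x, w). \<Phi> x w) z \<partial>distr M (?N1 \<Otimes>\<^sub>M ?N2) (\<lambda>\<omega>. (X0 \<omega>, field_map \<omega>)))
      = (\<integral>\<^sup>+\<omega>. \<Phi> (X0 \<omega>) (field_map \<omega>) \<partial>M)"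
    by (subst nn_integral_distr) simp_all
  also have "\<dots> \<le> (\<integral>\<^sup>+\<omega>. ennreal (\<phi> (load_process E ori p S U X0 t \<omega>)) \<partial>M)"
  proof (rule nn_integral_mono_AE)
    have S_meas [measurable]: "S e k \<in> borel_measurable M" if "e \<in> E" for e k
      using field_measurable[OF InlI[of "(e, k)"]] that by simp
    have "AE \<omega> in M. 0 \<le> S e k \<omega>" if "e \<in> E" for e k
    proof -
      have "prob {\<omega> \<in> space M. 0 < S e k \<omega>} = 1"
        using exponential_distributedD_gt[OF waiting_times[OF that, of k], of 0] by simp
      then have "AE \<omega> in M. 0 < S e k \<omega>" by (subst (asm) prob_Collect_eq_1) (use that in \<open>auto intro: S_meas\<close>)
      then show ?thesis by eventually_elim simp
    qed
    then have "AE \<omega> in M. \<forall>e\<in>E. \<forall>k. 0 \<le> S e k \<omega>"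
      using finite_E by (simp add: AE_finite_all AE_all_countable)
    then show "AE \<omega> in M. \<Phi> (X0 \<omega>) (field_map \<omega>) \<le> ennreal (\<phi> (load_process E ori p S U X0 t \<omega>))"
    proof eventually_elim
      case (elim \<omega>)
      have rings: "rings_upto E S t \<omega> = ring_labels es" if "set es \<subseteq> E" "hist_event E t es (field_map \<omega>)" for es
        using that elim by (intro rings_upto_hist[of E t es "field_map \<omega>"]) (auto simp: field_map_def)
      show ?case
      proof (cases "\<exists>es. set es \<subseteq> E \<and> hist_event E t es (field_map \<omega>)")
        case True
        then obtain es where es: "set es \<subseteq> E" "hist_event E t es (field_map \<omega>)" by blast
        \<comment> \<open>Both histories have \<open>rings_upto E S t \<omega>\<close> as their
          labels, and the labels determine the history.\<close>
        have uniq: "es' = es" if "set es' \<subseteq> E" "hist_event E t es' (field_map \<omega>)" for es'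
          using rings[OF that] rings[OF es] ring_labels_inj by metis
        have "(\<Sum>es'\<in>?L m. hist_term t \<phi> es' (X0 \<omega>) (field_map \<omega>))
          = (if m = length es then hist_term t \<phi> es (X0 \<omega>) (field_map \<omega>) else 0)" for m
        proof -
          have "(\<Sum>es'\<in>?L m. hist_term t \<phi> es' (X0 \<omega>) (field_map \<omega>))
             = (\<Sum>es'\<in>?L m. if es' = es then hist_term t \<phi> es (X0 \<omega>) (field_map \<omega>) else 0)"
            using uniq by (intro sum.cong refl) (auto simp: hist_term_def)
          then show ?thesis using finL[of m] es(1) by (auto simp: sum.delta)
        qed
        then have "\<Phi> (X0 \<omega>) (field_map \<omega>) = hist_term t \<phi> es (X0 \<omega>) (field_map \<omega>)"
          unfolding \<Phi>_def using suminf_finite[of "{length es}" "\<lambda>m. if m = length es then hist_term t \<phi> es (X0 \<omega>) (field_map \<omega>) else 0"]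
          by simp
        also have "\<dots> = ennreal (\<phi> (run_hist ori p (X0 \<omega>) (field_map \<omega>) es))"
          using es by (simp add: hist_term_def)
        also have "run_hist ori p (X0 \<omega>) (field_map \<omega>) es = load_process E ori p S U X0 t \<omega>"
        proof -
          have "fst a \<in> E" if "a \<in> set (ring_labels es)" for a
            using that es by (auto simp: set_ring_labels) (metis count_list_0_iff less_nat_zero_code subsetD)
          then show ?thesis
            unfolding load_process_def rings[OF es] run_hist_fold
            by (intro fold_cong refl) (auto simp: field_map_def fun_eq_iff)
        qed
        finally show ?thesis by simp
      next
        case False
        then have "(\<Sum>es\<in>?L m. hist_term t \<phi> es (X0 \<omega>) (field_map \<omega>)) = 0" for m
          by (intro sum.neutral) (auto simp: hist_term_def)
        then show ?thesis by (simp add: \<Phi>_def)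
      qed
    qed
  qed
  finally show ?thesis .
qed

section \<open>Measurability of the load process\<close>

lemma rings_upto_measurable: "rings_upto E S t \<in> M \<rightarrow>\<^sub>M count_space (lists (E \<times> UNIV))"
proof -
  define chron where "chron l \<omega> \<longleftrightarrow> sorted_wrt (\<lambda>a b. ring_time S \<omega> a < ring_time S \<omega> b) l \<and>
      set l = {a \<in> E \<times> UNIV. ring_time S \<omega> a \<le> t}" for l \<omega>
  have cE: "countable (E \<times> (UNIV :: nat set))" by (rule countable_SIGMA[OF countable_finite[OF finite_E] countableI_type])
  then have cl: "countable (lists (E \<times> (UNIV :: nat set)))" by (rule countable_lists)
  have S_meas: "S e k \<in> borel_measurable M" if "e \<in> E" for e k
    using field_measurable[OF InlI[of "(e, k)"]] that by simp
  have time: "(\<lambda>\<omega>. ring_time S \<omega> a) \<in> borel_measurable M" if "a \<in> E \<times> UNIV" for a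
    using that unfolding ring_time_def split_beta by (intro borel_measurable_sum S_meas) auto
  have chron_meas: "Measurable.pred M (chron l)" if l: "l \<in> lists (E \<times> UNIV)" for l
  proof -
    have nth: "l ! i \<in> E \<times> UNIV" if "i < length l" for i using l that by (auto simp: lists_eq_set)
    have eq: "chron l = (\<lambda>\<omega>. (\<forall>j\<in>{..<length l}. \<forall>i\<in>{..<j}. ring_time S \<omega> (l ! i) < ring_time S \<omega> (l ! j)) \<and>
        (\<forall>a\<in>E \<times> UNIV. a \<in> set l \<longleftrightarrow> ring_time S \<omega> a \<le> t))"
      using l by (auto simp: chron_def fun_eq_iff sorted_wrt_iff_nth_less)
    have 1: "Measurable.pred M (\<lambda>\<omega>. \<forall>j\<in>{..<length l}. \<forall>i\<in>{..<j}. ring_time S \<omega> (l ! i) < ring_time S \<omega> (l ! j))"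
    proof (intro pred_intros_finite(3)[OF finite_lessThan])
      fix j i assume "j \<in> {..<length l}" "i \<in> {..<j}"
      then have [measurable]: "(\<lambda>\<omega>. ring_time S \<omega> (l ! i)) \<in> borel_measurable M"
        "(\<lambda>\<omega>. ring_time S \<omega> (l ! j)) \<in> borel_measurable M"
        by (auto intro!: time nth)
      show "Measurable.pred M (\<lambda>\<omega>. ring_time S \<omega> (l ! i) < ring_time S \<omega> (l ! j))" by measurable
    qed
    have 2: "Measurable.pred M (\<lambda>\<omega>. \<forall>a\<in>E \<times> UNIV. a \<in> set l \<longleftrightarrow> ring_time S \<omega> a \<le> t)"
    proof (rule pred_countable_Ball)
      show "countable (E \<times> (UNIV :: nat set))" by (rule cE)
      fix a assume "a \<in> E \<times> (UNIV :: nat set)"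
      then have [measurable]: "(\<lambda>\<omega>. ring_time S \<omega> a) \<in> borel_measurable M" by (rule time)
      show "Measurable.pred M (\<lambda>\<omega>. a \<in> set l \<longleftrightarrow> ring_time S \<omega> a \<le> t)" by measurable
    qed
    show ?thesis unfolding eq using 1 2 by measurable
  qed
  have rings: "rings_upto E S t \<omega> = (if \<exists>l. chron l \<omega> then THE l. chron l \<omega> else [])" for \<omega>
    by (simp only: rings_upto_def chron_def Let_def)
  have chron_rings: "rings_upto E S t \<omega> = l" if "chron l \<omega>" for l \<omega>
    using that by (intro rings_upto_eqI) (auto simp: chron_def)
  have chron_lists: "l \<in> lists (E \<times> UNIV)" if "chron l \<omega>" for l \<omega>
    using that by (auto simp: chron_def lists_eq_set)
  \<comment> \<open>This describes the preimages without a definite choice. The list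
    \<open>[]\<close> is both a genuine value and the dummy one; the quantifier over lists is
    countable.\<close>
  have val: "rings_upto E S t \<omega> = l \<longleftrightarrow> chron l \<omega> \<or> (l = [] \<and> (\<forall>l'\<in>lists (E \<times> UNIV). \<not> chron l' \<omega>))" for l \<omega>
  proof (cases "\<exists>l'. chron l' \<omega>")
    case True
    then obtain l' where l': "chron l' \<omega>" by blast
    show ?thesis using chron_rings[OF l'] chron_rings[of l \<omega>] chron_lists[OF l'] l' by metis
  next
    case False
    then show ?thesis by (auto simp: rings)
  qed
  show ?thesis
  proof (subst measurable_count_space_eq_countable[OF cl], intro conjI ballI)
    show "rings_upto E S t \<in> space M \<rightarrow> lists (E \<times> UNIV)"
    proof
      fix \<omega>
      show "rings_upto E S t \<omega> \<in> lists (E \<times> UNIV)"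
        using val[of \<omega> "rings_upto E S t \<omega>"] chron_lists by fastforce
    qed
    fix l assume l: "l \<in> lists (E \<times> (UNIV :: nat set))"
    note [measurable] = chron_meas[OF l]
    have [measurable]: "Measurable.pred M (\<lambda>\<omega>. \<forall>l'\<in>lists (E \<times> UNIV). \<not> chron l' \<omega>)"
    proof (rule pred_countable_Ball)
      show "countable (lists (E \<times> (UNIV :: nat set)))" by (rule cl)
      fix l' assume "l' \<in> lists (E \<times> (UNIV :: nat set))"
      note [measurable] = chron_meas[OF this]
      show "Measurable.pred M (\<lambda>\<omega>. \<not> chron l' \<omega>)" by measurable
    qed
    have "{\<omega> \<in> space M. chron l \<omega> \<or> (l = [] \<and> (\<forall>l'\<in>lists (E \<times> UNIV). \<not> chron l' \<omega>))} \<in> sets M"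
      by measurable
    also have "{\<omega> \<in> space M. chron l \<omega> \<or> (l = [] \<and> (\<forall>l'\<in>lists (E \<times> UNIV). \<not> chron l' \<omega>))}
        = rings_upto E S t -` {l} \<inter> space M"
      using val[of _ l] by auto
    finally show "rings_upto E S t -` {l} \<inter> space M \<in> sets M" .
  qed
qed

lemma fold_ring_update_measurable:
  fixes \<psi> :: "('v \<Rightarrow> int) \<Rightarrow> real"
  assumes "l \<in> lists (E \<times> UNIV)"
  shows "(\<lambda>\<omega>. \<psi> (fold (\<lambda>(e, k). ring_update ori p e (U e k \<omega>)) l (X0 \<omega>))) \<in> borel_measurable M"
  using assms
proof (induction l arbitrary: \<psi> rule: rev_induct)
  case Nil
  have "\<psi> \<in> borel_measurable (PiM V (\<lambda>_. count_space UNIV))" unfolding initial_count_space by simp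
  then show ?case using measurable_compose[OF initial] by simp
next
  case (snoc a l)
  obtain e k where a: "a = (e, k)" by fastforce
  then have e: "e \<in> E" and l: "l \<in> lists (E \<times> UNIV)" using snoc.prems by auto
  let ?r = "\<lambda>\<omega>. fold (\<lambda>(e, k). ring_update ori p e (U e k \<omega>)) l (X0 \<omega>)"
  note IH = snoc.IH[OF l]
  have [measurable]: "U e k \<in> borel_measurable M"
    using field_measurable[OF InrI[of "(e, k)"]] e by simp
  have [measurable]: "(\<lambda>\<omega>. p e (?r \<omega> (fst (ori e)) - ?r \<omega> (snd (ori e)))) \<in> borel_measurable M"
    by (rule IH[of "\<lambda>x. p e (x (fst (ori e)) - x (snd (ori e)))"])
  have [measurable]: "(\<lambda>\<omega>. \<psi> ((?r \<omega>)(v := ?r \<omega> v + 1))) \<in> borel_measurable M" for v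
    by (rule IH[of "\<lambda>x. \<psi> (x(v := x v + 1))"])
  have "(\<lambda>\<omega>. if U e k \<omega> \<le> p e (?r \<omega> (fst (ori e)) - ?r \<omega> (snd (ori e)))
      then \<psi> ((?r \<omega>)(fst (ori e) := ?r \<omega> (fst (ori e)) + 1))
      else \<psi> ((?r \<omega>)(snd (ori e) := ?r \<omega> (snd (ori e)) + 1))) \<in> borel_measurable M"
    by measurable
  also have "(\<lambda>\<omega>. if U e k \<omega> \<le> p e (?r \<omega> (fst (ori e)) - ?r \<omega> (snd (ori e)))
      then \<psi> ((?r \<omega>)(fst (ori e) := ?r \<omega> (fst (ori e)) + 1))
      else \<psi> ((?r \<omega>)(snd (ori e) := ?r \<omega> (snd (ori e)) + 1)))
    = (\<lambda>\<omega>. \<psi> (fold (\<lambda>(e, k). ring_update ori p e (U e k \<omega>)) (l @ [a]) (X0 \<omega>)))"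
    by (simp add: a ring_update_def split_beta Let_def fun_eq_iff)
  finally show ?case .
qed

lemma load_process_measurable:
  fixes \<psi> :: "('v \<Rightarrow> int) \<Rightarrow> real"
  shows "(\<lambda>\<omega>. \<psi> (load_process E ori p S U X0 t \<omega>)) \<in> borel_measurable M"
  unfolding load_process_def
proof (rule measurable_compose_countable'[OF fold_ring_update_measurable rings_upto_measurable])
  show "countable (lists (E \<times> (UNIV :: nat set)))"
    by (rule countable_lists[OF countable_SIGMA[OF countable_finite[OF finite_E] countableI_type]])
qed

lemma prob_load_process_ge:
  assumes "ennreal q \<le> (\<integral>\<^sup>+\<omega>. ennreal (of_bool (Q (load_process E ori p S U X0 t \<omega>))) \<partial>M)"
  shows "q \<le> prob {\<omega> \<in> space M. Q (load_process E ori p S U X0 t \<omega>)}"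
proof -
  have [measurable]: "(\<lambda>\<omega>. of_bool (Q (load_process E ori p S U X0 t \<omega>)) :: real) \<in> borel_measurable M"
    by (rule load_process_measurable[of "\<lambda>x. of_bool (Q x)"])
  have "{\<omega> \<in> space M. (of_bool (Q (load_process E ori p S U X0 t \<omega>)) :: real) = 1} \<in> sets M" by measurable
  then have m: "{\<omega> \<in> space M. Q (load_process E ori p S U X0 t \<omega>)} \<in> sets M" by simp
  have "(\<integral>\<^sup>+\<omega>. ennreal (of_bool (Q (load_process E ori p S U X0 t \<omega>))) \<partial>M)
      = (\<integral>\<^sup>+\<omega>. indicator {\<omega> \<in> space M. Q (load_process E ori p S U X0 t \<omega>)} \<omega> \<partial>M)"
    by (intro nn_integral_cong) (auto simp: indicator_def)
  also have "\<dots> = ennreal (prob {\<omega> \<in> space M. Q (load_process E ori p S U X0 t \<omega>)})"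
    using m by (simp add: emeasure_eq_measure)
  finally show ?thesis using assms by (simp add: ennreal_le_iff)
qed

end

section \<open>Poisson weights\<close>

definition pois :: "real \<Rightarrow> nat \<Rightarrow> real" where
  "pois \<theta> m = exp (- \<theta>) * \<theta> ^ m / fact m"

lemma pois_nonneg: "0 \<le> \<theta> \<Longrightarrow> 0 \<le> pois \<theta> m"
  by (simp add: pois_def)

lemma pois_Suc: "pois \<theta> (Suc m) = pois \<theta> m * \<theta> / real (Suc m)"
  by (simp add: pois_def field_simps)

lemma pois_sums: "pois \<theta> sums 1"
proof -
  have "(\<lambda>m. exp (- \<theta>) * (\<theta> ^ m /\<^sub>R fact m)) sums (exp (- \<theta>) * exp \<theta>)"
    by (intro sums_mult exp_converges)
  then show ?thesis by (simp add: pois_def[abs_def] exp_minus divide_inverse mult_ac)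
qed

text \<open>A Chernoff bound: \<open>2 ^ m \<le> 2 ^ k\<close> for \<open>m < k\<close>, the weights
  with parameter \<open>\<theta> / 2\<close> sum to at most \<open>exp (\<theta> / 2)\<close>, and
  \<open>2 \<le> exp 1\<close>.\<close>

lemma pois_lower_tail:
  assumes "0 \<le> \<theta>"
  shows "(\<Sum>m<k. pois \<theta> m) \<le> exp (real k - \<theta> / 2)"
proof -
  have "(\<Sum>m<k. pois \<theta> m) \<le> (\<Sum>m<k. 2 ^ k * exp (- \<theta>) * ((\<theta> / 2) ^ m /\<^sub>R fact m))"
  proof (rule sum_mono)
    fix m assume "m \<in> {..<k}"
    then have "(2::real) ^ m \<le> 2 ^ k" by (intro power_increasing) auto
    then have "2 ^ m * (exp (- \<theta>) * ((\<theta> / 2) ^ m / fact m)) \<le> 2 ^ k * (exp (- \<theta>) * ((\<theta> / 2) ^ m / fact m))"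
      using assms by (intro mult_right_mono) auto
    moreover have "pois \<theta> m = 2 ^ m * (exp (- \<theta>) * ((\<theta> / 2) ^ m / fact m))"
      by (simp add: pois_def power_divide)
    moreover have "2 ^ k * exp (- \<theta>) * ((\<theta> / 2) ^ m /\<^sub>R fact m)
        = 2 ^ k * (exp (- \<theta>) * ((\<theta> / 2) ^ m / fact m))"
      by (simp only: divide_inverse real_scaleR_def mult_ac)
    ultimately show "pois \<theta> m \<le> 2 ^ k * exp (- \<theta>) * ((\<theta> / 2) ^ m /\<^sub>R fact m)"
      by (simp only:)
  qed
  also have "\<dots> \<le> 2 ^ k * exp (- \<theta>) * exp (\<theta> / 2)"
  proof -
    have "(\<Sum>m<k. (\<theta> / 2) ^ m /\<^sub>R fact m) \<le> (\<Sum>m. (\<theta> / 2) ^ m /\<^sub>R fact m)"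
      using assms by (intro sum_le_suminf summable_exp_generic) auto
    then have "(\<Sum>m<k. (\<theta> / 2) ^ m /\<^sub>R fact m) \<le> exp (\<theta> / 2)"
      by (simp only: exp_def)
    then show ?thesis unfolding sum_distrib_left[symmetric] by (intro mult_left_mono) auto
  qed
  also have "\<dots> \<le> exp 1 ^ k * exp (- \<theta>) * exp (\<theta> / 2)"
    using exp_ge_add_one_self[of 1] by (intro mult_right_mono power_mono) auto
  also have "\<dots> = exp (real k - \<theta> / 2)"
    by (simp add: exp_of_nat_mult[symmetric] exp_add[symmetric])
  finally show ?thesis .
qed

text \<open>The indices below \<open>k\<close> are simply discarded, at the cost of their total
  weight.\<close>

lemma pois_mixture_ge:
  assumes \<theta>: "0 \<le> \<theta>" and b: "0 \<le> b" and f: "\<And>m. 0 \<le> f m" "\<And>m. k \<le> m \<Longrightarrow> b \<le> f m"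
  shows "ennreal (b * (1 - exp (real k - \<theta> / 2))) \<le> (\<Sum>m. ennreal (pois \<theta> m * f m))"
proof -
  let ?a = "\<lambda>m. pois \<theta> m * b - (if m < k then pois \<theta> m * b else 0)"
  have "?a sums (1 * b - (\<Sum>m<k. pois \<theta> m * b))"
    using sums_If_finite_set[of "{..<k}" "\<lambda>m. pois \<theta> m * b"]
    by (intro sums_diff sums_mult2 pois_sums) simp
  then have a: "?a sums (b * (1 - (\<Sum>m<k. pois \<theta> m)))"
    by (simp add: sum_distrib_left algebra_simps)
  have "b * (1 - exp (real k - \<theta> / 2)) \<le> b * (1 - (\<Sum>m<k. pois \<theta> m))"
    using pois_lower_tail[OF \<theta>, of k] b by (intro mult_left_mono) auto
  then have "ennreal (b * (1 - exp (real k - \<theta> / 2))) \<le> ennreal (b * (1 - (\<Sum>m<k. pois \<theta> m)))"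
    by (rule ennreal_leI)
  also have "\<dots> = (\<Sum>m. ennreal (?a m))"
    using a b pois_nonneg[OF \<theta>] by (subst suminf_ennreal2) (auto simp: sums_iff)
  also have "\<dots> \<le> (\<Sum>m. ennreal (pois \<theta> m * f m))"
    using f b pois_nonneg[OF \<theta>] by (intro suminf_le ennreal_leI) (auto intro!: mult_left_mono)
  finally show ?thesis .
qed

text \<open>The weight of each multiple of \<open>n\<close> is at most the sum of the weights of its two neighbours,
  which are not multiples of \<open>n\<close>.\<close>

lemma pois_nondivisible:
  fixes c :: int
  assumes \<theta>: "1 \<le> \<theta>" and n: "n \<ge> 3"
  shows "1/2 \<le> (\<Sum>m. pois \<theta> m * of_bool (\<not> int n dvd c + int m))"
proof -
  \<comment> \<open>\<open>r 0\<close> carries the weights at multiples of \<open>n\<close>,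
    \<open>r (-1)\<close> those one above a multiple, and \<open>r 1\<close> those one
    below.\<close>
  define r where "r d m = pois \<theta> m * of_bool (int n dvd c + int m + d)" for d :: int and m
  define q where "q m = pois \<theta> m * of_bool (\<not> int n dvd c + int m)" for m
  have p0: "0 \<le> pois \<theta> m" for m using \<theta> by (simp add: pois_nonneg)
  have sp: "summable (pois \<theta>)" "suminf (pois \<theta>) = 1" using pois_sums by (auto simp: sums_iff)
  have sr: "summable (r d)" for d
    by (rule summable_comparison_test'[OF sp(1), of 0]) (use p0 in \<open>auto simp: r_def\<close>)
  have sq: "summable q"
    by (rule summable_comparison_test'[OF sp(1), of 0]) (use p0 in \<open>auto simp: q_def\<close>)
  have sr1: "summable (\<lambda>m. r d (Suc m))" for d
    using sr by (subst summable_Suc_iff)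
  then have sr2: "summable (\<lambda>m. r d (Suc (Suc m)))" for d
    by (subst summable_Suc_iff)
  have r0: "0 \<le> r d m" for d m using p0 by (simp add: r_def)
  have nb: "pois \<theta> (Suc k) \<le> pois \<theta> (Suc (Suc k)) + pois \<theta> k" for k
  proof -
    define x where "x = real k"
    have x: "0 \<le> x" by (simp add: x_def)
    \<comment> \<open>Divided by \<open>pois \<theta> k\<close>, the claim is a quadratic inequality
      in \<open>\<theta>\<close>; this is four times it, cleared of denominators and with the square
      completed.\<close>
    have "0 \<le> (2 * \<theta> - (x + 2))\<^sup>2 + (x + 2) * (3 * x + 2)" using x by simp
    then have "\<theta> * (x + 2) \<le> (x + 1) * (x + 2) + \<theta> * \<theta>"
      by (simp add: power2_eq_square algebra_simps)
    then have "\<theta> * (x + 2) / ((x + 1) * (x + 2)) \<le> ((x + 1) * (x + 2) + \<theta> * \<theta>) / ((x + 1) * (x + 2))"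
      using x by (intro divide_right_mono) auto
    then have "\<theta> / (x + 1) \<le> \<theta> * \<theta> / ((x + 1) * (x + 2)) + 1"
      using x by (simp add: add_divide_distrib)
    then have "pois \<theta> k * (\<theta> / (x + 1)) \<le> pois \<theta> k * (\<theta> * \<theta> / ((x + 1) * (x + 2)) + 1)"
      by (rule mult_left_mono[OF _ p0])
    then show ?thesis by (simp add: pois_Suc x_def algebra_simps)
  qed
  have "(\<Sum>m. r 0 m) = r 0 0 + (\<Sum>m. r 0 (Suc m))"
    using suminf_split_head[OF sr[of 0]] by simp
  also have "\<dots> \<le> r (-1) 1 + (\<Sum>m. r (-1) (Suc (Suc m)) + r 1 m)"
  proof (intro add_mono suminf_le)
    \<comment> \<open>Index 0 has only one neighbour, which must cover its weight alone; here
      \<open>1 \<le> \<theta>\<close>, coming from \<open>t \<ge> 1/n\<close>, enters.\<close>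
    have "pois \<theta> 0 \<le> pois \<theta> 1" using \<theta> by (simp add: pois_def)
    then show "r 0 0 \<le> r (-1) 1" by (simp add: r_def)
    show "r 0 (Suc m) \<le> r (-1) (Suc (Suc m)) + r 1 m" for m
      using nb[of m] by (simp add: r_def add_ac)
    show "summable (\<lambda>m. r 0 (Suc m))" by (rule sr1)
    show "summable (\<lambda>m. r (-1) (Suc (Suc m)) + r 1 m)"
      by (intro summable_add sr2 sr)
  qed
  also have "\<dots> = r (-1) 1 + (\<Sum>m. r (-1) (Suc (Suc m))) + (\<Sum>m. r 1 m)"
    using suminf_add[OF sr2[of "-1"] sr[of 1]] by simp
  also have "\<dots> \<le> (\<Sum>m. r (-1) m) + (\<Sum>m. r 1 m)"
    using suminf_split_head[OF sr[of "-1"]] suminf_split_head[OF sr1[of "-1"]] r0[of "-1" 0]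
    by simp
  also have "\<dots> = (\<Sum>m. r (-1) m + r 1 m)"
    using sr by (intro suminf_add)
  also have "\<dots> \<le> (\<Sum>m. q m)"
  proof (rule suminf_le)
    fix m
    \<comment> \<open>For \<open>n \<ge> 3\<close> the residues -1, 0 and 1 are distinct, so no
      weight in \<open>q\<close> is used for two multiples.\<close>
    have "\<not> (int n dvd a \<and> int n dvd a + 1)" "\<not> (int n dvd a \<and> int n dvd a - 1)"
      "\<not> (int n dvd a + 1 \<and> int n dvd a - 1)" for a :: int
    proof -
      have no: "\<not> int n dvd 1" "\<not> int n dvd 2"
        using n zdvd_imp_le[of "int n" 1] zdvd_imp_le[of "int n" 2] by auto
      show "\<not> (int n dvd a \<and> int n dvd a + 1)"
        using no(1) dvd_diff[of "int n" "a + 1" a] by auto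
      show "\<not> (int n dvd a \<and> int n dvd a - 1)"
        using no(1) dvd_diff[of "int n" a "a - 1"] by auto
      show "\<not> (int n dvd a + 1 \<and> int n dvd a - 1)"
        using no(2) dvd_diff[of "int n" "a + 1" "a - 1"] by auto
    qed
    from this[of "c + int m"] show "r (-1) m + r 1 m \<le> q m"
      using p0[of m] by (auto simp: r_def q_def of_bool_def)
  qed (use sr sq in \<open>auto intro!: summable_add\<close>)
  finally have "(\<Sum>m. r 0 m) \<le> (\<Sum>m. q m)" .
  moreover have "(\<Sum>m. r 0 m) + (\<Sum>m. q m) = 1"
  proof -
    have "(\<lambda>m. r 0 m + q m) = pois \<theta>" by (auto simp: r_def q_def)
    then show ?thesis using suminf_add[OF sr[of 0] sq] sp by simp
  qed
  ultimately show ?thesis unfolding q_def by linarith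
qed

section \<open>The lower bounds\<close>

locale cycle_load = load_model M "cycle_verts n" "cycle_edges n" S U X0 ori p + cycle_rule n ori p
  for M :: "'w measure" and n :: nat
    and S :: "nat set \<Rightarrow> nat \<Rightarrow> 'w \<Rightarrow> real" and U :: "nat set \<Rightarrow> nat \<Rightarrow> 'w \<Rightarrow> real"
    and X0 :: "'w \<Rightarrow> nat \<Rightarrow> int" and ori :: "nat set \<Rightarrow> nat \<times> nat" and p :: "nat set \<Rightarrow> int \<Rightarrow> real"
begin

abbreviation load :: "real \<Rightarrow> 'w \<Rightarrow> nat \<Rightarrow> int" where
  "load \<equiv> load_process (cycle_edges n) ori p S U X0"

abbreviation cgap :: "(nat \<Rightarrow> int) \<Rightarrow> int" where
  "cgap \<equiv> gap (cycle_verts n)"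

lemma abs_diff_le_gap: "u < n \<Longrightarrow> v < n \<Longrightarrow> x u - x v \<le> cgap x"
  unfolding gap_def cycle_verts_def by (intro diff_mono Max_ge Min_le) auto

lemma gap_nonneg: "0 \<le> cgap x"
  using abs_diff_le_gap[of 0 0 x] n3 by simp

lemma nn_integral_load_ge:
  assumes t: "0 \<le> t" and \<phi>: "\<And>x. 0 \<le> \<phi> x"
    and B: "\<And>x. B \<le> (\<Sum>m. ennreal (pois (real n * t) m * (mean_step ^^ m) \<phi> x))"
  shows "B \<le> (\<integral>\<^sup>+\<omega>. ennreal (\<phi> (load t \<omega>)) \<partial>M)"
  using B by (intro nn_integral_load_process_ge[OF t \<phi>]) (simp add: pois_def sum_cycle_edges(2)[OF n3])

text \<open>Fewer than \<open>k\<close> rings occur with probability at most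
  \<open>exp (k - n * t / 2)\<close>, which is tiny here. If \<open>m \<ge> k\<close> rings occur,
  the first \<open>m - k\<close> only change the start of the last \<open>k\<close>, and
  \<open>q\<close> is uniform in that start.\<close>

lemma load_lower:
  assumes t: "1000 \<le> real n * t" and k: "real k \<le> real n * t / 8"
    and \<phi>: "\<And>x. 0 \<le> \<phi> x" and q: "0 \<le> q" "\<And>x. q \<le> (mean_step ^^ k) \<phi> x"
  shows "ennreal (q * (249 / 250)) \<le> (\<integral>\<^sup>+\<omega>. ennreal (\<phi> (load t \<omega>)) \<partial>M)"
proof (rule nn_integral_load_ge[OF _ \<phi>])
  show "0 \<le> t"
  proof (rule ccontr)
    assume "\<not> 0 \<le> t"
    then have "real n * t \<le> 0" by (intro mult_nonneg_nonpos) auto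
    then show False using t by simp
  qed
  fix x
  have "exp (real k - real n * t / 2) \<le> exp (- 250)" using t k by simp
  also have "\<dots> \<le> 1 / 250"
    using exp_ge_add_one_self[of "250"] by (simp add: exp_minus field_simps)
  finally have "q * (249 / 250) \<le> q * (1 - exp (real k - real n * t / 2))"
    using q by (intro mult_left_mono) auto
  then have "ennreal (q * (249 / 250)) \<le> ennreal (q * (1 - exp (real k - real n * t / 2)))"
    by (rule ennreal_leI)
  also have "\<dots> \<le> (\<Sum>m. ennreal (pois (real n * t) m * (mean_step ^^ m) \<phi> x))"
  proof (rule pois_mixture_ge)
    show "0 \<le> real n * t" using t by simp
    show "0 \<le> (mean_step ^^ m) \<phi> x" for m by (rule funpow_mean_step_ge_const[OF \<phi>])
    fix m assume "k \<le> m"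
    then have "(mean_step ^^ m) \<phi> = (mean_step ^^ (m - k)) ((mean_step ^^ k) \<phi>)"
      using funpow_add[of "m - k" k mean_step] by simp
    then show "q \<le> (mean_step ^^ m) \<phi> x" using funpow_mean_step_ge_const[OF q(2)] by simp
  qed (rule q)
  finally show "ennreal (q * (249 / 250)) \<le> (\<Sum>m. ennreal (pois (real n * t) m * (mean_step ^^ m) \<phi> x))" .
qed

lemma mean_step_total:
  "(mean_step ^^ m) (\<lambda>x. g (\<Sum>v<n. x v)) x = (g ((\<Sum>v<n. x v) + int m) :: real)"
proof (induction m arbitrary: g)
  case (Suc m)
  have "edge_mean e (\<lambda>x. g (\<Sum>v<n. x v)) x = g ((\<Sum>v<n. x v) + 1)" if e: "e \<in> cycle_edges n" for e x
  proof -
    have "(\<Sum>v<n. (x(w := x w + 1)) v) = (\<Sum>v<n. x v) + 1" if "w < n" for w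
    proof -
      have "(\<Sum>v<n. (x(w := x w + 1)) v) = (\<Sum>v<n. x v + (if v = w then 1 else 0))"
        by (intro sum.cong) auto
      then show ?thesis using that by (simp add: sum.distrib)
    qed
    moreover have "fst (ori e) < n" "snd (ori e) < n"
      using edge_eq[OF e] e n3 by (auto simp: cycle_edges_def) (metis insert_iff mod_less_divisor singletonD lessThan_iff gr_zeroI not_numeral_le_zero)+
    ultimately show ?thesis by (simp add: edge_mean_def algebra_simps del: fun_upd_apply)
  qed
  then have "mean_step (\<lambda>x. g (\<Sum>v<n. x v)) = (\<lambda>x. g ((\<Sum>v<n. x v) + 1))"
    using card_pos by (simp add: mean_step_def fun_eq_iff)
  then show ?case using Suc[of "\<lambda>z. g (z + 1)"] by (simp add: funpow_swap1 algebra_simps)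
qed simp

text \<open>Without a positive gap all loads agree and \<open>n\<close> divides their total. By
  \<open>mean_step_total\<close> that total after \<open>m\<close> rings is the initial one plus
  \<open>m\<close>, so \<open>pois_nondivisible\<close> applies.\<close>

lemma gap_pos_half:
  assumes t: "1 / real n \<le> t"
  shows "ennreal (1/2) \<le> (\<integral>\<^sup>+\<omega>. ennreal (of_bool (1 \<le> cgap (load t \<omega>))) \<partial>M)"
proof (rule nn_integral_load_ge)
  have nt: "1 \<le> real n * t" using t n3 by (simp add: field_simps)
  show "0 \<le> t" using t by (smt (verit) divide_nonneg_nonneg of_nat_0_le_iff)
  fix x
  define N where "N m = pois (real n * t) m * of_bool (\<not> int n dvd (\<Sum>v<n. x v) + int m)" for m
  have N0: "0 \<le> N m" for m using nt by (simp add: N_def pois_nonneg)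
  have "summable N"
    by (rule summable_comparison_test'[OF sums_summable[OF pois_sums[of "real n * t"]], of 0])
       (use pois_nonneg[of "real n * t"] nt in \<open>auto simp: N_def\<close>)
  have "ennreal (1/2) \<le> ennreal (\<Sum>m. N m)"
    unfolding N_def by (intro ennreal_leI pois_nondivisible nt n3)
  also have "\<dots> = (\<Sum>m. ennreal (N m))"
    by (rule suminf_ennreal2[symmetric, OF N0 \<open>summable N\<close>])
  also have "\<dots> \<le> (\<Sum>m. ennreal (pois (real n * t) m * (mean_step ^^ m) (\<lambda>x. of_bool (1 \<le> cgap x)) x))"
  proof (intro suminf_le ennreal_leI)
    fix m
    have "of_bool (\<not> int n dvd (\<Sum>v<n. y v)) \<le> (of_bool (1 \<le> cgap y) :: real)" for y :: "nat \<Rightarrow> int"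
    proof (cases "1 \<le> cgap y")
      case False
      have eq: "y v = y 0" if "v < n" for v
        using abs_diff_le_gap[OF that, of 0 y] abs_diff_le_gap[of 0 v y] that False by auto
      have "(\<Sum>v<n. y v) = (\<Sum>v<n. y 0)" by (rule sum.cong[OF refl], rule eq) simp
      then have "int n dvd (\<Sum>v<n. y v)" by simp
      then show ?thesis by simp
    qed simp
    then have "(mean_step ^^ m) (\<lambda>y. of_bool (\<not> int n dvd (\<Sum>v<n. y v))) x
        \<le> (mean_step ^^ m) (\<lambda>x. of_bool (1 \<le> cgap x)) x"
      by (rule funpow_mean_step_mono)
    then show "N m \<le> pois (real n * t) m * (mean_step ^^ m) (\<lambda>x. of_bool (1 \<le> cgap x)) x"
      unfolding N_def mean_step_total[of m "\<lambda>z. of_bool (\<not> int n dvd z)"]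
      using nt by (intro mult_left_mono pois_nonneg) auto
  qed auto
  finally show "ennreal (1/2) \<le> (\<Sum>m. ennreal (pois (real n * t) m * (mean_step ^^ m) (\<lambda>x. of_bool (1 \<le> cgap x)) x))" .
qed simp

lemma gap_lower_bounds:
  fixes t :: real
  defines "R \<equiv> min (sqrt (real n)) (t powr (1/4))"
  assumes t: "1 / real n \<le> t" and c: "0 < c" "c \<le> 1/5500"
  shows "ennreal (c * R) \<le> (\<integral>\<^sup>+\<omega>. ennreal (real_of_int (cgap (load t \<omega>))) \<partial>M)"
    and "ennreal (1/8) \<le> (\<integral>\<^sup>+\<omega>. ennreal (of_bool (c * R \<le> real_of_int (cgap (load t \<omega>)))) \<partial>M)"
proof -
  have t0: "0 < t" using t n3 by (smt (verit) divide_pos_pos of_nat_0_less_iff zero_less_numeral less_le_trans)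
  have R0: "0 \<le> R" using t0 by (simp add: R_def)
  have cR: "c * R \<le> R / 5500" using mult_right_mono[OF c(2) R0] by simp
  have "ennreal (c * R) \<le> (\<integral>\<^sup>+\<omega>. ennreal (real_of_int (cgap (load t \<omega>))) \<partial>M)
    \<and> ennreal (1/8) \<le> (\<integral>\<^sup>+\<omega>. ennreal (of_bool (c * R \<le> real_of_int (cgap (load t \<omega>)))) \<partial>M)"
  \<comment> \<open>Up to this size the target \<open>c * R\<close> is below 1/2, so a gap of at
    least 1 with probability 1/2 is enough for both bounds.\<close>
  proof (cases "R \<le> 2500")
    case True
    then have c2: "c * R \<le> 1/2" using cR by simp
    have "ennreal (c * R) \<le> ennreal (1/2)" using c2 by (rule ennreal_leI)
    also note gap_pos_half[OF t]
    also have "(\<integral>\<^sup>+\<omega>. ennreal (of_bool (1 \<le> cgap (load t \<omega>))) \<partial>M)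
        \<le> (\<integral>\<^sup>+\<omega>. ennreal (real_of_int (cgap (load t \<omega>))) \<partial>M)"
      using gap_nonneg by (intro nn_integral_mono ennreal_leI) (auto simp: of_bool_def)
    finally have 1: "ennreal (c * R) \<le> (\<integral>\<^sup>+\<omega>. ennreal (real_of_int (cgap (load t \<omega>))) \<partial>M)" .
    have "ennreal (1/8) \<le> ennreal (1/2)" by (rule ennreal_leI) simp
    also note gap_pos_half[OF t]
    also have "(\<integral>\<^sup>+\<omega>. ennreal (of_bool (1 \<le> cgap (load t \<omega>))) \<partial>M)
        \<le> (\<integral>\<^sup>+\<omega>. ennreal (of_bool (c * R \<le> real_of_int (cgap (load t \<omega>)))) \<partial>M)"
    proof (intro nn_integral_mono ennreal_leI)
      fix \<omega>
      have "c * R \<le> real_of_int (cgap (load t \<omega>))" if "1 \<le> cgap (load t \<omega>)"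
        using that c2 by linarith
      then show "of_bool (1 \<le> cgap (load t \<omega>)) \<le> (of_bool (c * R \<le> real_of_int (cgap (load t \<omega>))) :: real)"
        by (simp add: of_bool_def)
    qed
    finally show ?thesis using 1 by blast
  next
    case False
    \<comment> \<open>From \<open>R\<^sup>2 \<le> n\<close> this gives
      \<open>400 * b \<le> n\<close>, and from \<open>R ^ 4 \<le> t\<close> it gives
      \<open>b\<^sup>2 \<le> t / 8\<close>. As \<open>R > 2500\<close>, rounding down costs at most
      a factor \<open>(99/100)\<^sup>2\<close>.\<close>
    define b where "b = nat \<lfloor>R\<^sup>2 / 400\<rfloor>"
    have R: "2500 < R" using False by simp
    have R2: "6250000 \<le> R\<^sup>2" using power_mono[of 2500 R 2] R by simp
    have b_le: "real b \<le> R\<^sup>2 / 400" using of_int_floor_le[of "R\<^sup>2 / 400"] by (simp add: b_def)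
    have "R\<^sup>2 / 400 - 1 \<le> real b" unfolding b_def by linarith
    then have b_ge: "(99/100)\<^sup>2 * (R\<^sup>2 / 400) \<le> real b" and b10: "10 \<le> b"
      using R2 by (simp_all add: power2_eq_square)
    have "R \<le> sqrt (real n)" by (simp add: R_def)
    then have Rn: "R\<^sup>2 \<le> real n" using R0 by (metis real_sqrt_le_iff real_sqrt_unique)
    have bn: "400 * b \<le> n" using b_le Rn by linarith
    have "R ^ 4 \<le> (t powr (1/4)) ^ 4" using R0 by (intro power_mono) (simp_all add: R_def)
    also have "\<dots> = t" using t0 by (simp add: powr_realpow[symmetric] powr_powr)
    finally have Rt: "R ^ 4 \<le> t" .
    have R4: "R ^ 4 = R\<^sup>2 * R\<^sup>2" by (simp add: power2_eq_square power4_eq_xxxx)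
    have "(real b)\<^sup>2 \<le> (R\<^sup>2 / 400)\<^sup>2" using b_le by (intro power_mono) auto
    also have "\<dots> = R ^ 4 / 160000" by (simp add: R4 power2_eq_square)
    finally have "(real b)\<^sup>2 \<le> t / 8" using Rt t0 by linarith
    then have k: "real (n * b\<^sup>2) \<le> real n * t / 8"
      using mult_left_mono[of "(real b)\<^sup>2" "t / 8" "real n"] by simp
    have "6250000 * 1 \<le> R\<^sup>2 * R\<^sup>2" using R2 by (intro mult_mono) auto
    then have "1000 \<le> t" using Rt R4 by linarith
    moreover have "1 * t \<le> real n * t" using t0 n3 by (intro mult_right_mono) auto
    ultimately have nt: "1000 \<le> real n * t" by linarith
    have "99/100 * (R / 20) = sqrt ((99/100)\<^sup>2 * (R\<^sup>2 / 400))"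
      using R0 by (simp add: real_sqrt_mult real_sqrt_divide)
    also have "\<dots> \<le> sqrt (real b)" using b_ge by simp
    finally have sb: "99/100 * (R / 20) \<le> sqrt (real b)" .
    have "c * R \<le> sqrt (real b) / 18 * (249/250)" using cR sb R0 by linarith
    then have "ennreal (c * R) \<le> ennreal (sqrt (real b) / 18 * (249/250))" by (rule ennreal_leI)
    also have "\<dots> \<le> (\<integral>\<^sup>+\<omega>. ennreal (real_of_int (cgap (load t \<omega>))) \<partial>M)"
      by (rule load_lower[OF nt k]) (use gap_nonneg mean_gap_lower[OF b10 bn] in auto)
    finally have 1: "ennreal (c * R) \<le> (\<integral>\<^sup>+\<omega>. ennreal (real_of_int (cgap (load t \<omega>))) \<partial>M)" .
    have "ennreal (1/8) \<le> ennreal (7/50 * (249/250))" by (rule ennreal_leI) simp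
    also have "\<dots> \<le> (\<integral>\<^sup>+\<omega>. ennreal (of_bool (sqrt (real b) / 180 \<le> real_of_int (cgap (load t \<omega>)))) \<partial>M)"
      by (rule load_lower[OF nt k]) (use prob_gap_lower[OF b10 bn] in auto)
    also have "\<dots> \<le> (\<integral>\<^sup>+\<omega>. ennreal (of_bool (c * R \<le> real_of_int (cgap (load t \<omega>)))) \<partial>M)"
    proof (intro nn_integral_mono ennreal_leI)
      fix \<omega>
      have "c * R \<le> real_of_int (cgap (load t \<omega>))" if "sqrt (real b) / 180 \<le> real_of_int (cgap (load t \<omega>))"
        using that cR sb R0 by linarith
      then show "of_bool (sqrt (real b) / 180 \<le> real_of_int (cgap (load t \<omega>)))
          \<le> (of_bool (c * R \<le> real_of_int (cgap (load t \<omega>))) :: real)"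
        by (simp add: of_bool_def)
    qed
    finally show ?thesis using 1 by blast
  qed
  then show "ennreal (c * R) \<le> (\<integral>\<^sup>+\<omega>. ennreal (real_of_int (cgap (load t \<omega>))) \<partial>M)"
    "ennreal (1/8) \<le> (\<integral>\<^sup>+\<omega>. ennreal (of_bool (c * R \<le> real_of_int (cgap (load t \<omega>)))) \<partial>M)"
    by blast+
qed

end

theorem theorem1p1:
  shows "\<exists>c::real. c > 0 \<and> c = 1 / (1024 * pi * sqrt 3) \<and>
    (\<forall>(n::nat) ori p (M :: 'w measure) S U X0 (t::real).
       n \<ge> 3 \<longrightarrow>
       endpoint_local_monotone_rule (cycle_edges n) ori p \<longrightarrow>
       clocks_and_marks M (cycle_verts n) (cycle_edges n) S U X0 \<longrightarrow>
       t \<ge> 1 / real n \<longrightarrow>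
       (\<integral>\<^sup>+\<omega>. ennreal (real_of_int
            (gap (cycle_verts n) (load_process (cycle_edges n) ori p S U X0 t \<omega>))) \<partial>M)
         \<ge> ennreal (c * min (sqrt (real n)) (t powr (1/4))) \<and>
       measure M {\<omega> \<in> space M.
            real_of_int (gap (cycle_verts n) (load_process (cycle_edges n) ori p S U X0 t \<omega>))
              \<ge> c * min (sqrt (real n)) (t powr (1/4))} \<ge> 1 / 8)"
proof (intro exI[of _ "1 / (1024 * pi * sqrt 3)"] conjI refl allI impI)
  let ?c = "1 / (1024 * pi * sqrt 3) :: real"
  show c0: "0 < ?c" by simp
  \<comment> \<open>\<open>1024 * pi * sqrt 3\<close> is about 5572; the approximations 1.73 and
    3.14 keep it above the rational bound 5500 of \<open>gap_lower_bounds\<close>.\<close>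
  have "(173/100 :: real)\<^sup>2 \<le> 3" by (simp add: power2_eq_square)
  then have "173/100 \<le> sqrt 3" by (rule real_le_rsqrt)
  moreover have "(157/50 :: real) \<le> pi" using pi_approx(1) by simp
  ultimately have "(157/50) * (173/100) \<le> pi * sqrt 3" by (intro mult_mono) auto
  then have c1: "?c \<le> 1/5500" by (simp add: field_simps)
  fix n :: nat and ori p and M :: "'w measure" and S U X0 and t :: real
  assume n: "n \<ge> 3" and rule: "endpoint_local_monotone_rule (cycle_edges n) ori p"
    and model: "clocks_and_marks M (cycle_verts n) (cycle_edges n) S U X0" and t: "t \<ge> 1 / real n"
  interpret clocks_and_marks M "cycle_verts n" "cycle_edges n" S U X0 by (rule model)
  interpret cycle_load M n S U X0 ori p
    by unfold_locales (use n rule in \<open>auto simp: cycle_edges_def cycle_verts_def lessThan_empty_iff\<close>)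
  show "ennreal (?c * min (sqrt (real n)) (t powr (1/4)))
      \<le> (\<integral>\<^sup>+\<omega>. ennreal (real_of_int
            (gap (cycle_verts n) (load_process (cycle_edges n) ori p S U X0 t \<omega>))) \<partial>M)"
    by (rule gap_lower_bounds(1)[OF t c0 c1])
  show "1 / 8 \<le> measure M {\<omega> \<in> space M. ?c * min (sqrt (real n)) (t powr (1/4))
      \<le> real_of_int (gap (cycle_verts n) (load_process (cycle_edges n) ori p S U X0 t \<omega>))}"
    by (rule prob_load_process_ge[OF gap_lower_bounds(2)[OF t c0 c1]])
qed

end
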